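(* Let $\Gamma=(V,E)$ be a simple connected graph (possibly infinite) of finite degree $d$ whose automorphism group acts transitively on $V$ and on $E$, and let $A\subseteq V$ be finite and nonempty. If $c(A)<2d$ and $|A|\le\frac12|V|$, then, letting $\Gamma'$ be the subgraph of $\Gamma$ induced by $A$, one of the following holds. 1. $\Gamma'$ is a single vertex. 2. $\Gamma'$ is a one-edge path. 3. $\Gamma$ is a cycle or a two-way infinite path, and $\Gamma'$ is a path. 4. $\Gamma$ is cubic and $\Gamma'$ is a 2-edge path. 5. $\Gamma\in\mathcal{LC}$ and $\Gamma'$ is a triangle. 6. $\Gamma$ is isomorphic to the Cube, Octahedron, Dodecahedron, Icosahedron, Petersen graph, or $K_6$, and $\Gamma'$ is a shortest cycle of $\Gamma$.
   Context: $\Gamma$ is $d$-regular. For $A\subseteq V$, $c(A)$ is the number of edges with exactly one endpoint in $A$. The line graph $L(\Upsilon)$ of $\Upsilon$ has vertex set $E(\Upsilon)$ with two edges adjacent iff they share an endpoint; $\mathcal{LC}$ is the class of graphs isomorphic to $L(\Upsilon)$ for some cubic graph $\Upsilon$ of girth at least $4$. Cube, Octahedron, Dodecahedron, Icosahedron denote the 1-skeleta of these Platonic solids. When $V$ is infinite the condition $|A|\le\frac12|V|$ is automatic. *)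

theory Defs
  imports "HOL-Analysis.Analysis"
begin

section \<open>Graphs\<close>

text \<open>A graph is a pair of a vertex set and a set of edges, an edge being the set of its two
  endpoints. Vertex and edge sets may be infinite.\<close>

type_synonym 'a graph = "'a set \<times> 'a set set"

abbreviation verts :: "'a graph \<Rightarrow> 'a set" where "verts G \<equiv> fst G"
abbreviation edges :: "'a graph \<Rightarrow> 'a set set" where "edges G \<equiv> snd G"

definition simple_graph :: "'a graph \<Rightarrow> bool" where
  "simple_graph G \<longleftrightarrow> (\<forall>e\<in>edges G. e \<subseteq> verts G \<and> card e = 2)"

definition connected_graph :: "'a graph \<Rightarrow> bool" where
  "connected_graph G \<longleftrightarrow>
     verts G \<noteq> {} \<and> (\<forall>u\<in>verts G. \<forall>v\<in>verts G. (u, v) \<in> {(x, y). {x, y} \<in> edges G}\<^sup>*)"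

text \<open>Finiteness is explicit because \<open>card\<close> is \<open>0\<close> on infinite sets.\<close>

definition regular_graph :: "nat \<Rightarrow> 'a graph \<Rightarrow> bool" where
  "regular_graph d G \<longleftrightarrow>
     (\<forall>v\<in>verts G. finite {e \<in> edges G. v \<in> e} \<and> card {e \<in> edges G. v \<in> e} = d)"

abbreviation cubic :: "'a graph \<Rightarrow> bool" where "cubic \<equiv> regular_graph 3"

definition graph_iso :: "('a \<Rightarrow> 'b) \<Rightarrow> 'a graph \<Rightarrow> 'b graph \<Rightarrow> bool" where
  "graph_iso f G H \<longleftrightarrow> bij_betw f (verts G) (verts H) \<and> edges H = (\<lambda>e. f ` e) ` edges G"

definition isomorphic :: "'a graph \<Rightarrow> 'b graph \<Rightarrow> bool" where
  "isomorphic G H \<longleftrightarrow> (\<exists>f. graph_iso f G H)"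

definition vertex_transitive :: "'a graph \<Rightarrow> bool" where
  "vertex_transitive G \<longleftrightarrow> (\<forall>u\<in>verts G. \<forall>v\<in>verts G. \<exists>f. graph_iso f G G \<and> f u = v)"

definition edge_transitive :: "'a graph \<Rightarrow> bool" where
  "edge_transitive G \<longleftrightarrow> (\<forall>e\<in>edges G. \<forall>e'\<in>edges G. \<exists>f. graph_iso f G G \<and> f ` e = e')"

definition cut_size :: "'a graph \<Rightarrow> 'a set \<Rightarrow> nat" where
  "cut_size G A = card {e \<in> edges G. card (e \<inter> A) = 1}"

definition induced :: "'a graph \<Rightarrow> 'a set \<Rightarrow> 'a graph" where
  "induced G A = (A, {e \<in> edges G. e \<subseteq> A})"

definition subgraph :: "'a graph \<Rightarrow> 'a graph \<Rightarrow> bool" where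
  "subgraph H G \<longleftrightarrow> simple_graph H \<and> verts H \<subseteq> verts G \<and> edges H \<subseteq> edges G"


section \<open>Paths, cycles and girth\<close>

text \<open>The path with \<open>k\<close> edges, hence \<open>k + 1\<close> vertices.\<close>

definition path_graph :: "nat \<Rightarrow> nat graph" where
  "path_graph k = ({..k}, {{i, i + 1} |i. i < k})"

definition two_way_infinite_path :: "int graph" where
  "two_way_infinite_path = (UNIV, {{i, i + 1} |i. True})"

text \<open>This is a cycle only for \<open>n \<ge> 3\<close>.\<close>

definition cycle_graph :: "nat \<Rightarrow> nat graph" where
  "cycle_graph n = ({..<n}, {{i, (i + 1) mod n} |i. i < n})"

definition is_cycle :: "'a graph \<Rightarrow> nat \<Rightarrow> bool" where
  "is_cycle G n \<longleftrightarrow> n \<ge> 3 \<and> isomorphic G (cycle_graph n)"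

text \<open>The girth of an acyclic graph is \<open>\<infinity>\<close>.\<close>

definition girth :: "'a graph \<Rightarrow> enat" where
  "girth G = Inf {enat n |n. \<exists>C. subgraph C G \<and> is_cycle C n}"

definition shortest_cycle :: "'a graph \<Rightarrow> 'a graph \<Rightarrow> bool" where
  "shortest_cycle C G \<longleftrightarrow> subgraph C G \<and> (\<exists>n. is_cycle C n \<and> enat n = girth G)"


section \<open>Line graphs\<close>

definition line_graph :: "'a graph \<Rightarrow> 'a set graph" where
  "line_graph G =
     (edges G, {{e, e'} |e e'. e \<in> edges G \<and> e' \<in> edges G \<and> e \<noteq> e' \<and> e \<inter> e' \<noteq> {}})"

text \<open>The cubic graph whose line graph is \<open>G\<close> is required to have its vertices in \<^typ>\<open>'a set\<close>.
  This is no restriction: a vertex of the cubic graph is determined by the set of its incident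
  edges, which correspond to vertices of \<open>G\<close>. See \<open>cubic_line_graphI\<close> below.\<close>

definition cubic_line_graph :: "'a graph \<Rightarrow> bool" where
  "cubic_line_graph G \<longleftrightarrow>
     (\<exists>Y :: 'a set graph. simple_graph Y \<and> cubic Y \<and> girth Y \<ge> 4 \<and> isomorphic G (line_graph Y))"


section \<open>Particular graphs\<close>

definition complete_graph :: "nat \<Rightarrow> nat graph" where
  "complete_graph n = ({..<n}, {e. e \<subseteq> {..<n} \<and> card e = 2})"

text \<open>The Petersen graph is the Kneser graph on the 2-subsets of a 5-set.\<close>

definition petersen_graph :: "nat set graph" where
  "petersen_graph =
     (let P = {s. s \<subseteq> {..<5} \<and> card s = 2}
      in (P, {{s, t} |s t. s \<in> P \<and> t \<in> P \<and> s \<inter> t = {}}))"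

text \<open>The 1-skeleton of a polytope. If \<open>closed_segment u v\<close> is an edge then \<open>u \<noteq> v\<close> and both are
  extreme points.\<close>

definition skeleton :: "'a::euclidean_space set \<Rightarrow> 'a graph" where
  "skeleton P = ({v. v extreme_point_of P}, {{u, v} |u v. closed_segment u v edge_of P})"

definition golden :: real where
  "golden = (1 + sqrt 5) / 2"

definition cube :: "(real^3) set" where
  "cube = convex hull {vector [a, b, c] |a b c. {a, b, c} \<subseteq> {-1, 1}}"

definition octahedron :: "(real^3) set" where
  "octahedron = convex hull (\<Union>a\<in>{-1, 1}. {vector [a, 0, 0], vector [0, a, 0], vector [0, 0, a]})"

definition icosahedron :: "(real^3) set" where
  "icosahedron = convex hull (\<Union>a\<in>{-1, 1}. \<Union>b\<in>{-golden, golden}.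
     {vector [0, a, b], vector [a, b, 0], vector [b, 0, a]})"

definition dodecahedron :: "(real^3) set" where
  "dodecahedron = convex hull ({vector [a, b, c] |a b c. {a, b, c} \<subseteq> {-1, 1}} \<union>
     (\<Union>a\<in>{-1 / golden, 1 / golden}. \<Union>b\<in>{-golden, golden}.
       {vector [0, a, b], vector [a, b, 0], vector [b, 0, a]}))"


section \<open>Independence of the vertex type of the cubic graph\<close>

lemma graph_iso_sym:
  assumes "simple_graph G" "graph_iso f G H"
  shows "graph_iso (inv_into (verts G) f) H G"
proof -
  let ?g = "inv_into (verts G) f"
  have b: "bij_betw f (verts G) (verts H)" and E: "edges H = (\<lambda>e. f ` e) ` edges G"
    using assms by (auto simp: graph_iso_def)
  have "?g ` f ` e = e" if "e \<in> edges G" for e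
    using that assms(1) b unfolding simple_graph_def bij_betw_def
    by (meson inv_into_image_cancel)
  then have "(\<lambda>e. ?g ` e) ` edges H = edges G"
    unfolding E by (force simp: image_iff)
  then show ?thesis
    using b by (simp add: graph_iso_def bij_betw_inv_into)
qed

lemma graph_iso_trans:
  "graph_iso f G H \<Longrightarrow> graph_iso g H K \<Longrightarrow> graph_iso (g \<circ> f) G K"
  unfolding graph_iso_def by (auto simp: bij_betw_trans image_comp)

lemma simple_graph_iso:
  assumes "simple_graph G" "graph_iso f G H"
  shows "simple_graph H"
proof -
  have b: "bij_betw f (verts G) (verts H)" and E: "edges H = (\<lambda>e. f ` e) ` edges G"
    using assms by (auto simp: graph_iso_def)
  have "f ` e \<subseteq> verts H \<and> card (f ` e) = 2" if "e \<in> edges G" for e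
  proof -
    have e: "e \<subseteq> verts G" "card e = 2"
      using that assms(1) by (auto simp: simple_graph_def)
    then have "inj_on f e" using b by (meson bij_betw_def inj_on_subset)
    then show ?thesis using e b by (auto simp: card_image bij_betw_def)
  qed
  then show ?thesis by (auto simp: simple_graph_def E)
qed

lemma regular_graph_iso:
  assumes "simple_graph G" "graph_iso f G H" "regular_graph d G"
  shows "regular_graph d H"
  unfolding regular_graph_def
proof
  fix w assume "w \<in> verts H"
  have b: "bij_betw f (verts G) (verts H)" and E: "edges H = (\<lambda>e. f ` e) ` edges G"
    using assms by (auto simp: graph_iso_def)
  obtain v where v: "v \<in> verts G" "w = f v"
    using \<open>w \<in> verts H\<close> b by (auto simp: bij_betw_def)
  have sub: "edges G \<subseteq> Pow (verts G)"
    using assms(1) by (auto simp: simple_graph_def)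
  have mem: "f v \<in> f ` e \<longleftrightarrow> v \<in> e" if "e \<in> edges G" for e
    using that sub b v(1) by (meson PowD bij_betw_def inj_on_image_mem_iff subsetD)
  then have eq: "{e \<in> edges H. w \<in> e} = (\<lambda>e. f ` e) ` {e \<in> edges G. v \<in> e}"
    unfolding E v(2) by blast
  have "inj_on (\<lambda>e. f ` e) (edges G)"
    using b sub by (meson bij_betw_def inj_on_image_Pow inj_on_subset)
  then have "inj_on (\<lambda>e. f ` e) {e \<in> edges G. v \<in> e}"
    by (rule inj_on_subset) auto
  then show "finite {e \<in> edges H. w \<in> e} \<and> card {e \<in> edges H. w \<in> e} = d"
    using assms(3) v(1) unfolding eq regular_graph_def by (simp add: card_image)
qed

lemma girth_iso_le:
  assumes "graph_iso f G H"
  shows "girth H \<le> girth G"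
proof -
  have b: "bij_betw f (verts G) (verts H)" and E: "edges H = (\<lambda>e. f ` e) ` edges G"
    using assms by (auto simp: graph_iso_def)
  have "\<exists>D. subgraph D H \<and> is_cycle D n" if C: "subgraph C G" "is_cycle C n" for C n
  proof -
    let ?D = "(f ` verts C, (\<lambda>e. f ` e) ` edges C)"
    have s: "simple_graph C" and sub: "verts C \<subseteq> verts G" "edges C \<subseteq> edges G"
      using C(1) by (auto simp: subgraph_def)
    have "inj_on f (verts C)"
      using sub b by (meson bij_betw_def inj_on_subset)
    then have iso: "graph_iso f C ?D"
      by (simp add: graph_iso_def bij_betw_def)
    have "subgraph ?D H"
      using simple_graph_iso[OF s iso] sub b by (auto simp: subgraph_def E bij_betw_def)
    moreover have "is_cycle ?D n"
      using C(2) graph_iso_trans[OF graph_iso_sym[OF s iso]]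
      unfolding is_cycle_def isomorphic_def by blast
    ultimately show ?thesis by blast
  qed
  then show ?thesis
    unfolding girth_def by (intro Inf_superset_mono) blast
qed

lemma line_graph_iso:
  assumes "simple_graph G" "graph_iso f G H"
  shows "graph_iso (\<lambda>e. f ` e) (line_graph G) (line_graph H)"
proof -
  have b: "bij_betw f (verts G) (verts H)" and E: "edges H = (\<lambda>e. f ` e) ` edges G"
    using assms by (auto simp: graph_iso_def)
  have sub: "edges G \<subseteq> Pow (verts G)"
    using assms(1) by (auto simp: simple_graph_def)
  have inj: "inj_on (\<lambda>e. f ` e) (edges G)"
    using b sub by (meson bij_betw_def inj_on_image_Pow inj_on_subset)
  have meet: "f ` e \<inter> f ` e' = {} \<longleftrightarrow> e \<inter> e' = {}" if "e \<in> edges G" "e' \<in> edges G" for e e'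
  proof -
    have "f ` (e \<inter> e') = f ` e \<inter> f ` e'"
      using that sub b by (intro inj_on_image_Int[where C = "verts G"]) (auto simp: bij_betw_def)
    then show ?thesis by auto
  qed
  have "edges (line_graph H) = (\<lambda>x. (\<lambda>e. f ` e) ` x) ` edges (line_graph G)" (is "?L = ?R")
  proof
    show "?L \<subseteq> ?R"
    proof
      fix x assume "x \<in> ?L"
      then obtain e e' where x: "x = {f ` e, f ` e'}" "e \<in> edges G" "e' \<in> edges G"
          "f ` e \<noteq> f ` e'" "f ` e \<inter> f ` e' \<noteq> {}"
        by (auto simp: line_graph_def E)
      then have "e \<noteq> e'" "e \<inter> e' \<noteq> {}" using meet by blast+
      then have "{e, e'} \<in> edges (line_graph G)"
        unfolding line_graph_def snd_conv mem_Collect_eq using x(2,3)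
        by (intro exI[of _ e] exI[of _ e']) simp
      then show "x \<in> ?R" using x(1) by (intro image_eqI[where x = "{e, e'}"]) auto
    qed
    show "?R \<subseteq> ?L"
    proof
      fix x assume "x \<in> ?R"
      then obtain e e' where x: "x = {f ` e, f ` e'}" "e \<in> edges G" "e' \<in> edges G"
          "e \<noteq> e'" "e \<inter> e' \<noteq> {}"
        by (auto simp: line_graph_def)
      moreover have "f ` e \<noteq> f ` e'" using x inj by (meson inj_on_eq_iff)
      moreover have "f ` e \<inter> f ` e' \<noteq> {}" using x meet by blast
      ultimately show "x \<in> ?L" unfolding line_graph_def E by auto
    qed
  qed
  then show ?thesis
    using inj by (simp add: graph_iso_def bij_betw_def line_graph_def E)
qed

lemma cubic_line_graphI:
  fixes G :: "'a graph" and Y :: "'b graph"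
  assumes s: "simple_graph Y" and c: "cubic Y" and g: "girth Y \<ge> 4"
    and i: "isomorphic G (line_graph Y)"
  shows "cubic_line_graph G"
proof -
  obtain f where f: "graph_iso f G (line_graph Y)"
    using i by (auto simp: isomorphic_def)
  then have b: "bij_betw f (verts G) (edges Y)"
    by (auto simp: graph_iso_def line_graph_def)
  define h where "h v = {x \<in> verts G. v \<in> f x}" for v
  have "inj_on h (verts Y)"
  proof (rule inj_onI, rule ccontr)
    fix v w assume vw: "v \<in> verts Y" "w \<in> verts Y" "h v = h w" "v \<noteq> w"
    have "e = {v, w}" if e: "e \<in> edges Y" "v \<in> e" for e
    proof -
      obtain x where "x \<in> verts G" "f x = e" using e(1) bij_betw_imp_surj_on[OF b] by (metis imageE)
      then have "w \<in> e" using vw(3) e by (auto simp: h_def)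
      moreover have "card e = 2" using s e by (auto simp: simple_graph_def)
      ultimately show ?thesis using e(2) vw(4) by (auto simp: card_2_iff)
    qed
    then have "card {e \<in> edges Y. v \<in> e} \<le> card {{v, w}}"
      by (intro card_mono) auto
    then show False using c vw(1) by (simp add: regular_graph_def)
  qed
  then have iso: "graph_iso h Y (h ` verts Y, (\<lambda>e. h ` e) ` edges Y)" (is "graph_iso h Y ?Z")
    by (simp add: graph_iso_def bij_betw_def)
  have "girth ?Z \<ge> 4"
    using g girth_iso_le[OF graph_iso_sym[OF s iso]] by (rule order_trans)
  then show ?thesis
    unfolding cubic_line_graph_def isomorphic_def
    using simple_graph_iso[OF s iso] regular_graph_iso[OF s iso c]
      graph_iso_trans[OF f line_graph_iso[OF s iso]] by blast
qed

end

theory Submission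
  imports Defs
begin

text \<open>The cut function \<open>c\<close> is submodular. Among the sets with at least \<open>n\<close> vertices that minimise
  \<open>c\<close>, take one, \<open>A\<close>, with fewest vertices. By edge-transitivity some translate \<open>B\<close> of \<open>A\<close> crosses
  \<open>A\<close>, and uncrossing the two sets forces \<open>\<bar>A - B\<bar> < n\<close> and \<open>\<bar>A \<inter> B\<bar> < n\<close>. For \<open>n = 3\<close> this
  yields, from any set with \<open>c < 2 d\<close> and at least three vertices, one with three or four vertices;
  hence \<open>d \<le> 5\<close>, and the graph has triangles unless \<open>d \<le> 3\<close>. Edge-transitivity makes the number of
  triangles on an edge, and in the cubic case the numbers of 4-cycles and 5-cycles through a 2-path,
  constant. These numbers determine the graph, except that the graphs with \<open>d = 4\<close> and one triangle
  on each edge are the line graphs in \<open>LC\<close> and that no set with at least three vertices other than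
  a 2-path occurs in the remaining cubic graphs. Uncrossing with \<open>n = 4\<close> and \<open>n = 6\<close> then bounds \<open>A\<close>.\<close>

section \<open>Skeleta of the Platonic solids\<close>

text \<open>Since \<open>c A\<close> is \<open>d * card A\<close> minus twice the number of edges
  inside \<open>A\<close>, the bound \<open>c A < 2 * d\<close> asks for many inner edges, which a
  lack of short cycles forbids; this leaves few local structures. One uncrossing only bounds a
  smallest minimiser, by \<open>2 * n - 2\<close> vertices, and says nothing of larger sets with the
  same cut. These are treated by a further uncrossing whose \<open>n\<close> is just above a size
  already understood: 4 above a triangle or a 2-path, 6 above a pentagon. The bound \<open>k\<close>
  remains one that holds for all separating sets with three vertices, as it is applied to the union
  of the two sets. In the small finite graphs the condition that \<open>A\<close> has at most half
  of the vertices gives its size instead. The graphs are found as tables of neighbours, whereas the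
  skeleta are defined by faces of convex hulls; \<open>label_graph\<close> is the common reference.
  Once the named vertices are distinct, a full table is closed under neighbours and connectedness
  makes it everything. Distinctness is the hard point for the icosahedron and the
  dodecahedron.\<close>

text \<open>On a sphere, the pairs of points of \<open>S\<close> with the largest inner product span edges of the convex
  hull. No other pair \<open>u, v\<close> does if \<open>v - u\<close> is a nonnegative combination of the differences between
  \<open>u\<close> and its neighbours: a supporting hyperplane at the segment would contain these neighbours.\<close>

lemma convex_cone_open_halfspace:
  "convex_cone (insert 0 {x. a \<bullet> x < (0::real)})"
  unfolding convex_cone_iff
  by (auto simp: inner_add_right mult_pos_neg intro: add_neg_neg mult_pos_neg)

lemma skeleton_spherical:
  fixes S :: "'a::euclidean_space set"
  assumes fin: "finite S" and R: "\<And>u. u \<in> S \<Longrightarrow> u \<bullet> u = R" and "k < R"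
    and le: "\<And>u v. u \<in> S \<Longrightarrow> v \<in> S \<Longrightarrow> u \<noteq> v \<Longrightarrow> u \<bullet> v \<le> k"
    and cone: "\<And>u v. u \<in> S \<Longrightarrow> v \<in> S \<Longrightarrow> u \<bullet> v < k \<Longrightarrow>
      v - u \<in> convex_cone hull ((\<lambda>n. n - u) ` {n \<in> S. u \<bullet> n = k})"
  shows "skeleton (convex hull S) = (S, {{u, v} |u v. u \<in> S \<and> v \<in> S \<and> u \<bullet> v = k})"
proof -
  have face: "convex hull {x \<in> S. a \<bullet> x = b} face_of convex hull S"
    if ab: "\<And>x. x \<in> S \<Longrightarrow> a \<bullet> x \<le> b" for a b
  proof -
    have "convex hull S \<subseteq> {x. a \<bullet> x \<le> b}"
      using ab by (intro hull_minimal) (auto simp: convex_halfspace_le)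
    then have F: "(convex hull S \<inter> {x. a \<bullet> x = b}) face_of convex hull S"
      by (intro face_of_Int_supporting_hyperplane_le) auto
    then obtain S' where S': "S' \<subseteq> S" "convex hull S \<inter> {x. a \<bullet> x = b} = convex hull S'"
      using face_of_convex_hull_subset fin finite_imp_compact by metis
    have "convex hull S' \<subseteq> convex hull {x \<in> S. a \<bullet> x = b}"
      using S' hull_subset[of S' convex] by (intro hull_mono) auto
    moreover have "convex hull {x \<in> S. a \<bullet> x = b} \<subseteq> convex hull S \<inter> {x. a \<bullet> x = b}"
      by (intro hull_minimal) (auto simp: hull_inc convex_Int convex_hyperplane)
    ultimately show ?thesis using F S' by auto
  qed
  have ext: "v extreme_point_of convex hull S \<longleftrightarrow> v \<in> S" for v
  proof
    assume v: "v \<in> S"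
    then have "v \<bullet> x \<le> R" if "x \<in> S" for x
      using that R le \<open>k < R\<close> by (metis dual_order.trans less_eq_real_def)
    moreover have "{x \<in> S. v \<bullet> x = R} = {v}"
      using v R le \<open>k < R\<close> by force
    ultimately show "v extreme_point_of convex hull S"
      using face[of v R] by (simp add: face_of_singleton)
  qed (rule extreme_point_of_convex_hull)
  have edge: "closed_segment u v edge_of convex hull S \<longleftrightarrow> u \<in> S \<and> v \<in> S \<and> u \<bullet> v = k" for u v
  proof
    assume uv: "u \<in> S \<and> v \<in> S \<and> u \<bullet> v = k"
    then have ne: "u \<noteq> v" using R \<open>k < R\<close> by auto
    have uv': "u \<bullet> u = R" "v \<bullet> v = R" "v \<bullet> u = k" using uv R by (auto simp: inner_commute)
    \<comment> \<open>The functional \<open>u + v\<close> attains its maximum \<open>R + k\<close>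
      over \<open>S\<close> exactly at \<open>u\<close> and \<open>v\<close>, which makes the
      segment a face.\<close>
    have lt: "(u + v) \<bullet> x < R + k" if x: "x \<in> S" "x \<noteq> u" "x \<noteq> v" for x
      using le[of u x] le[of v x] uv x \<open>k < R\<close> by (simp add: inner_add_left)
    then have "(u + v) \<bullet> x \<le> R + k" if "x \<in> S" for x
      using that uv uv' by (cases "x = u \<or> x = v") (auto simp: inner_add_left less_imp_le)
    moreover have "{x \<in> S. (u + v) \<bullet> x = R + k} = {u, v}"
      using uv uv' lt by (force simp: inner_add_left)
    ultimately have "closed_segment u v face_of convex hull S"
      using face[of "u + v" "R + k"] by (simp add: segment_convex_hull)
    moreover have "aff_dim (closed_segment u v) = 1"
      using ne by (simp add: segment_convex_hull aff_dim_convex_hull aff_dim_2)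
    ultimately show "closed_segment u v edge_of convex hull S" by (simp add: edge_of_def)
  next
    assume E: "closed_segment u v edge_of convex hull S"
    then have F: "closed_segment u v face_of convex hull S"
      and ad: "aff_dim (closed_segment u v) = 1"
      by (auto simp: edge_of_def)
    have ne: "u \<noteq> v" using ad by auto
    have seg: "x \<in> closed_segment u v \<and> x \<in> S \<longleftrightarrow> x = u \<or> x = v" for x
      using extreme_point_of_face[OF F, of x] ext extreme_point_of_segment by blast
    then have uv: "u \<in> S" "v \<in> S" by auto
    have "\<not> u \<bullet> v < k"
    proof
      assume lt: "u \<bullet> v < k"
      \<comment> \<open>Faces of a polyhedron are exposed, so some supporting hyperplane meets the
        hull exactly in the segment. The neighbours of \<open>u\<close> lie strictly on one side of
        it, and with them the cone that contains \<open>v - u\<close>.\<close>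
      obtain a b where ab: "convex hull S \<subseteq> {x. a \<bullet> x \<le> b}"
          "closed_segment u v = convex hull S \<inter> {x. a \<bullet> x = b}"
        using F
          exposed_face_of_polyhedron[OF polyhedron_convex_hull[OF fin], of "closed_segment u v"]
        unfolding exposed_face_of_def by blast
      have au: "a \<bullet> u = b" "a \<bullet> v = b" using ab(2) by auto
      have "a \<bullet> (n - u) < 0" if n: "n \<in> S" "u \<bullet> n = k" for n
      proof -
        have "n \<noteq> u" "n \<noteq> v" using n R uv lt \<open>k < R\<close> by auto
        then have "n \<notin> closed_segment u v" using seg n by blast
        then show ?thesis using ab n hull_inc[of n S] au by (force simp: inner_diff_right)
      qed
      then have "convex_cone hull ((\<lambda>n. n - u) ` {n \<in> S. u \<bullet> n = k}) \<subseteq> insert 0 {x. a \<bullet> x < 0}"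
        by (intro hull_minimal convex_cone_open_halfspace) auto
      then show False
        using cone[OF uv lt] ne au by (auto simp: inner_diff_right)
    qed
    then show "u \<in> S \<and> v \<in> S \<and> u \<bullet> v = k"
      using le[OF uv ne] uv by simp
  qed
  show ?thesis unfolding skeleton_def ext edge by simp
qed

text \<open>The pair \<open>(a, b)\<close> encodes the number \<open>a + b \<phi>\<close> of the ring \<open>\<int>[\<phi>]\<close>, where \<open>\<phi>\<close> is the golden
  ratio, and a triple of such pairs encodes a point of space.\<close>

type_synonym zphi = "int \<times> int"
type_synonym zpoint = "zphi \<times> zphi \<times> zphi"

fun zval :: "zphi \<Rightarrow> real" where "zval (a, b) = of_int a + of_int b * golden"
fun zadd :: "zphi \<Rightarrow> zphi \<Rightarrow> zphi" where "zadd (a, b) (a', b') = (a + a', b + b')"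
fun zsub :: "zphi \<Rightarrow> zphi \<Rightarrow> zphi" where "zsub (a, b) (a', b') = (a - a', b - b')"
text \<open>The product is reduced with \<open>golden * golden = golden + 1\<close>.\<close>

fun zmul :: "zphi \<Rightarrow> zphi \<Rightarrow> zphi" where
  "zmul (a, b) (a', b') = (a * a' + b * b', a * b' + b * a' + b * b')"

text \<open>A sufficient test only, based on \<open>8 / 5 < \<phi> < 17 / 10\<close>.\<close>

fun znonneg :: "zphi \<Rightarrow> bool" where
  "znonneg (a, b) \<longleftrightarrow> 0 \<le> 5 * a + 8 * b \<and> 0 \<le> 10 * a + 17 * b"

fun zpt :: "zpoint \<Rightarrow> real^3" where "zpt (x, y, z) = vector [zval x, zval y, zval z]"
fun zdiff :: "zpoint \<Rightarrow> zpoint \<Rightarrow> zpoint" where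
  "zdiff (x, y, z) (x', y', z') = (zsub x x', zsub y y', zsub z z')"
fun zinner :: "zpoint \<Rightarrow> zpoint \<Rightarrow> zphi" where
  "zinner (x, y, z) (x', y', z') = zadd (zmul x x') (zadd (zmul y y') (zmul z z'))"
fun zcross :: "zpoint \<Rightarrow> zpoint \<Rightarrow> zpoint" where
  "zcross (x, y, z) (x', y', z') =
     (zsub (zmul y z') (zmul z y'), zsub (zmul z x') (zmul x z'), zsub (zmul x y') (zmul y x'))"

lemma golden_square: "golden * golden = golden + 1"
proof -
  have "sqrt 5 * sqrt 5 = (5::real)" by simp
  then show ?thesis unfolding golden_def by (simp add: field_simps)
qed

lemma golden_bounds: "8 / 5 < golden" "golden < 17 / 10"
proof -
  have "(11 / 5)\<^sup>2 < (5::real)" "(5::real) < (12 / 5)\<^sup>2" by (simp_all add: power2_eq_square)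
  then have "11 / 5 < sqrt 5" "sqrt 5 < 12 / 5"
    using real_less_rsqrt[of "11 / 5" 5] real_less_lsqrt[of "12 / 5" 5] by simp_all
  then show "8 / 5 < golden" "golden < 17 / 10" by (simp_all add: golden_def)
qed

lemma golden_inverse: "1 / golden = golden - 1"
  using golden_square golden_bounds by (simp add: field_simps)

lemma zval_simps:
  "zval (zadd x y) = zval x + zval y" "zval (zsub x y) = zval x - zval y"
  "zval (zmul x y) = zval x * zval y"
proof -
  obtain a b a' b' where xy: "x = (a, b)" "y = (a', b')" by fastforce
  have g: "b * golden * (b' * golden) = b * b' * (golden + 1)" for b b' :: real
    using golden_square by (metis mult.assoc mult.left_commute)
  show "zval (zmul x y) = zval x * zval y"
    unfolding xy by (simp add: algebra_simps) (use g[of b b'] in \<open>simp add: algebra_simps\<close>)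
qed (cases x; cases y; simp add: algebra_simps)+

text \<open>\<open>a + b x\<close> is linear in \<open>x\<close>; the test checks it at 8/5 and
  17/10, and \<phi> lies between them.\<close>

lemma znonneg: "znonneg x \<Longrightarrow> 0 \<le> zval x"
proof (cases x)
  case (Pair a b)
  assume "znonneg x"
  then have ab: "0 \<le> 5 * a + 8 * b" "0 \<le> 10 * a + 17 * b" using Pair by auto
  show ?thesis
  proof (cases "0 \<le> b")
    case True
    have "0 \<le> real_of_int (5 * a + 8 * b)" using ab(1) by linarith
    moreover have "8 / 5 * real_of_int b \<le> golden * real_of_int b"
      using True golden_bounds by (intro mult_right_mono) auto
    ultimately show ?thesis using Pair by (simp add: mult.commute)
  next
    case False
    have "0 \<le> real_of_int (10 * a + 17 * b)" using ab(2) by linarith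
    moreover have "17 / 10 * real_of_int b \<le> golden * real_of_int b"
      using False golden_bounds by (intro mult_right_mono_neg) auto
    ultimately show ?thesis using Pair by (simp add: mult.commute)
  qed
qed

text \<open>A linear function that is nonnegative at both ends of an interval and vanishes strictly
  inside it is zero.\<close>

lemma zpos:
  assumes "znonneg x" "x \<noteq> (0, 0)"
  shows "0 < zval x"
proof -
  obtain a b where x: "x = (a, b)" by fastforce
  have ab: "0 \<le> 5 * a + 8 * b" "0 \<le> 10 * a + 17 * b" using assms x by auto
  have "zval x \<noteq> 0"
  proof
    assume "zval x = 0"
    then have z: "real_of_int a = - (real_of_int b * golden)" using x by simp
    have "b = 0"
    proof (rule linorder_cases[of b 0])
      assume "b < 0"
      then have "real_of_int b * (17 / 10) < real_of_int b * golden"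
        using golden_bounds by (intro mult_strict_left_mono_neg) auto
      then have "real_of_int (10 * a + 17 * b) < 0" using z by simp
      then show ?thesis using ab(2) by linarith
    next
      assume "b > 0"
      then have "real_of_int b * (8 / 5) < real_of_int b * golden"
        using golden_bounds by (intro mult_strict_left_mono) auto
      then have "real_of_int (5 * a + 8 * b) < 0" using z by simp
      then show ?thesis using ab(1) by linarith
    qed
    then show False using z assms x by simp
  qed
  then show ?thesis using znonneg[OF assms(1)] by simp
qed

lemma zinner: "zpt p \<bullet> zpt q = zval (zinner p q)"
  by (cases p rule: prod_cases3; cases q rule: prod_cases3)
    (simp add: inner_vec_def sum_3 zval_simps del: zval.simps zadd.simps zmul.simps)

lemma zdiff: "zpt (zdiff p q) = zpt p - zpt q"
  by (cases p rule: prod_cases3; cases q rule: prod_cases3)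
    (simp add: vec_eq_iff forall_3 zval_simps del: zval.simps zsub.simps)

text \<open>Cramer's rule: the coefficients of \<open>w\<close> in the basis \<open>a, b, c\<close> are quotients of
  triple products.\<close>

fun zcone :: "zpoint \<Rightarrow> zpoint \<Rightarrow> zpoint \<Rightarrow> zpoint \<Rightarrow> bool" where
  "zcone w a b c \<longleftrightarrow> (let D = zinner a (zcross b c) in
     znonneg D \<and> D \<noteq> (0, 0) \<and> znonneg (zinner w (zcross b c)) \<and>
     znonneg (zinner w (zcross c a)) \<and> znonneg (zinner w (zcross a b)))"

lemma zcone:
  assumes "zcone w a b c" and "zpt a \<in> X" "zpt b \<in> X" "zpt c \<in> X"
  shows "zpt w \<in> convex_cone hull X"
proof -
  define D where "D = zval (zinner a (zcross b c))"
  define f where "f = zval (zinner w (zcross b c)) / D"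
  define g where "g = zval (zinner w (zcross c a)) / D"
  define h where "h = zval (zinner w (zcross a b)) / D"
  have D: "0 < D" using assms(1) zpos by (auto simp: D_def Let_def)
  have fgh: "0 \<le> f" "0 \<le> g" "0 \<le> h"
    using assms(1) D znonneg by (auto simp: f_def g_def h_def Let_def)
  have Dfgh: "D * f = zval (zinner w (zcross b c))" "D * g = zval (zinner w (zcross c a))"
      "D * h = zval (zinner w (zcross a b))"
    using D by (simp_all add: f_def g_def h_def del: zinner.simps zcross.simps zval.simps)
  have "D *\<^sub>R zpt w = (D * f) *\<^sub>R zpt a + (D * g) *\<^sub>R zpt b + (D * h) *\<^sub>R zpt c"
    unfolding Dfgh unfolding D_def
    by (cases w rule: prod_cases3; cases a rule: prod_cases3; cases b rule: prod_cases3;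
        cases c rule: prod_cases3)
      (simp add: vec_eq_iff forall_3 zval_simps algebra_simps
        del: zval.simps zadd.simps zsub.simps zmul.simps)
  also have "\<dots> = D *\<^sub>R (f *\<^sub>R zpt a + g *\<^sub>R zpt b + h *\<^sub>R zpt c)"
    by (simp add: scaleR_add_right)
  finally have "zpt w = f *\<^sub>R zpt a + g *\<^sub>R zpt b + h *\<^sub>R zpt c"
    using D by simp
  then show ?thesis
    using assms fgh by (simp add: convex_cone_hull_add convex_cone_hull_mul hull_inc)
qed

text \<open>Row \<open>i\<close> lists the neighbours of label \<open>i\<close>. Both the skeleta
  and the abstract graphs are shown isomorphic to such a table, which can be evaluated.\<close>

definition label_graph :: "nat list list \<Rightarrow> nat graph" where
  "label_graph T = ({..<length T}, {{i, j} |i j. i < length T \<and> j \<in> set (T ! i)})"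

text \<open>An executable certificate for the hypotheses of \<open>skeleton_spherical\<close>:
  \<open>R\<close> is the squared length of all points, \<open>k\<close> the inner product of
  adjacent ones, and for each nonadjacent pair three neighbours of \<open>P ! i\<close> span a cone
  that contains the direction to \<open>P ! j\<close>.\<close>

definition zcheck :: "zpoint list \<Rightarrow> nat list list \<Rightarrow> zphi \<Rightarrow> zphi \<Rightarrow> bool" where
  "zcheck P T R k \<longleftrightarrow> length P = length T \<and> znonneg (zsub R k) \<and> zsub R k \<noteq> (0, 0) \<and>
     (\<forall>i\<in>set [0..<length T]. zinner (P ! i) (P ! i) = R \<and> i \<notin> set (T ! i) \<and>
       (\<forall>j\<in>set (T ! i). j < length T \<and> zinner (P ! i) (P ! j) = k) \<and>
       (\<forall>j\<in>set [0..<length T]. j = i \<or> j \<in> set (T ! i) \<or>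
         zinner (P ! i) (P ! j) \<noteq> k \<and> znonneg (zsub k (zinner (P ! i) (P ! j))) \<and>
         (\<exists>a\<in>set (T ! i). \<exists>b\<in>set (T ! i). \<exists>c\<in>set (T ! i).
           zcone (zdiff (P ! j) (P ! i)) (zdiff (P ! a) (P ! i))
             (zdiff (P ! b) (P ! i)) (zdiff (P ! c) (P ! i)))))"

lemma zcheck_skeleton:
  assumes "zcheck P T R k"
  shows "isomorphic (label_graph T) (skeleton (convex hull (zpt ` set P)))"
proof -
  define n where "n = length T"
  define p where "p i = zpt (P ! i)" for i
  have len: "length P = n" and Rk: "zval k < zval R"
    using assms zpos[of "zsub R k"] by (auto simp: zcheck_def n_def zval_simps simp del: zval.simps)
  have R: "p i \<bullet> p i = zval R" and irr: "i \<notin> set (T ! i)" if "i < n" for i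
    using assms that by (auto simp: zcheck_def n_def zinner p_def simp del: zval.simps)
  have nb: "j < n" "p i \<bullet> p j = zval k" if "i < n" "j \<in> set (T ! i)" for i j
    using assms that by (auto simp: zcheck_def n_def zinner p_def simp del: zval.simps)
  have far: "p i \<bullet> p j < zval k \<and>
      p j - p i \<in> convex_cone hull ((\<lambda>l. p l - p i) ` set (T ! i))"
    if "i < n" "j < n" "i \<noteq> j" "j \<notin> set (T ! i)" for i j
  proof -
    have ij: "i \<in> set [0..<length T]" "j \<in> set [0..<length T]" using that by (auto simp: n_def)
    note check = assms[unfolded zcheck_def, THEN conjunct2, THEN conjunct2, THEN conjunct2,
        THEN bspec, OF ij(1), THEN conjunct2, THEN conjunct2, THEN conjunct2, THEN bspec, OF ij(2)]
    have *: "zinner (P ! i) (P ! j) \<noteq> k" "znonneg (zsub k (zinner (P ! i) (P ! j)))"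
      "\<exists>a\<in>set (T ! i). \<exists>b\<in>set (T ! i). \<exists>c\<in>set (T ! i).
           zcone (zdiff (P ! j) (P ! i)) (zdiff (P ! a) (P ! i))
             (zdiff (P ! b) (P ! i)) (zdiff (P ! c) (P ! i))"
      using check that(3,4) by (elim disjE; blast)+
    have "zsub k (zinner (P ! i) (P ! j)) \<noteq> (0, 0)"
      using *(1) by (cases k; cases "zinner (P ! i) (P ! j)") auto
    then have "p i \<bullet> p j < zval k"
      using zpos[OF *(2)] by (simp add: zval_simps zinner p_def del: zval.simps)
    moreover have "p j - p i \<in> convex_cone hull ((\<lambda>l. p l - p i) ` set (T ! i))"
    proof -
      obtain a b c where abc: "a \<in> set (T ! i)" "b \<in> set (T ! i)" "c \<in> set (T ! i)"
        "zcone (zdiff (P ! j) (P ! i)) (zdiff (P ! a) (P ! i))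
          (zdiff (P ! b) (P ! i)) (zdiff (P ! c) (P ! i))"
        using *(3) by blast
      show ?thesis
        using zcone[OF abc(4), of "(\<lambda>l. p l - p i) ` set (T ! i)"] abc(1-3)
        unfolding zdiff p_def by blast
    qed
    ultimately show ?thesis ..
  qed
  have S: "zpt ` set P = p ` {..<n}"
    using len by (auto simp: p_def set_conv_nth)
  have le: "p i \<bullet> p j \<le> zval k" if "i < n" "j < n" "i \<noteq> j" for i j
    using far[OF that] nb[OF that(1)] by (cases "j \<in> set (T ! i)") auto
  have inj: "inj_on p {..<n}"
  proof (rule inj_onI, rule ccontr)
    fix i j assume ij: "i \<in> {..<n}" "j \<in> {..<n}" "p i = p j" "i \<noteq> j"
    then show False using le[of i j] R[of i] Rk by simp
  qed
  have adj: "p i \<bullet> p j = zval k \<longleftrightarrow> j \<in> set (T ! i)" if "i < n" "j < n" for i j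
    using far[OF that] nb[OF that(1), of j] R[OF that(1)] irr[OF that(1)] Rk
    by (cases "i = j"; cases "j \<in> set (T ! i)") auto
  have sk: "skeleton (convex hull (p ` {..<n})) =
      (p ` {..<n}, {{u, v} |u v. u \<in> p ` {..<n} \<and> v \<in> p ` {..<n} \<and> u \<bullet> v = zval k})"
  proof (rule skeleton_spherical)
    fix u v assume "u \<in> p ` {..<n}" "v \<in> p ` {..<n}" "u \<bullet> v < zval k"
    then obtain i j where ij: "u = p i" "v = p j" "i < n" "j < n" by auto
    then have "i \<noteq> j" "j \<notin> set (T ! i)" using \<open>u \<bullet> v < zval k\<close> R Rk adj by force+
    then have "v - u \<in> convex_cone hull ((\<lambda>l. p l - p i) ` set (T ! i))"
      using far ij by blast
    moreover have "(\<lambda>l. p l - p i) ` set (T ! i) \<subseteq> (\<lambda>m. m - u) ` {m \<in> p ` {..<n}. u \<bullet> m = zval k}"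
      using ij nb by auto
    ultimately show "v - u \<in> convex_cone hull ((\<lambda>m. m - u) ` {m \<in> p ` {..<n}. u \<bullet> m = zval k})"
      using hull_mono by blast
  qed (use R le Rk in auto)
  have "graph_iso p (label_graph T) (skeleton (convex hull (p ` {..<n})))"
    unfolding graph_iso_def sk label_graph_def fst_conv snd_conv n_def[symmetric]
  proof
    show "bij_betw p {..<n} (p ` {..<n})" using inj by (simp add: bij_betw_def)
    show "{{u, v} |u v. u \<in> p ` {..<n} \<and> v \<in> p ` {..<n} \<and> u \<bullet> v = zval k} =
        (`) p ` {{i, j} |i j. i < n \<and> j \<in> set (T ! i)}" (is "?L = ?R")
    proof (intro set_eqI iffI)
      fix x assume "x \<in> ?L"
      then obtain i j where "x = {p i, p j}" "i < n" "j \<in> set (T ! i)" using adj by auto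
      then show "x \<in> ?R" by (intro image_eqI[of _ _ "{i, j}"]) auto
    next
      fix x assume "x \<in> ?R"
      then obtain i j where "x = {p i, p j}" "i < n" "j \<in> set (T ! i)" by auto
      then show "x \<in> ?L" using nb by blast
    qed
  qed
  then show ?thesis unfolding S isomorphic_def by blast
qed

section \<open>Coordinates and neighbour tables of the solids\<close>

definition cube_points :: "zpoint list" where
  "cube_points = [
    ((1, 0), (1, 0), (1, 0)), ((1, 0), (1, 0), (-1, 0)), ((1, 0), (-1, 0), (1, 0)),
     ((-1, 0), (1, 0), (1, 0)), ((1, 0), (-1, 0), (-1, 0)), ((-1, 0), (1, 0), (-1, 0)),
     ((-1, 0), (-1, 0), (1, 0)), ((-1, 0), (-1, 0), (-1, 0))]"

text \<open>Here and in the other tables the labels follow the order in which the abstract graph is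
  later explored: a vertex, its neighbours, the further vertices, and for the cube the antipode
  last. The points are listed in the same order.\<close>

definition cube_table :: "nat list list" where
  "cube_table =
     [[1, 2, 3], [0, 4, 5], [0, 4, 6], [0, 5, 6], [1, 2, 7], [1, 3, 7], [2, 3, 7], [4, 5, 6]]"

definition octahedron_points :: "zpoint list" where
  "octahedron_points = [
    ((1, 0), (0, 0), (0, 0)), ((0, 0), (1, 0), (0, 0)), ((0, 0), (0, 0), (1, 0)),
     ((0, 0), (-1, 0), (0, 0)), ((0, 0), (0, 0), (-1, 0)), ((-1, 0), (0, 0), (0, 0))]"

definition octahedron_table :: "nat list list" where
  "octahedron_table =
     [[1, 2, 3, 4], [0, 2, 4, 5], [0, 1, 3, 5], [0, 2, 4, 5], [0, 1, 3, 5], [1, 2, 3, 4]]"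

definition icosahedron_points :: "zpoint list" where
  "icosahedron_points = [
    ((0, 0), (1, 0), (0, 1)), ((1, 0), (0, 1), (0, 0)), ((0, 1), (0, 0), (1, 0)),
     ((0, 0), (-1, 0), (0, 1)), ((0, -1), (0, 0), (1, 0)), ((-1, 0), (0, 1), (0, 0)),
     ((0, 1), (0, 0), (-1, 0)), ((1, 0), (0, -1), (0, 0)), ((-1, 0), (0, -1), (0, 0)),
     ((0, -1), (0, 0), (-1, 0)), ((0, 0), (1, 0), (0, -1)), ((0, 0), (-1, 0), (0, -1))]"

definition icosahedron_table :: "nat list list" where
  "icosahedron_table =
     [[1, 2, 3, 4, 5], [0, 2, 5, 6, 10], [0, 3, 1, 7, 6], [0, 4, 2, 8, 7], [0, 5, 3, 9, 8],
     [0, 1, 4, 10, 9], [1, 2, 7, 10, 11], [2, 3, 8, 6, 11], [3, 4, 9, 7, 11], [4, 5, 10, 8,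
     11], [5, 1, 6, 9, 11], [6, 7, 8, 9, 10]]"

text \<open>The pair \<open>(-1, 1)\<close> encodes 1/\<phi>, as 1/\<phi> = \<phi> - 1. The four
  groups of five points are a face, its outer neighbours, the next ring and the opposite face; in
  the proof they are called \<open>A\<close>, \<open>B\<close>, \<open>C\<close> and
  \<open>D\<close>.\<close>

definition dodecahedron_points :: "zpoint list" where
  "dodecahedron_points = [
    ((1, 0), (1, 0), (1, 0)), ((0, 0), (-1, 1), (0, 1)), ((-1, 0), (1, 0), (1, 0)),
     ((1, -1), (0, 1), (0, 0)), ((-1, 1), (0, 1), (0, 0)), ((0, 1), (0, 0), (-1, 1)),
     ((0, 0), (1, -1), (0, 1)), ((0, -1), (0, 0), (-1, 1)), ((-1, 0), (1, 0), (-1, 0)),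
     ((1, 0), (1, 0), (-1, 0)), ((1, 0), (-1, 0), (1, 0)), ((-1, 0), (-1, 0), (1, 0)),
     ((0, -1), (0, 0), (1, -1)), ((0, 0), (-1, 1), (0, -1)), ((0, 1), (0, 0), (1, -1)),
     ((-1, 1), (0, -1), (0, 0)), ((1, -1), (0, -1), (0, 0)), ((-1, 0), (-1, 0), (-1, 0)),
     ((0, 0), (1, -1), (0, -1)), ((1, 0), (-1, 0), (-1, 0))]"

definition dodecahedron_table :: "nat list list" where
  "dodecahedron_table =
     [[1, 4, 5], [2, 0, 6], [3, 1, 7], [4, 2, 8], [0, 3, 9], [0, 10, 14], [1, 11, 10], [2, 12,
     11], [3, 13, 12], [4, 14, 13], [5, 6, 15], [6, 7, 16], [7, 8, 17], [8, 9, 18], [9, 5,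
     19], [10, 16, 19], [11, 17, 15], [12, 18, 16], [13, 19, 17], [14, 15, 18]]"

lemma cube_points: "cube = convex hull (zpt ` set cube_points)"
proof -
  have "{vector [a, b, c] |a b c. {a, b, c} \<subseteq> {-1, 1::real}} = zpt ` set cube_points"
    unfolding cube_points_def by auto
  then show ?thesis by (simp add: cube_def)
qed

lemma octahedron_points: "octahedron = convex hull (zpt ` set octahedron_points)"
proof -
  have "(\<Union>a\<in>{-1, 1::real}. {vector [a, 0, 0], vector [0, a, 0], vector [0, 0, a]}) =
      zpt ` set octahedron_points"
    unfolding octahedron_points_def by auto
  then show ?thesis by (simp only: octahedron_def)
qed

lemma icosahedron_points: "icosahedron = convex hull (zpt ` set icosahedron_points)"
proof -
  have "(\<Union>a\<in>{-1, 1}. \<Union>b\<in>{-golden, golden}.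
      {vector [0, a, b], vector [a, b, 0], vector [b, 0, a]}) = zpt ` set icosahedron_points"
    unfolding icosahedron_points_def by auto
  then show ?thesis by (simp only: icosahedron_def)
qed

lemma dodecahedron_points: "dodecahedron = convex hull (zpt ` set dodecahedron_points)"
proof -
  have g: "1 / golden = golden - 1" "-1 / golden = 1 - golden"
    using golden_inverse by (simp_all add: minus_divide_left[symmetric])
  have "{vector [a, b, c] |a b c. {a, b, c} \<subseteq> {-1, 1::real}} \<union>
     (\<Union>a\<in>{-1 / golden, 1 / golden}. \<Union>b\<in>{-golden, golden}.
       {vector [0, a, b], vector [a, b, 0], vector [b, 0, a]}) = zpt ` set dodecahedron_points"
    unfolding dodecahedron_points_def g by auto
  then show ?thesis by (simp only: dodecahedron_def)
qed

text \<open>\<open>R\<close> is the squared radius and \<open>k\<close> the inner product of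
  adjacent vertices; the rest is evaluation.\<close>

lemma cube_skeleton: "isomorphic (label_graph cube_table) (skeleton cube)"
  unfolding cube_points by (rule zcheck_skeleton[where R = "(3, 0)" and k = "(1, 0)"]) code_simp

lemma octahedron_skeleton: "isomorphic (label_graph octahedron_table) (skeleton octahedron)"
  unfolding octahedron_points
  by (rule zcheck_skeleton[where R = "(1, 0)" and k = "(0, 0)"]) code_simp

lemma icosahedron_skeleton: "isomorphic (label_graph icosahedron_table) (skeleton icosahedron)"
  unfolding icosahedron_points
  \<comment> \<open>The points have squared length 1 + \<phi>^2 = 2 + \<phi>, and adjacent ones have
    inner product \<phi>.\<close>
  by (rule zcheck_skeleton[where R = "(2, 1)" and k = "(0, 1)"]) code_simp

lemma dodecahedron_skeleton:
  "isomorphic (label_graph dodecahedron_table) (skeleton dodecahedron)"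
  unfolding dodecahedron_points
  \<comment> \<open>Adjacent vertices have inner product \<phi> + 1/\<phi> = 2 \<phi> - 1.\<close>
  by (rule zcheck_skeleton[where R = "(3, 0)" and k = "(-1, 2)"]) code_simp

lemma card_Diff_Int: "finite A \<Longrightarrow> card A = card (A - B) + card (A \<inter> B)"
  by (metis card_Diff_subset_Int card_mono finite_Int inf_le1 le_add_diff_inverse2)

lemma not_le_singleton: "1 < card S \<Longrightarrow> \<exists>z. z \<in> S \<and> z \<noteq> k"
  using card_mono[of "{k}" S] by fastforce

section \<open>Paths, cycles and tables of neighbours\<close>

lemma edges_path_graph:
  "i < Suc k \<Longrightarrow> j < Suc k \<Longrightarrow> {i, j} \<in> edges (path_graph k) \<longleftrightarrow> j = Suc i \<or> i = Suc j"
  by (auto simp: path_graph_def doubleton_eq_iff)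

lemma simple_path_graph: "simple_graph (path_graph k)"
  by (auto simp: simple_graph_def path_graph_def)

lemma edges_cycle_graph:
  "i < n \<Longrightarrow> j < n \<Longrightarrow>
    {i, j} \<in> edges (cycle_graph n) \<longleftrightarrow> j = (i + 1) mod n \<or> i = (j + 1) mod n"
  by (auto simp: cycle_graph_def doubleton_eq_iff)

lemma simple_cycle_graph: "2 \<le> n \<Longrightarrow> simple_graph (cycle_graph n)"
  by (auto simp: simple_graph_def cycle_graph_def mod_Suc)

lemma subgraph_cycle:
  assumes "subgraph C G" "is_cycle C n"
  obtains w where "inj_on w {..<n}" "\<And>i. i < n \<Longrightarrow> w i \<in> verts G"
    "\<And>i. i < n \<Longrightarrow> {w i, w ((i + 1) mod n)} \<in> edges G"
proof -
  have s: "simple_graph C" "verts C \<subseteq> verts G" "edges C \<subseteq> edges G"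
    using assms(1) by (auto simp: subgraph_def)
  obtain f where f: "graph_iso f C (cycle_graph n)"
    using assms(2) by (auto simp: is_cycle_def isomorphic_def)
  define w where "w = inv_into (verts C) f"
  have w: "graph_iso w (cycle_graph n) C" unfolding w_def by (rule graph_iso_sym[OF s(1) f])
  have b: "bij_betw w {..<n} (verts C)" and e: "edges C = (`) w ` edges (cycle_graph n)"
    using w by (auto simp: graph_iso_def cycle_graph_def)
  show ?thesis
  proof
    show "inj_on w {..<n}" using b by (simp add: bij_betw_def)
    show "w i \<in> verts G" if "i < n" for i using b s that by (auto simp: bij_betw_def)
    fix i assume i: "i < n"
    then have "{i, (i + 1) mod n} \<in> edges (cycle_graph n)" by (auto simp: cycle_graph_def)
    then have "w ` {i, (i + 1) mod n} \<in> edges G" using e s by blast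
    then show "{w i, w ((i + 1) mod n)} \<in> edges G" by simp
  qed
qed

text \<open>Normal forms for indices, used when a fact proved for every \<open>i\<close> is
  instantiated at a shifted index.\<close>

lemma int_shift:
  fixes i :: int
  shows "i + 1 + 1 = i + 2" "i + 1 - 1 = i" "i - 1 + 1 = i" "i + 2 - 1 = i + 1" "i + 2 + 1 = i + 3"
    "i + 1 + 2 = i + 3" "i - 1 + 2 = i + 1" "i - 1 - 1 = i - 2" "i + 1 - 2 = i - 1"
      "i - 2 + 1 = i - 1"
    "i - 1 + 5 = i + 4" "i + 1 + 5 = i + 6" "i + 2 - 2 = i" "i - 2 + 2 = i" "i + 2 + 2 = i + 4"
    "i - 2 + 5 = i + 3" "i + 3 + 1 = i + 4" "i + 5 + 1 = i + 6" "i + 5 - 1 = i + 4"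
      "i + 3 - 1 = i + 2"
  by simp_all

text \<open>Integer indices of period 5 make \<open>i - 1\<close> and \<open>i + 2\<close>
  meaningful without wrap-around; \<open>cyc5_all\<close> reduces a fact about all \<open>i\<close>
  to the five rotations.\<close>

definition cyc5 :: "'a \<Rightarrow> 'a \<Rightarrow> 'a \<Rightarrow> 'a \<Rightarrow> 'a \<Rightarrow> int \<Rightarrow> 'a" where
  "cyc5 p q r s u i = [p, q, r, s, u] ! nat (i mod 5)"

lemma cyc5_vals:
  "cyc5 p q r s u 0 = p" "cyc5 p q r s u 1 = q" "cyc5 p q r s u 2 = r" "cyc5 p q r s u 3 = s"
  "cyc5 p q r s u 4 = u"
  by (simp_all add: cyc5_def)

lemma cyc5_period: "cyc5 p q r s u (i + 5) = cyc5 p q r s u i"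
  by (simp add: cyc5_def)

lemma cyc5_all:
  assumes "P p q r s u" "P q r s u p" "P r s u p q" "P s u p q r" "P u p q r s"
  shows "P (cyc5 p q r s u i) (cyc5 p q r s u (i + 1)) (cyc5 p q r s u (i + 2))
    (cyc5 p q r s u (i - 2)) (cyc5 p q r s u (i - 1))"
proof -
  have "i mod 5 = 0 \<or> i mod 5 = 1 \<or> i mod 5 = 2 \<or> i mod 5 = 3 \<or> i mod 5 = 4" by presburger
  moreover have "(i + k) mod 5 = (i mod 5 + k) mod 5" "(i - k) mod 5 = (i mod 5 - k) mod 5" for k
    by (simp_all add: mod_add_left_eq mod_diff_left_eq)
  ultimately show ?thesis
    unfolding cyc5_def using assms by (elim disjE) simp_all
qed

lemma mem_Int_iff: "A \<inter> X = B \<Longrightarrow> y \<in> X \<Longrightarrow> y \<in> A \<longleftrightarrow> y \<in> B"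
  by blast

definition petersen_table :: "nat list list" where
  "petersen_table =
     [[1, 2, 3], [0, 4, 5], [0, 6, 7], [0, 8, 9], [1, 6, 8], [1, 7, 9], [2, 4, 9], [2, 5, 8], [3, 4, 7],
     [3, 5, 6]]"

lemma petersen_isomorphic: "isomorphic (label_graph petersen_table) petersen_graph"
proof -
  \<comment> \<open>Label 0 is one pair, labels 1 to 3 are the pairs disjoint from it, and 4 to 9
    are the further neighbours of these, two for each.\<close>
  define p :: "nat \<Rightarrow> nat set" where
    "p i = [{0, 1}, {2, 3}, {2, 4}, {3, 4}, {0, 4}, {1, 4}, {1, 3}, {0, 3}, {1, 2}, {0, 2}] ! i"
    for i
  have lt10: "{..<10::nat} = {0, 1, 2, 3, 4, 5, 6, 7, 8, 9}" by auto
  have lt5: "{..<5::nat} = {0, 1, 2, 3, 4}" by auto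
  have P: "{s. s \<subseteq> {..<5} \<and> card s = 2} = p ` {..<10}"
  proof (intro set_eqI iffI)
    fix s assume "s \<in> {s. s \<subseteq> {..<5::nat} \<and> card s = 2}"
    then obtain x y where "s = {x, y}" "x \<noteq> y" "x \<in> {0, 1, 2, 3, 4}" "y \<in> {0, 1, 2, 3, 4}"
      unfolding lt5 by (auto simp: card_2_iff)
    then show "s \<in> p ` {..<10}"
      unfolding lt10 by (elim insertE emptyE) (simp_all add: p_def insert_commute)
  next
    fix s assume "s \<in> p ` {..<10}"
    then show "s \<in> {s. s \<subseteq> {..<5} \<and> card s = 2}"
      unfolding lt10 by (elim imageE insertE emptyE) (simp_all add: p_def)
  qed
  have inj: "inj_on p {..<10}"
    unfolding lt10 inj_on_def p_def by (simp add: doubleton_eq_iff)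
  have adj: "p i \<inter> p j = {} \<longleftrightarrow> j \<in> set (petersen_table ! i)" if "i < 10" "j < 10" for i j
  proof -
    have "i \<in> {0, 1, 2, 3, 4, 5, 6, 7, 8, 9}" "j \<in> {0, 1, 2, 3, 4, 5, 6, 7, 8, 9}"
      using that unfolding lt10[symmetric] by auto
    then show ?thesis
      by (elim insertE emptyE) (simp_all add: p_def petersen_table_def)
  qed
  have tab: "j < 10" if "i < 10" "j \<in> set (petersen_table ! i)" for i j
  proof -
    have "i \<in> {0, 1, 2, 3, 4, 5, 6, 7, 8, 9}" using that unfolding lt10[symmetric] by auto
    then show ?thesis using that(2)
      by (elim insertE emptyE) (auto simp: petersen_table_def)
  qed
  have len: "length petersen_table = 10" by (simp add: petersen_table_def)
  have "graph_iso p (label_graph petersen_table) petersen_graph"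
    unfolding graph_iso_def petersen_graph_def Let_def label_graph_def fst_conv snd_conv len P
  proof
    show "bij_betw p {..<10} (p ` {..<10})" using inj by (simp add: bij_betw_def)
    show "{{s, t} |s t. s \<in> p ` {..<10} \<and> t \<in> p ` {..<10} \<and> s \<inter> t = {}} =
        (`) p ` {{i, j} |i j. i < 10 \<and> j \<in> set (petersen_table ! i)}" (is "?L = ?R")
    proof (intro set_eqI iffI)
      fix x assume "x \<in> ?L"
      then obtain i j where "x = {p i, p j}" "i < 10" "j \<in> set (petersen_table ! i)"
        using adj by auto
      then show "x \<in> ?R" by (intro image_eqI[of _ _ "{i, j}"]) auto
    next
      fix x assume "x \<in> ?R"
      then obtain i j where ij: "x = {p i, p j}" "i < 10" "j \<in> set (petersen_table ! i)" by auto
      then have "j < 10" "p i \<inter> p j = {}" using tab adj by auto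
      then show "x \<in> ?L" using ij by blast
    qed
  qed
  then show ?thesis unfolding isomorphic_def by blast
qed

text \<open>Some walk from \<open>i\<close> to \<open>j\<close> in the graph with neighbour table \<open>T\<close> shows that \<open>i\<close> and \<open>j\<close> cannot
  be identified by a local isomorphism to a graph of girth at least 5 in which every 2-path lies in
  a unique pentagon. In the last case a walk of length 5 from \<open>i\<close> to \<open>j\<close> leaves the pentagon
  through its first two edges.\<close>

definition spread :: "nat list list \<Rightarrow> nat \<Rightarrow> nat \<Rightarrow> bool" where
  "spread T i j \<longleftrightarrow> j \<in> set (T ! i) \<or>
     (\<exists>a\<in>set (T ! i). (j \<noteq> i \<and> j \<in> set (T ! a)) \<or>
       (\<exists>b\<in>set (T ! a). b \<noteq> i \<and> ((j \<noteq> a \<and> j \<in> set (T ! b)) \<or>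
         (\<exists>k\<in>set (T ! b). k \<noteq> a \<and> ((j \<noteq> b \<and> j \<in> set (T ! k)) \<or>
           (\<exists>l\<in>set (T ! k). l \<noteq> b \<and> j \<noteq> k \<and> j \<in> set (T ! l) \<and>
             (\<exists>k'\<in>set (T ! b). k' \<noteq> a \<and> k' \<noteq> k \<and>
               (\<exists>l'\<in>set (T ! k'). l' \<noteq> b \<and> i \<in> set (T ! l')))))))))"

text \<open>Enumerates the ends of the admissible walks from \<open>i\<close>, so that one
  evaluation for each \<open>i\<close> settles every \<open>j\<close>.\<close>

definition spread_list :: "nat list list \<Rightarrow> nat \<Rightarrow> nat list" where
  "spread_list T i = T ! i @
     concat (map (\<lambda>a. filter (\<lambda>j. j \<noteq> i) (T ! a) @
       concat (map (\<lambda>b. filter (\<lambda>j. j \<noteq> a) (T ! b) @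
         concat (map (\<lambda>k. filter (\<lambda>j. j \<noteq> b) (T ! k) @
           (if \<exists>k'\<in>set (T ! b). k' \<noteq> a \<and> k' \<noteq> k \<and> (\<exists>l'\<in>set (T ! k'). l' \<noteq> b \<and> i \<in> set (T ! l'))
            then concat (map (\<lambda>l. filter (\<lambda>j. j \<noteq> k) (T ! l)) (filter (\<lambda>l. l \<noteq> b) (T ! k)))
            else []))
         (filter (\<lambda>k. k \<noteq> a) (T ! b))))
       (filter (\<lambda>b. b \<noteq> i) (T ! a)))) (T ! i))"

lemma spread_list: "j \<in> set (spread_list T i) \<Longrightarrow> spread T i j"
  unfolding spread_list_def spread_def by (auto split: if_splits; blast)

lemma dodecahedron_table_nth:
    "dodecahedron_table ! 0 = [Suc 0, 4, 5]" "dodecahedron_table ! Suc 0 = [2, 0, 6]"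
    "dodecahedron_table ! 2 = [3, Suc 0, 7]" "dodecahedron_table ! 3 = [4, 2, 8]"
    "dodecahedron_table ! 4 = [0, 3, 9]" "dodecahedron_table ! 5 = [0, 10, 14]"
    "dodecahedron_table ! 6 = [Suc 0, 11, 10]" "dodecahedron_table ! 7 = [2, 12, 11]"
    "dodecahedron_table ! 8 = [3, 13, 12]" "dodecahedron_table ! 9 = [4, 14, 13]"
    "dodecahedron_table ! 10 = [5, 6, 15]" "dodecahedron_table ! 11 = [6, 7, 16]"
    "dodecahedron_table ! 12 = [7, 8, 17]" "dodecahedron_table ! 13 = [8, 9, 18]"
    "dodecahedron_table ! 14 = [9, 5, 19]" "dodecahedron_table ! 15 = [10, 16, 19]"
    "dodecahedron_table ! 16 = [11, 17, 15]" "dodecahedron_table ! 17 = [12, 18, 16]"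
    "dodecahedron_table ! 18 = [13, 19, 17]" "dodecahedron_table ! 19 = [14, 15, 18]"
  by (simp_all add: dodecahedron_table_def)

text \<open>Vertices at distance at most 4 are reached by a shortest walk; the antipode, at distance
  5, is what the last clause of \<open>spread\<close> is for.\<close>

lemma dodecahedron_table_spread:
  assumes "i < 20" "j < 20" "i \<noteq> j"
  shows "spread dodecahedron_table i j"
proof (rule spread_list)
  have lt20: "{..<20::nat} = {0, 1, 2, 3, 4, 5, 6, 7, 8, 9, 10, 11, 12, 13, 14, 15, 16, 17, 18, 19}"
    by (auto simp: lessThan_nat_numeral lessThan_Suc)
  have "i \<in> {..<20}" using assms by simp
  then have "{..<20} \<subseteq> insert i (set (spread_list dodecahedron_table i))"
    unfolding lt20
    by (elim insertE emptyE) (simp_all add: spread_list_def dodecahedron_table_nth)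
  then have "j \<in> insert i (set (spread_list dodecahedron_table i))" using assms by blast
  then show "j \<in> set (spread_list dodecahedron_table i)" using assms by blast
qed

lemma isomorphic_trans: "isomorphic G H \<Longrightarrow> isomorphic H K \<Longrightarrow> isomorphic G K"
  unfolding isomorphic_def using graph_iso_trans by blast

section \<open>Cuts and uncrossing\<close>

text \<open>\<open>N x\<close> is the set of neighbours of \<open>x\<close>, and \<open>conn\<close> expresses connectedness. Edges inside \<open>X \<inter> Y\<close>
  count twice in \<open>e X Y\<close>.\<close>

locale egraph =
  fixes V :: "'a set" and N :: "'a \<Rightarrow> 'a set" and d :: nat
  assumes N_sub: "x \<in> V \<Longrightarrow> N x \<subseteq> V"
    and N_sym: "x \<in> V \<Longrightarrow> y \<in> N x \<Longrightarrow> x \<in> N y"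
    and N_irrefl: "x \<in> V \<Longrightarrow> x \<notin> N x"
    and N_fin: "x \<in> V \<Longrightarrow> finite (N x)"
    and N_card: "x \<in> V \<Longrightarrow> card (N x) = d"
    and V_ne: "V \<noteq> {}"
    and conn: "X \<subseteq> V \<Longrightarrow> X \<noteq> {} \<Longrightarrow> (\<And>x. x \<in> X \<Longrightarrow> N x \<subseteq> X) \<Longrightarrow> X = V"
    and edge_trans: "x \<in> V \<Longrightarrow> y \<in> N x \<Longrightarrow> x' \<in> V \<Longrightarrow> y' \<in> N x' \<Longrightarrow>
      \<exists>f. bij_betw f V V \<and> (\<forall>z\<in>V. N (f z) = f ` N z) \<and> {f x, f y} = {x', y'}"
    and d_pos: "0 < d"
begin

lemma N_V: "x \<in> V \<Longrightarrow> y \<in> N x \<Longrightarrow> y \<in> V"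
  using N_sub by blast

lemma N_iff: "x \<in> V \<Longrightarrow> y \<in> V \<Longrightarrow> y \<in> N x \<longleftrightarrow> x \<in> N y"
  using N_sym by blast

definition e :: "'a set \<Rightarrow> 'a set \<Rightarrow> nat" where
  "e X Y = (\<Sum>x\<in>X. card (N x \<inter> Y))"

definition c :: "'a set \<Rightarrow> nat" where
  "c X = e X (V - X)"

lemma e_Un_left: "finite X \<Longrightarrow> finite Y \<Longrightarrow> X \<inter> Y = {} \<Longrightarrow> e (X \<union> Y) Z = e X Z + e Y Z"
  unfolding e_def by (rule sum.union_disjoint)

lemma e_Un_right:
  assumes "X \<subseteq> V" "Y \<inter> Z = {}"
  shows "e X (Y \<union> Z) = e X Y + e X Z"
proof -
  have "card (N x \<inter> (Y \<union> Z)) = card (N x \<inter> Y) + card (N x \<inter> Z)" if "x \<in> X" for x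
    unfolding Int_Un_distrib using that assms N_fin by (intro card_Un_disjoint) auto
  then show ?thesis unfolding e_def by (simp add: sum.distrib)
qed

lemma e_eq_card:
  assumes "X \<subseteq> V" "finite X"
  shows "e X Y = card {(x, y). x \<in> X \<and> y \<in> N x \<inter> Y}"
proof -
  have "{(x, y). x \<in> X \<and> y \<in> N x \<inter> Y} = Sigma X (\<lambda>x. N x \<inter> Y)" by auto
  then show ?thesis
    unfolding e_def using assms N_fin by (subst card_SigmaI[symmetric]) auto
qed

lemma e_sym:
  assumes "X \<subseteq> V" "finite X" "Y \<subseteq> V" "finite Y"
  shows "e X Y = e Y X"
proof -
  have "prod.swap ` {(x, y). x \<in> X \<and> y \<in> N x \<inter> Y} = {(x, y). x \<in> Y \<and> y \<in> N x \<inter> X}"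
    using assms N_sym by (auto simp: image_iff)
  then show ?thesis
    unfolding e_eq_card[OF assms(1,2)] e_eq_card[OF assms(3,4)]
    using card_image[OF inj_swap[of "{(x, y). x \<in> X \<and> y \<in> N x \<inter> Y}"]] by simp
qed

lemma e_empty [simp]: "e {} Y = 0" "e X {} = 0"
  by (simp_all add: e_def)

lemma e_zeroD:
  assumes "e X Y = 0" "X \<subseteq> V" "finite X" "x \<in> X"
  shows "N x \<inter> Y = {}"
proof -
  have "finite (N x \<inter> Y)" using assms N_fin by blast
  moreover have "card (N x \<inter> Y) = 0" using assms by (auto simp: e_def)
  ultimately show ?thesis by simp
qed

text \<open>Both sides count edges between the four cells \<open>A - B\<close>,
  \<open>B - A\<close>, \<open>A \<inter> B\<close> and the rest. The first identity is
  submodularity, the second posimodularity. The exact error terms matter: where the cuts are tight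
  they say that no edge joins the two cells concerned.\<close>

lemma uncross_union:
  assumes "A \<subseteq> V" "B \<subseteq> V" "finite A" "finite B"
  shows "c (A \<inter> B) + c (A \<union> B) + 2 * e (A - B) (B - A) = c A + c B"
    and "c (A - B) + c (B - A) + 2 * e (A \<inter> B) (V - (A \<union> B)) = c A + c B"
proof -
  define a b m r where ab: "a = A - B" "b = B - A" "m = A \<inter> B" "r = V - (A \<union> B)"
  note f = ab assms
  have A: "A = a \<union> m" and B: "B = b \<union> m" and AB: "A \<union> B = a \<union> (b \<union> m)"
    using f by auto
  have vA: "V - A = b \<union> r" and vB: "V - B = a \<union> r" and vU: "V - (A \<union> B) = r"
    and va: "V - a = m \<union> (b \<union> r)" and vb: "V - b = m \<union> (a \<union> r)" and vm: "V - m = a \<union> (b \<union> r)"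
    using f by auto
  have fin: "finite a" "finite b" "finite m" and sub: "a \<subseteq> V" "b \<subseteq> V" "m \<subseteq> V"
    and dis: "a \<inter> b = {}" "a \<inter> m = {}" "b \<inter> m = {}" "a \<inter> r = {}" "b \<inter> r = {}" "m \<inter> r = {}"
      "m \<inter> a = {}"  "m \<inter> b = {}" "b \<inter> a = {}"
    using f by auto
  have cA: "c A = e a b + e a r + e m b + e m r"
    unfolding c_def vA unfolding A
      using fin sub dis by (simp add: e_Un_left e_Un_right Int_Un_distrib)
  have cB: "c B = e b a + e b r + e m a + e m r"
    unfolding c_def vB unfolding B
      using fin sub dis by (simp add: e_Un_left e_Un_right Int_Un_distrib)
  have cU: "c (A \<union> B) = e a r + e b r + e m r"
    unfolding c_def vU unfolding AB
      using fin sub dis by (simp add: e_Un_left e_Un_right Int_Un_distrib)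
  have ca: "c a = e a m + e a b + e a r"
    unfolding c_def va using fin sub dis by (simp add: e_Un_left e_Un_right Int_Un_distrib)
  have cb: "c b = e b m + e b a + e b r"
    unfolding c_def vb using fin sub dis by (simp add: e_Un_left e_Un_right Int_Un_distrib)
  have cm: "c m = e m a + e m b + e m r"
    unfolding c_def vm using fin sub dis by (simp add: e_Un_left e_Un_right Int_Un_distrib)
  \<comment> \<open>\<open>r\<close> may be infinite, so it stands only on the right of
    \<open>e\<close>; symmetry is used between the finite cells alone.\<close>
  have s: "e b a = e a b" "e m a = e a m" "e m b = e b m"
    using fin sub by (auto intro: e_sym)
  show "c (A \<inter> B) + c (A \<union> B) + 2 * e (A - B) (B - A) = c A + c B"
    unfolding ab[symmetric] cA cB cU cm using s by simp
  show "c (A - B) + c (B - A) + 2 * e (A \<inter> B) (V - (A \<union> B)) = c A + c B"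
    unfolding ab[symmetric] cA cB ca cb using s by simp
qed

lemma c_compl:
  assumes "finite V" "A \<subseteq> V"
  shows "c (V - A) = c A"
proof -
  have "V - (V - A) = A" using assms by auto
  then show ?thesis
    unfolding c_def using assms by (metis Diff_subset e_sym finite_Diff finite_subset)
qed

text \<open>This is the first uncrossing identity for \<open>A\<close> and \<open>{x}\<close>, whose
  intersection is empty.\<close>

lemma c_insert:
  assumes "finite A" "A \<subseteq> V" "x \<in> V" "x \<notin> A"
  shows "c (insert x A) + 2 * card (N x \<inter> A) = c A + d"
proof -
  have "c {x} = d"
  proof -
    have "N x \<inter> (V - {x}) = N x" using N_sub N_irrefl assms by blast
    then show ?thesis using N_card assms by (simp add: c_def e_def)
  qed
  moreover have "A \<inter> {x} = {}" "A - {x} = A" "{x} - A = {x}" using assms by auto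
  moreover have "e A {x} = card (N x \<inter> A)"
    using assms e_sym[of A "{x}"] by (simp add: e_def)
  moreover have "c {} = 0" by (simp add: c_def)
  ultimately show ?thesis
    using uncross_union(1)[of A "{x}"] assms by simp
qed

lemma c_single: "x \<in> V \<Longrightarrow> c {x} = d"
  using c_insert[of "{}" x] by (simp add: c_def)

lemma c_remove:
  assumes "finite A" "A \<subseteq> V" "x \<in> A"
  shows "c A + 2 * card (N x \<inter> A) = c (A - {x}) + d"
proof -
  have "N x \<inter> (A - {x}) = N x \<inter> A" using N_irrefl assms by blast
  then show ?thesis
    using c_insert[of "A - {x}" x] assms by (auto simp: insert_absorb)
qed

text \<open>In the sum of the degrees over \<open>A\<close> an edge leaving \<open>A\<close> is
  counted once and an inner edge twice.\<close>

lemma c_e: "finite A \<Longrightarrow> A \<subseteq> V \<Longrightarrow> c A + e A A = d * card A"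
proof -
  assume A: "finite A" "A \<subseteq> V"
  have "e A (A \<union> (V - A)) = e A A + e A (V - A)"
    using A by (intro e_Un_right) auto
  moreover have "e A V = d * card A"
  proof -
    have "card (N x \<inter> V) = d" if "x \<in> A" for x
      using that A N_card N_sub by (metis Int_absorb2 subset_iff)
    then show ?thesis by (simp add: e_def)
  qed
  ultimately show ?thesis using A by (simp add: c_def Un_absorb1)
qed

text \<open>For odd \<open>d\<close> the cut fixes the parity of the size, and for even
  \<open>d\<close> the cut is even; several sizes and cut values are excluded in this way.\<close>

lemma c_parity: "finite A \<Longrightarrow> A \<subseteq> V \<Longrightarrow> even (c A + d * card A)"
proof (induction A rule: finite_induct)
  case empty
  then show ?case by (simp add: c_def)
next
  case (insert x A)
  have "c (insert x A) + 2 * card (N x \<inter> A) = c A + d"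
    using c_insert insert by auto
  then have "even (c (insert x A)) \<longleftrightarrow> even (c A + d)"
    by (metis even_add even_mult_iff even_numeral)
  then show ?case using insert by (auto simp: algebra_simps)
qed

lemma e_parity: "finite A \<Longrightarrow> A \<subseteq> V \<Longrightarrow> even (e A A)"
  using c_parity[of A] c_e[of A] by (metis even_add)

lemma card_N_insert:
  assumes "x \<in> V" "finite S" "y \<notin> S"
  shows "card (N x \<inter> insert y S) = of_bool (y \<in> N x) + card (N x \<inter> S)"
  using assms by (auto simp: Int_insert_right)

lemma common_unique:
  assumes "x \<in> V" "a \<in> N x" "a \<in> N y" "b \<in> N x" "b \<in> N y" "card (N x \<inter> N y) \<le> 1"
  shows "a = b"
proof -
  have "finite (N x \<inter> N y)" using N_fin[OF assms(1)] by simp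
  then show ?thesis using card_le_Suc0_iff_eq assms(2-6) by auto
qed

section \<open>Automorphisms preserve cuts\<close>

definition aut :: "('a \<Rightarrow> 'a) \<Rightarrow> bool" where
  "aut f \<longleftrightarrow> bij_betw f V V \<and> (\<forall>z\<in>V. N (f z) = f ` N z)"

lemma aut_inj: "aut f \<Longrightarrow> inj_on f V"
  by (auto simp: aut_def bij_betw_def)

lemma aut_Int:
  assumes "aut f" "X \<subseteq> V" "Y \<subseteq> V"
  shows "f ` (X \<inter> Y) = f ` X \<inter> f ` Y"
  using assms aut_inj by (meson inj_on_image_Int)

lemma aut_card: "aut f \<Longrightarrow> X \<subseteq> V \<Longrightarrow> card (f ` X) = card X"
  using aut_inj by (meson card_image inj_on_subset)

lemma aut_sub: "aut f \<Longrightarrow> X \<subseteq> V \<Longrightarrow> f ` X \<subseteq> V"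
  by (auto simp: aut_def bij_betw_def)

lemma aut_e:
  assumes "aut f" "X \<subseteq> V" "Y \<subseteq> V"
  shows "e (f ` X) (f ` Y) = e X Y"
proof -
  have "inj_on f X" using aut_inj assms by (meson inj_on_subset)
  then have "e (f ` X) (f ` Y) = (\<Sum>x\<in>X. card (N (f x) \<inter> f ` Y))"
    by (simp add: e_def sum.reindex)
  also have "\<dots> = e X Y"
    unfolding e_def
  proof (rule sum.cong[OF refl])
    fix x assume "x \<in> X"
    then have "N (f x) = f ` N x" "N x \<subseteq> V" using assms N_sub by (auto simp: aut_def)
    then have "N (f x) \<inter> f ` Y = f ` (N x \<inter> Y)"
      using assms aut_Int by metis
    then show "card (N (f x) \<inter> f ` Y) = card (N x \<inter> Y)"
      using assms aut_card by (metis le_infI2)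
  qed
  finally show ?thesis .
qed

lemma aut_c:
  assumes "aut f" "X \<subseteq> V"
  shows "c (f ` X) = c X"
proof -
  have "f ` (V - X) = V - f ` X"
    using inj_on_image_set_diff[OF aut_inj[OF assms(1)], of V X] assms
    by (auto simp: aut_def bij_betw_def)
  then show ?thesis
    unfolding c_def using assms aut_e by (metis Diff_subset)
qed

section \<open>Separating sets, crossing translates and minimal cuts\<close>

definition small :: "'a set \<Rightarrow> bool" where
  "small X \<longleftrightarrow> X \<subseteq> V \<and> finite X \<and> (finite V \<longrightarrow> 2 * card X \<le> card V)"

text \<open>Both sides of the cut have at least \<open>n\<close> vertices. Unlike
  \<open>small\<close>, this is symmetric under complements in a finite graph and can be established
  for a union of two small sets.\<close>

definition sep :: "nat \<Rightarrow> 'a set \<Rightarrow> bool" where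
  "sep n X \<longleftrightarrow> X \<subseteq> V \<and> finite X \<and> n \<le> card X \<and> (finite V \<longrightarrow> n + card X \<le> card V)"

lemma small_sep: "small X \<Longrightarrow> n \<le> card X \<Longrightarrow> sep n X"
  by (auto simp: small_def sep_def)

lemma small_subset: "small X \<Longrightarrow> Y \<subseteq> X \<Longrightarrow> small Y"
  unfolding small_def by (meson card_mono dual_order.trans finite_subset mult_le_mono2)

lemma edge_leaves:
  assumes "A \<subseteq> V" "A \<noteq> {}" "A \<noteq> V"
  obtains x y where "x \<in> A" "y \<in> N x" "y \<notin> A"
  using conn[of A] assms by blast

lemma small_ne: "small A \<Longrightarrow> A \<noteq> V"
  using V_ne by (auto simp: small_def)

text \<open>A finite set all of whose translates are disjoint from it or equal to it is a block of
  imprimitivity, so an edge inside it cannot be moved to an edge leaving it.\<close>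

lemma crossing_translate:
  assumes "small A" "x \<in> A" "y \<in> A" "y \<in> N x"
  obtains f where "aut f" "f ` A \<noteq> A" "f ` A \<inter> A \<noteq> {}"
proof -
  have AV: "A \<subseteq> V" using assms by (simp add: small_def)
  obtain x' y' where xy: "x' \<in> A" "y' \<in> N x'" "y' \<notin> A"
    using edge_leaves[OF AV _ small_ne[OF assms(1)]] assms(2) by (metis empty_iff)
  obtain f where f: "bij_betw f V V" "\<forall>z\<in>V. N (f z) = f ` N z" "{f x, f y} = {x', y'}"
    using edge_trans[of x y x' y'] xy assms(2,4) AV by (meson subsetD)
  \<comment> \<open>The edge may arrive reversed, but in either case both of its ends lie in the
    translate, while only \<open>x'\<close> lies in \<open>A\<close>.\<close>
  have "x' \<in> f ` A" "y' \<in> f ` A" using f(3) assms by blast+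
  then show ?thesis using that[of f] f xy by (auto simp: aut_def)
qed

text \<open>If \<open>A - B\<close> had \<open>n\<close> vertices, then \<open>A - B\<close> and
  \<open>B - A\<close>, being smaller than \<open>A\<close>, would both have a cut above
  \<open>k\<close>, against the second uncrossing identity. If \<open>A \<inter> B\<close> had
  \<open>n\<close> vertices, its cut would exceed \<open>k\<close> while that of the union is at
  least \<open>k\<close>, against the first. The bound \<open>k < n * d\<close> provides an edge
  inside \<open>A\<close>, as an independent set with \<open>n\<close> vertices already has cut
  \<open>n * d\<close>. The lower bound is assumed for some \<open>m \<le> n\<close>, so that the
  one for three vertices serves with larger \<open>n\<close> as well.\<close>

lemma uncrossing:
  assumes lower: "\<And>X. sep m X \<Longrightarrow> k \<le> c X" and "m \<le> n"
    and X: "small X" "n \<le> card X" "c X \<le> k" and k: "k < n * d"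
  obtains A B where "small A" "small B" "card A = card B" "c A = k" "c B = k" "n \<le> card A"
    "A \<inter> B \<noteq> {}" "A \<noteq> B" "card (A - B) < n" "card (A \<inter> B) < n" "card (A - B) = card (B - A)"
proof -
  define P where "P Y \<longleftrightarrow> small Y \<and> n \<le> card Y \<and> c Y \<le> k" for Y
  obtain A where A: "P A" and min: "\<And>Y. P Y \<Longrightarrow> card A \<le> card Y"
    using exists_least_iff[of "\<lambda>i. \<exists>Y. P Y \<and> card Y = i"] X unfolding P_def
    by (metis linorder_not_less)
  have AV: "A \<subseteq> V" "finite A" and sA: "small A" using A by (auto simp: P_def small_def)
  have cA: "c A = k"
    using lower[OF small_sep[OF sA, of m]] A \<open>m \<le> n\<close> by (auto simp: P_def)
  have "e A A \<noteq> 0"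
  proof
    assume "e A A = 0"
    then have "k = d * card A" using c_e AV cA by force
    moreover have "n * d \<le> d * card A" using A by (simp add: P_def)
    ultimately show False using k by simp
  qed
  then obtain x where "x \<in> A" "N x \<inter> A \<noteq> {}"
    unfolding e_def using sum.neutral[of A "\<lambda>x. card (N x \<inter> A)"] card.empty by metis
  then obtain y where "y \<in> A" "y \<in> N x" by blast
  then obtain f where f: "aut f" "f ` A \<noteq> A" "f ` A \<inter> A \<noteq> {}"
    using crossing_translate[of A x y] sA \<open>x \<in> A\<close> by blast
  define B where "B = f ` A"
  have BV: "B \<subseteq> V" "finite B" and cB: "c B = k" and cardB: "card B = card A"
    using f AV cA aut_sub aut_c aut_card by (auto simp: B_def)
  have sB: "small B" using sA BV cardB by (simp add: small_def)
  have diff: "card (A - B) = card (B - A)"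
    using AV BV cardB by (metis Int_commute card_Diff_subset_Int finite_Int)
  have i0: "0 < card (A \<inter> B)" using f AV by (auto simp: B_def card_gt_0_iff)
  have split: "card A = card (A - B) + card (A \<inter> B)"
    using card_Diff_Int[OF AV(2)] .
  have "card (A - B) < n"
  proof (rule ccontr)
    assume n: "\<not> card (A - B) < n"
    have "\<not> c (A - B) \<le> k"
      using min[of "A - B"] n small_subset[OF sA, of "A - B"] i0 split by (auto simp: P_def)
    moreover have "\<not> c (B - A) \<le> k"
      using min[of "B - A"] n small_subset[OF sB, of "B - A"] i0 split diff by (auto simp: P_def)
    ultimately show False
      using uncross_union(2)[of A B] AV BV cA cB by linarith
  qed
  moreover have "card (A \<inter> B) < n"
  proof (rule ccontr)
    assume n: "\<not> card (A \<inter> B) < n"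
    have "A - B \<noteq> {}"
      using AV BV cardB f(2) B_def by (metis Diff_eq_empty_iff card_subset_eq)
    then have "card (A - B) > 0" using AV by (simp add: card_gt_0_iff)
    then have "\<not> c (A \<inter> B) \<le> k"
      using min[of "A \<inter> B"] n small_subset[OF sA, of "A \<inter> B"] split by (auto simp: P_def)
    moreover have "k \<le> c (A \<union> B)"
    proof (rule lower)
      \<comment> \<open>In a finite graph \<open>2 * card A \<le> card V\<close>, so the complement
        of the union has at least \<open>card (A \<inter> B)\<close> vertices, which is at least
        \<open>n\<close>.\<close>
      have u: "card (A \<union> B) + card (A \<inter> B) = 2 * card A"
        using card_Un_Int[of A B] AV BV cardB by simp
      have i: "card (A \<inter> B) \<le> card A" using AV by (simp add: card_mono)
      show "sep m (A \<union> B)"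
        unfolding sep_def using AV BV sA u i n \<open>m \<le> n\<close> by (auto simp: small_def)
    qed
    ultimately show False
      using uncross_union(1)[of A B] AV BV cA cB by linarith
  qed
  ultimately show ?thesis
    using that[of A B] sA sB A cA cB cardB f diff i0 by (auto simp: P_def B_def)
qed

text \<open>A minimum \<open>k < d\<close> satisfies \<open>k < n * d\<close> with
  \<open>n = 1\<close>; uncrossing would then produce two sets that meet in fewer than one
  vertex.\<close>

lemma c_ge_d:
  assumes "sep 1 X"
  shows "d \<le> c X"
proof -
  define k where "k = (LEAST i. \<exists>X. sep 1 X \<and> c X = i)"
  have lower: "k \<le> c Y" if "sep 1 Y" for Y
    unfolding k_def using that by (auto intro: Least_le)
  obtain Y where Y: "sep 1 Y" "c Y = k"
    using LeastI_ex[of "\<lambda>i. \<exists>X. sep 1 X \<and> c X = i"] assms unfolding k_def by blast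
  have "\<not> k < d"
  proof
    assume k: "k < d"
    obtain Z where Z: "small Z" "1 \<le> card Z" "c Z \<le> k"
    proof (cases "small Y")
      case True
      then show ?thesis using that[of Y] Y by (auto simp: sep_def)
    next
      case False
      then have "finite V" "small (V - Y)" "1 \<le> card (V - Y)"
        using Y(1) unfolding small_def sep_def by (auto simp: card_Diff_subset finite_subset)
      then show ?thesis using that[of "V - Y"] Y c_compl[of Y] by (auto simp: sep_def)
    qed
    from uncrossing[of 1 k 1 Z, OF lower _ Z] k
    obtain A B where "finite A" "A \<inter> B \<noteq> {}" "card (A \<inter> B) < 1"
      by (auto simp: small_def)
    then show False by (simp add: card_gt_0_iff)
  qed
  then show ?thesis using lower[OF assms] by linarith
qed

text \<open>A minimiser with more than half of the vertices is replaced by its complement, which has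
  the same cut.\<close>

lemma min_cut:
  assumes "sep n X"
  obtains k Z where "\<And>Y. sep n Y \<Longrightarrow> k \<le> c Y" "small Z" "n \<le> card Z" "c Z = k"
proof -
  define k where "k = (LEAST i. \<exists>X. sep n X \<and> c X = i)"
  have lower: "k \<le> c Y" if "sep n Y" for Y
    unfolding k_def using that by (auto intro: Least_le)
  obtain Y where Y: "sep n Y" "c Y = k"
    using LeastI_ex[of "\<lambda>i. \<exists>X. sep n X \<and> c X = i"] assms unfolding k_def by blast
  show ?thesis
  proof (cases "small Y")
    case True
    then show ?thesis using that[of k Y] lower Y by (auto simp: sep_def)
  next
    case False
    then have "finite V" "small (V - Y)" "n \<le> card (V - Y)"
      using Y(1) unfolding small_def sep_def by (auto simp: card_Diff_subset finite_subset)
    then show ?thesis using that[of k "V - Y"] lower Y c_compl[of Y] by (auto simp: sep_def)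
  qed
qed

section \<open>Induced paths and cycles\<close>

definition gr :: "'a graph" where
  "gr = (V, {{x, y} |x y. x \<in> V \<and> y \<in> N x})"

lemma verts_gr [simp]: "verts gr = V"
  by (simp add: gr_def)

lemma edge_gr: "{x, y} \<in> edges gr \<longleftrightarrow> x \<in> V \<and> y \<in> N x"
  using N_sym N_sub by (fastforce simp: gr_def doubleton_eq_iff)

lemma edges_gr_cases:
  assumes "E \<in> edges gr"
  obtains x y where "E = {x, y}" "x \<in> V" "y \<in> V" "y \<in> N x" "x \<noteq> y"
  using assms N_irrefl N_sub by (fastforce simp: gr_def)

lemma simple_gr: "simple_graph gr"
  unfolding simple_graph_def by (auto elim!: edges_gr_cases)

lemma induced_V: "induced gr V = gr"
proof -
  have "{E \<in> edges gr. E \<subseteq> V} = edges gr" using simple_gr by (auto simp: simple_graph_def)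
  then show ?thesis by (simp add: induced_def prod_eq_iff)
qed

lemma induced_iso:
  assumes K: "simple_graph K" "verts K = {..<length xs}" and xs: "distinct xs" "set xs \<subseteq> V"
    and adj: "\<And>i j. i < length xs \<Longrightarrow> j < length xs \<Longrightarrow>
      {i, j} \<in> edges K \<longleftrightarrow> xs ! j \<in> N (xs ! i)"
  shows "isomorphic (induced gr (set xs)) K"
proof -
  have "graph_iso ((!) xs) K (induced gr (set xs))"
    unfolding graph_iso_def induced_def fst_conv snd_conv K(2)
  proof
    show "bij_betw ((!) xs) {..<length xs} (set xs)"
      using xs(1) by (rule bij_betw_nth) auto
    show "{E \<in> edges gr. E \<subseteq> set xs} = (`) ((!) xs) ` edges K"
    proof (intro set_eqI iffI)
      fix E assume E: "E \<in> {E \<in> edges gr. E \<subseteq> set xs}"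
      then obtain x y where xy: "E = {x, y}" "y \<in> N x" "x \<in> set xs" "y \<in> set xs"
        by (auto elim!: edges_gr_cases)
      then obtain i j where ij: "x = xs ! i" "y = xs ! j" "i < length xs" "j < length xs"
        by (metis in_set_conv_nth)
      then have "{i, j} \<in> edges K" using adj xy by blast
      then show "E \<in> (`) ((!) xs) ` edges K"
        using xy ij by (intro image_eqI[of _ _ "{i, j}"]) auto
    next
      fix E assume "E \<in> (`) ((!) xs) ` edges K"
      then obtain D where D: "D \<in> edges K" "E = (!) xs ` D" by auto
      then obtain i j where ij: "D = {i, j}" "i < length xs" "j < length xs"
        using K by (auto simp: simple_graph_def card_2_iff)
      then have "xs ! j \<in> N (xs ! i)" using adj D by blast
      then have "{xs ! i, xs ! j} \<in> edges gr" using ij xs by (simp add: edge_gr subset_iff)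
      then show "E \<in> {E \<in> edges gr. E \<subseteq> set xs}" using D ij by simp
    qed
  qed
  then show ?thesis using graph_iso_sym[OF K(1)] unfolding isomorphic_def by blast
qed

text \<open>It suffices that table neighbours are sent to neighbours: a row has \<open>d\<close>
  entries, so its image fills the neighbourhood, which gives nonadjacency as well. The image is then
  closed under neighbours and equals \<open>V\<close>.\<close>

lemma embed_label_graph:
  assumes len: "length xs = length T" "xs \<noteq> []" and xs: "distinct xs" "set xs \<subseteq> V"
    and T: "\<And>i. i < length T \<Longrightarrow> distinct (T ! i) \<and> length (T ! i) = d \<and> (\<forall>j\<in>set (T ! i). j < length T)"
    and adj: "\<And>i j. i < length T \<Longrightarrow> j \<in> set (T ! i) \<Longrightarrow> xs ! j \<in> N (xs ! i)"
  shows "set xs = V" "isomorphic gr (label_graph T)"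
proof -
  define n where "n = length T"
  have inj: "inj_on ((!) xs) {..<n}" using xs len by (simp add: inj_on_nth n_def)
  have xV: "xs ! i \<in> V" if "i < n" for i using xs len that by (auto simp: n_def)
  have Nx: "N (xs ! i) = (!) xs ` set (T ! i)" if i: "i < n" for i
  proof -
    have s: "set (T ! i) \<subseteq> {..<n}" using T[of i] i by (auto simp: n_def)
    have "card ((!) xs ` set (T ! i)) = card (set (T ! i))"
      using inj s by (meson card_image inj_on_subset)
    also have "\<dots> = d" using T[of i] i by (auto simp: n_def distinct_card)
    finally show ?thesis
      using adj[of i] i xV N_fin N_card
      by (intro card_subset_eq[symmetric]) (auto simp: n_def)
  qed
  show sV: "set xs = V"
  proof (rule conn)
    fix x assume "x \<in> set xs"
    then obtain i where "i < n" "x = xs ! i" using len by (metis in_set_conv_nth n_def)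
    then show "N x \<subseteq> set xs" using Nx T[of i] len by (auto simp: n_def)
  qed (use len xs in auto)
  have tab: "j \<in> set (T ! i) \<longleftrightarrow> xs ! j \<in> N (xs ! i)" if "i < n" "j < n" for i j
  proof -
    have "set (T ! i) \<subseteq> {..<n}" using T[of i] that by (auto simp: n_def)
    then show ?thesis using inj_on_image_mem_iff[OF inj, of j] Nx that by auto
  qed
  have "isomorphic (induced gr (set xs)) (label_graph T)"
  proof (rule induced_iso)
    show "simple_graph (label_graph T)"
      unfolding simple_graph_def
    proof
      fix E assume "E \<in> edges (label_graph T)"
      then obtain i j where ij: "E = {i, j}" "i < n" "j \<in> set (T ! i)"
        by (auto simp: label_graph_def n_def)
      then have "j < n" using T[of i] by (auto simp: n_def)
      then have "i \<noteq> j" using tab[of i j] ij N_irrefl xV by auto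
      then show "E \<subseteq> verts (label_graph T) \<and> card E = 2"
        using ij \<open>j < n\<close> by (auto simp: label_graph_def n_def)
    qed
    show "verts (label_graph T) = {..<length xs}" by (simp add: label_graph_def len)
    fix i j assume "i < length xs" "j < length xs"
    then have ij: "i < n" "j < n" using len by (auto simp: n_def)
    have "{i, j} \<in> edges (label_graph T) \<longleftrightarrow> j \<in> set (T ! i) \<or> i \<in> set (T ! j)"
      using ij by (auto simp: label_graph_def n_def doubleton_eq_iff)
    then show "{i, j} \<in> edges (label_graph T) \<longleftrightarrow> xs ! j \<in> N (xs ! i)"
      using tab ij N_sym xV by blast
  qed (use xs in auto)
  then show "isomorphic gr (label_graph T)" using sV induced_V by simp
qed

definition ipath :: "'a list \<Rightarrow> bool" where
  "ipath xs \<longleftrightarrow> distinct xs \<and> set xs \<subseteq> V \<and>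
     (\<forall>i<length xs. \<forall>j<length xs. xs ! j \<in> N (xs ! i) \<longleftrightarrow> j = Suc i \<or> i = Suc j)"

lemma ipath_path_graph:
  assumes "ipath xs" "length xs = Suc k"
  shows "isomorphic (induced gr (set xs)) (path_graph k)"
proof (rule induced_iso)
  show "verts (path_graph k) = {..<length xs}" using assms by (auto simp: path_graph_def)
qed (use assms edges_path_graph simple_path_graph in \<open>auto simp: ipath_def\<close>)

lemma ipath_rev:
  assumes "ipath xs"
  shows "ipath (rev xs)"
proof -
  have "rev xs ! j \<in> N (rev xs ! i) \<longleftrightarrow> j = Suc i \<or> i = Suc j"
    if "i < length xs" "j < length xs" for i j
  proof -
    have "rev xs ! j \<in> N (rev xs ! i) \<longleftrightarrow>
        length xs - Suc j = Suc (length xs - Suc i) \<or> length xs - Suc i = Suc (length xs - Suc j)"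
      using assms that by (simp add: ipath_def rev_nth)
    then show ?thesis using that by auto
  qed
  then show ?thesis using assms by (simp add: ipath_def)
qed

lemma ipath_snoc:
  assumes "ipath xs" "x \<in> V" "x \<notin> set xs" "xs \<noteq> []" "N x \<inter> set xs = {last xs}"
  shows "ipath (xs @ [x])"
proof -
  let ?n = "length xs"
  have nx: "xs ! i \<in> N x \<longleftrightarrow> Suc i = ?n" if "i < ?n" for i
  proof -
    have "xs ! i \<in> N x \<longleftrightarrow> xs ! i = last xs"
      using assms(5) nth_mem[OF that] by blast
    also have "\<dots> \<longleftrightarrow> xs ! i = xs ! (?n - 1)"
      using last_conv_nth[OF assms(4)] by simp
    also have "\<dots> \<longleftrightarrow> i = ?n - 1"
      using assms(1) that by (intro nth_eq_iff_index_eq) (auto simp: ipath_def)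
    finally show ?thesis using that by auto
  qed
  have xn: "x \<in> N (xs ! i) \<longleftrightarrow> Suc i = ?n" if "i < ?n" for i
  proof -
    have "xs ! i \<in> V" using assms(1) nth_mem[OF that] unfolding ipath_def by blast
    then show ?thesis using nx[OF that] N_iff[of x "xs ! i"] assms(2) by blast
  qed
  have "(xs @ [x]) ! j \<in> N ((xs @ [x]) ! i) \<longleftrightarrow> j = Suc i \<or> i = Suc j"
    if "i < Suc ?n" "j < Suc ?n" for i j
  proof (cases "i < ?n"; cases "j < ?n")
    assume "i < ?n" "j < ?n"
    then show ?thesis using assms(1) by (simp add: ipath_def nth_append)
  next
    assume "i < ?n" "\<not> j < ?n"
    then show ?thesis using xn[of i] that by (auto simp: nth_append)
  next
    assume "\<not> i < ?n" "j < ?n"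
    then show ?thesis using nx[of j] that by (auto simp: nth_append)
  next
    assume "\<not> i < ?n" "\<not> j < ?n"
    then have "i = ?n" "j = ?n" using that by auto
    then show ?thesis using N_irrefl assms(2) by simp
  qed
  then show ?thesis using assms(1-3) by (simp add: ipath_def)
qed

lemma cycle_induced:
  assumes "distinct xs" "set xs \<subseteq> V" "length xs = n" "3 \<le> n"
    and adj: "\<And>i j. i < n \<Longrightarrow> j < n \<Longrightarrow>
      xs ! j \<in> N (xs ! i) \<longleftrightarrow> j = (i + 1) mod n \<or> i = (j + 1) mod n"
  shows "is_cycle (induced gr (set xs)) n"
  unfolding is_cycle_def
proof
  show "isomorphic (induced gr (set xs)) (cycle_graph n)"
  proof (rule induced_iso)
    show "verts (cycle_graph n) = {..<length xs}" using assms by (simp add: cycle_graph_def)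
  qed (use assms edges_cycle_graph simple_cycle_graph in auto)
qed fact

text \<open>For \<open>n \<le> 5\<close> only lengths 3 and 4 can be shorter. A triangle gives
  adjacent vertices with a common neighbour, a 4-cycle gives distinct vertices with two of
  them.\<close>

lemma shortest_cycleI:
  assumes "is_cycle (induced gr A) n" "A \<subseteq> V"
    and "3 < n \<Longrightarrow> \<forall>x\<in>V. \<forall>y\<in>N x. N x \<inter> N y = {}"
    and "4 < n \<Longrightarrow> \<forall>x\<in>V. \<forall>y\<in>V. x \<noteq> y \<longrightarrow> card (N x \<inter> N y) \<le> 1"
    and "n \<le> 5"
  shows "shortest_cycle (induced gr A) gr"
proof -
  have sub: "subgraph (induced gr A) gr"
    using assms(2) simple_gr by (auto simp: subgraph_def induced_def simple_graph_def)
  have "n \<le> m" if C: "subgraph C gr" "is_cycle C m" for C m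
  proof (rule ccontr)
    assume "\<not> n \<le> m"
    obtain w where w: "inj_on w {..<m}" "\<And>i. i < m \<Longrightarrow> w i \<in> V"
        "\<And>i. i < m \<Longrightarrow> w ((i + 1) mod m) \<in> N (w i)"
      using subgraph_cycle[OF C] by (metis edge_gr verts_gr)
    have "3 \<le> m" using C(2) by (simp add: is_cycle_def)
    then consider "m = 3" | "m = 4" using \<open>\<not> n \<le> m\<close> \<open>n \<le> 5\<close> by linarith
    then show False
    proof cases
      case 1
      have "w 1 \<in> N (w 0)" "w 2 \<in> N (w 1)" "w 0 \<in> N (w 2)"
      proof -
        have md: "(0 + 1) mod m = 1" "(1 + 1) mod m = 2" "(2 + 1) mod m = 0"
          unfolding 1 by simp_all
        show "w 1 \<in> N (w 0)" "w 2 \<in> N (w 1)" "w 0 \<in> N (w 2)"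
          using w(3)[of 0, unfolded md] w(3)[of 1, unfolded md] w(3)[of 2, unfolded md] 1
          by linarith+
      qed
      moreover have "w 0 \<in> V" "w 2 \<in> V" using w(2) 1 by auto
      ultimately have "w 2 \<in> N (w 0) \<inter> N (w 1)" using N_sym by auto
      then show False using assms(3) \<open>w 0 \<in> V\<close> \<open>w 1 \<in> N (w 0)\<close> 1 \<open>\<not> n \<le> m\<close> by auto
    next
      case 2
      have adj: "w 1 \<in> N (w 0)" "w 2 \<in> N (w 1)" "w 3 \<in> N (w 2)" "w 0 \<in> N (w 3)"
      proof -
        have md: "(0 + 1) mod m = 1" "(1 + 1) mod m = 2" "(2 + 1) mod m = 3" "(3 + 1) mod m = 0"
          unfolding 2 by simp_all
        show "w 1 \<in> N (w 0)" "w 2 \<in> N (w 1)" "w 3 \<in> N (w 2)" "w 0 \<in> N (w 3)"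
          using w(3)[of 0, unfolded md] w(3)[of 1, unfolded md] w(3)[of 2, unfolded md]
            w(3)[of 3, unfolded md] 2 by linarith+
      qed
      have V: "w 0 \<in> V" "w 1 \<in> V" "w 2 \<in> V" "w 3 \<in> V" using w(2) 2 by auto
      have "w 0 \<noteq> w 2" "w 1 \<noteq> w 3"
        using inj_on_eq_iff[OF w(1), of 0 2] inj_on_eq_iff[OF w(1), of 1 3] 2 by simp_all
      moreover have "{w 1, w 3} \<subseteq> N (w 0) \<inter> N (w 2)" using adj V N_sym by auto
      then have "card {w 1, w 3} \<le> card (N (w 0) \<inter> N (w 2))"
        using V N_fin by (intro card_mono) auto
      ultimately show False using assms(4) V 2 \<open>\<not> n \<le> m\<close> by fastforce
    qed
  qed
  then have "enat n \<le> girth gr"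
    unfolding girth_def by (intro Inf_greatest) auto
  moreover have "girth gr \<le> enat n"
    unfolding girth_def by (intro Inf_lower) (use sub assms(1) in blast)
  ultimately show ?thesis
    unfolding shortest_cycle_def using sub assms(1) by (metis antisym)
qed

section \<open>Graphs of degree two\<close>

text \<open>By parity and \<open>c_ge_d\<close> the cut is 2. A vertex \<open>x\<close> with a
  neighbour outside has at most one inside; as the rest has cut at least 2, it has exactly one, and
  the rest is again of cut 2. The statement is for \<open>sep 1\<close> rather than
  \<open>small\<close> so that it applies to the complement of a vertex.\<close>

lemma degree2_ipath:
  assumes d: "d = 2"
  shows "sep 1 A \<Longrightarrow> c A < 4 \<Longrightarrow> \<exists>xs. ipath xs \<and> set xs = A"
proof (induction "card A" arbitrary: A rule: less_induct)
  case less
  have A: "A \<subseteq> V" "finite A" "A \<noteq> {}" and AV: "A \<noteq> V"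
    using less.prems(1) by (auto simp: sep_def)
  obtain x y where xy: "x \<in> A" "y \<in> N x" "y \<notin> A" using edge_leaves[OF A(1,3) AV] by blast
  have xV: "x \<in> V" using A xy by blast
  have rm: "c A + 2 * card (N x \<inter> A) = c (A - {x}) + 2"
    using c_remove[OF A(2,1) xy(1)] d by simp
  have "card (N x \<inter> A) < card (N x)"
    using xy N_fin[OF xV] by (intro psubset_card_mono) auto
  then have deg: "card (N x \<inter> A) \<le> 1" using N_card[OF xV] d by simp
  have "even (c A)" using c_parity[OF A(2,1)] d by simp
  moreover have "2 \<le> c A" using c_ge_d[OF less.prems(1)] d by simp
  ultimately have cA: "c A = 2" using less.prems(2) by (auto elim!: evenE)
  show ?case
  proof (cases "A = {x}")
    case True
    then have "ipath [x] \<and> set [x] = A" using xV N_irrefl by (simp add: ipath_def)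
    then show ?thesis by blast
  next
    case False
    then have ne: "A - {x} \<noteq> {}" using A by blast
    have sep: "sep 1 (A - {x})"
    proof -
      have "0 < card (A - {x})" using ne A(2) by (simp add: card_gt_0_iff)
      then show ?thesis
        using less.prems(1) card_Suc_Diff1[OF A(2) xy(1)] unfolding sep_def by auto
    qed
    have "2 \<le> c (A - {x})" using c_ge_d[OF sep] d by simp
    then have c1: "c (A - {x}) = 2" "card (N x \<inter> A) = 1" using rm deg cA by auto
    obtain xs where xs: "ipath xs" "set xs = A - {x}"
      using less.hyps[of "A - {x}"] sep c1(1) card_Suc_Diff1[OF A(2) xy(1)] by auto
    obtain z where z: "N x \<inter> A = {z}" using c1(2) by (rule card_1_singletonE)
    then have Nz: "N x \<inter> set xs = {z}" using xs(2) N_irrefl[OF xV] by auto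
    then obtain k where k: "z = xs ! k" "k < length xs" by (metis IntD2 in_set_conv_nth insertI1)
    have zV: "z \<in> V" and xz: "x \<in> N z" using Nz N_sub[OF xV] N_sym[OF xV] by auto
    \<comment> \<open>Inside the path both neighbours of \<open>z\<close> are already used, so
      \<open>x\<close> can only be attached at an end.\<close>
    have ends: "k = 0 \<or> Suc k = length xs"
    proof (rule ccontr)
      assume "\<not> ?thesis"
      then have k': "0 < k" "Suc k < length xs" using k by auto
      have "xs ! (k - 1) \<in> N z" "xs ! Suc k \<in> N z"
        using xs(1) k k' by (auto simp: ipath_def)
      then have "{x, xs ! (k - 1), xs ! Suc k} \<subseteq> N z" using xz by blast
      moreover have "card {x, xs ! (k - 1), xs ! Suc k} = 3"
      proof -
        have "xs ! (k - 1) \<noteq> xs ! Suc k"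
          using xs(1) k k' by (auto simp: ipath_def nth_eq_iff_index_eq)
        moreover have "xs ! (k - 1) \<noteq> x" "xs ! Suc k \<noteq> x"
          using xs(2) k k' nth_mem[of "k - 1" xs] nth_mem[of "Suc k" xs] by auto
        ultimately show ?thesis by auto
      qed
      ultimately have "3 \<le> card (N z)" using N_fin[OF zV] by (metis card_mono)
      then show False using N_card[OF zV] d by simp
    qed
    obtain ys where ys: "ipath ys" "set ys = A - {x}" "last ys = z" "ys \<noteq> []"
    proof (cases "Suc k = length xs")
      case True
      then show ?thesis using that[of xs] xs k by (cases xs rule: rev_cases) (auto simp: nth_append)
    next
      case False
      then have "k = 0" "xs \<noteq> []" using ends k by auto
      then show ?thesis using that[of "rev xs"] xs k ipath_rev by (simp add: last_rev hd_conv_nth)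
    qed
    have "ipath (ys @ [x])"
      using ys Nz xs(2) xV by (intro ipath_snoc) auto
    moreover have "set (ys @ [x]) = A" using ys xy by auto
    ultimately show ?thesis by blast
  qed
qed

text \<open>The complement of a vertex \<open>x\<close> has cut 2 and is an induced path; its two
  ends still lack a neighbour, which is \<open>x\<close>.\<close>

lemma degree2_finite:
  assumes d: "d = 2" and fin: "finite V"
  shows "\<exists>n. is_cycle gr n"
proof -
  obtain x where x: "x \<in> V" using V_ne by blast
  define A where "A = V - {x}"
  have cA: "c A = 2" unfolding A_def using c_compl[OF fin, of "{x}"] c_single[OF x] x d by simp
  have NA: "N x \<subseteq> A" "finite A" "A \<subseteq> V" using N_sub[OF x] N_irrefl[OF x] fin by (auto simp: A_def)
  have "card A + 1 = card V" unfolding A_def using card_Suc_Diff1[OF fin x] by simp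
  moreover have "2 \<le> card A" using card_mono[OF NA(2,1)] N_card[OF x] d by simp
  ultimately have "sep 1 A" unfolding sep_def A_def using fin by auto
  then obtain xs where xs: "ipath xs" "set xs = A" using degree2_ipath[OF d] cA by fastforce
  define m where "m = length xs"
  have m: "2 \<le> m" using \<open>2 \<le> card A\<close> xs by (metis card_length dual_order.trans m_def)
  have adj: "xs ! j \<in> N (xs ! i) \<longleftrightarrow> j = Suc i \<or> i = Suc j" if "i < m" "j < m" for i j
    using xs(1) that by (simp add: ipath_def m_def)
  have xsA: "xs ! i \<in> A" if "i < m" for i using xs that by (auto simp: m_def)
  have inj: "xs ! i = xs ! j \<longleftrightarrow> i = j" if "i < m" "j < m" for i j
    using xs(1) that by (simp add: ipath_def m_def nth_eq_iff_index_eq)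
  have hd: "x \<in> N (xs ! i)" if i: "i = 0 \<or> Suc i = m" "i < m" for i
  proof (rule ccontr)
    assume "x \<notin> N (xs ! i)"
    then have sub: "N (xs ! i) \<subseteq> set xs" using xsA[OF i(2)] N_sub NA(3) xs(2) A_def by blast
    \<comment> \<open>The only neighbour that the end \<open>i\<close> has within the path.\<close>
    define l where "l = (if i = 0 then 1 else i - 1)"
    have "N (xs ! i) \<subseteq> {xs ! l}"
    proof
      fix y assume y: "y \<in> N (xs ! i)"
      then obtain j where j: "y = xs ! j" "j < m" using sub by (metis in_set_conv_nth m_def subsetD)
      then have "j = l" using adj[OF i(2) j(2)] y i j unfolding l_def by (auto split: if_splits)
      then show "y \<in> {xs ! l}" using j by simp
    qed
    then have "card (N (xs ! i)) \<le> 1" using card_mono[of "{xs ! l}"] by simp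
    then show False using N_card xsA[OF i(2)] NA(3) d by fastforce
  qed
  have ends: "xs ! 0 \<in> N x" "xs ! (m - 1) \<in> N x"
    using hd[of 0] hd[of "m - 1"] m xsA[of 0] xsA[of "m - 1"] NA(3) N_sym by auto
  have Nx: "N x = {xs ! 0, xs ! (m - 1)}"
  proof (rule card_subset_eq[symmetric])
    show "card {xs ! 0, xs ! (m - 1)} = card (N x)" using inj[of 0 "m - 1"] m N_card[OF x] d by simp
  qed (use ends N_fin[OF x] in auto)
  have nx: "xs ! i \<in> N x \<longleftrightarrow> i = 0 \<or> Suc i = m" if "i < m" for i
    using inj[OF that, of 0] inj[OF that, of "m - 1"] m that by (auto simp: Nx)
  have xn: "x \<in> N (xs ! i) \<longleftrightarrow> i = 0 \<or> Suc i = m" if "i < m" for i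
    using nx[OF that] N_iff[OF x] xsA[OF that] NA(3) by blast
  have "is_cycle (induced gr (set (xs @ [x]))) (Suc m)"
  proof (rule cycle_induced)
    fix i j assume "i < Suc m" "j < Suc m"
    then consider "i < m" "j < m" | "i < m" "j = m" | "i = m" "j < m" | "i = m" "j = m" by linarith
    then show "(xs @ [x]) ! j \<in> N ((xs @ [x]) ! i) \<longleftrightarrow>
        j = (i + 1) mod Suc m \<or> i = (j + 1) mod Suc m"
    proof cases
      case 1
      then show ?thesis using adj by (auto simp: nth_append m_def[symmetric])
    next
      case 2
      then show ?thesis using xn[of i] by (auto simp: nth_append m_def[symmetric])
    next
      case 3
      then show ?thesis using nx[of j] by (auto simp: nth_append m_def[symmetric])
    next
      case 4
      then show ?thesis using N_irrefl[OF x] m by (auto simp: nth_append m_def[symmetric])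
    qed
  qed (use xs NA(3) x m in \<open>auto simp: ipath_def A_def m_def\<close>)
  moreover have "set (xs @ [x]) = V" using xs(2) x by (auto simp: A_def)
  ultimately show ?thesis using induced_V by metis
qed

text \<open>A walk that never turns back is followed in both directions from an edge. It covers
  everything by connectedness, and a repetition would close it up to a finite graph.\<close>

lemma degree2_infinite:
  assumes d: "d = 2" and inf: "infinite V"
  shows "isomorphic gr two_way_infinite_path"
proof -
  define other where "other p = (SOME z. z \<in> N (snd p) \<and> z \<noteq> fst p)" for p :: "'a \<times> 'a"
  have other: "N y = {x, other (x, y)}" "other (x, y) \<noteq> x" if yx: "y \<in> V" "x \<in> N y" for x y
  proof -
    obtain a b where ab: "N y = {a, b}" "a \<noteq> b"
      using N_card[OF yx(1)] d by (auto simp: card_2_iff)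
    then have "\<exists>z. z \<in> N y \<and> z \<noteq> x" by auto
    then have "other (x, y) \<in> N y \<and> other (x, y) \<noteq> x"
      unfolding other_def fst_conv snd_conv by (rule someI_ex)
    then show "N y = {x, other (x, y)}" "other (x, y) \<noteq> x" using ab yx by auto
  qed
  define walk where "walk p n = ((\<lambda>q. (snd q, other q)) ^^ n) p" for p n
  have walk: "snd (walk (x, y) n) \<in> V \<and> fst (walk (x, y) n) \<in> N (snd (walk (x, y) n))"
    if "y \<in> V" "x \<in> N y" for x y n
  proof (induction n)
    case 0
    then show ?case using that by (simp add: walk_def)
  next
    case (Suc n)
    obtain a b where ab: "walk (x, y) n = (a, b)" by fastforce
    then have "b \<in> V" "a \<in> N b" using Suc by auto
    then have "other (a, b) \<in> N b" using other(1) by auto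
    then show ?case using ab \<open>b \<in> V\<close> N_sub N_sym by (auto simp: walk_def)
  qed
  define f where "f x y n = fst (walk (x, y) n)" for x y n
  have f: "f x y n \<in> V" "f x y n \<in> N (f x y (Suc n))"
      "N (f x y (Suc n)) = {f x y n, f x y (Suc (Suc n))}" "f x y n \<noteq> f x y (Suc (Suc n))"
    if "y \<in> V" "x \<in> N y" for x y n
  proof -
    obtain a b where ab: "walk (x, y) n = (a, b)" by fastforce
    then have w: "b \<in> V" "a \<in> N b" using walk[OF that, of n] by auto
    have e: "f x y n = a" "f x y (Suc n) = b" "f x y (Suc (Suc n)) = other (a, b)"
      using ab by (simp_all add: f_def walk_def)
    show "f x y n \<in> V" "f x y n \<in> N (f x y (Suc n))"
      "N (f x y (Suc n)) = {f x y n, f x y (Suc (Suc n))}" "f x y n \<noteq> f x y (Suc (Suc n))"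
      unfolding e using w other[OF w] N_sub by auto
  qed
  obtain x where x: "x \<in> V" using V_ne by blast
  obtain y where y: "y \<in> N x" using N_card[OF x] d by fastforce
  have yV: "y \<in> V" and xy: "x \<in> N y" using x y N_sub N_sym by auto
  \<comment> \<open>The walks \<open>f x y\<close> and \<open>f y x\<close> run along the same edge
    in opposite directions. Vertex \<open>x\<close> is number 0 of the first and number 1 of the
    second, hence the shift \<open>1 - i\<close>.\<close>
  define w :: "int \<Rightarrow> 'a" where
    "w i = (if 0 \<le> i then f x y (nat i) else f y x (nat (1 - i)))" for i
  have f0: "f a b 0 = a" "f a b (Suc 0) = b" for a b by (simp_all add: f_def walk_def)
  have w: "w i \<in> V \<and> N (w i) = {w (i - 1), w (i + 1)} \<and> w (i - 1) \<noteq> w (i + 1)" for i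
  proof (cases "0 < i")
    case True
    define n where "n = nat (i - 1)"
    have i: "i = int n + 1" using True by (simp add: n_def)
    have "w (i - 1) = f x y n" "w i = f x y (Suc n)" "w (i + 1) = f x y (Suc (Suc n))"
      unfolding i w_def by (simp_all add: nat_add_distrib)
    then show ?thesis using f[OF yV xy, of n] f(1)[OF yV xy, of "Suc n"] by simp
  next
    case False
    define n where "n = nat (- i)"
    have i: "i = - int n" using False by (simp add: n_def)
    have "w (i + 1) = f y x n"
      using f0 unfolding i w_def by (cases n) (auto simp: nat_add_distrib)
    moreover have "w i = f y x (Suc n)"
      using f0 unfolding i w_def by (cases n) (auto simp: nat_add_distrib)
    moreover have "w (i - 1) = f y x (Suc (Suc n))"
      unfolding i w_def by (simp add: nat_add_distrib)
    ultimately show ?thesis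
      using f[OF x y, of n] f(1)[OF x y, of "Suc n"] by (auto simp: insert_commute)
  qed
  have ran: "range w = V"
  proof (rule conn)
    show "range w \<subseteq> V" "range w \<noteq> {}" using w by auto
    show "N u \<subseteq> range w" if "u \<in> range w" for u using that w by auto
  qed
  have irr: "w i \<noteq> w (i + 1)" for i using w[of i] N_irrefl by auto
  have "inj w"
  proof (rule ccontr)
    assume "\<not> inj w"
    then obtain a b where "w a = w b" "a < b"
      unfolding inj_def by (metis linorder_neqE)
    then have "\<exists>n i. 0 < n \<and> w i = w (i + int n)"
      by (intro exI[of _ "nat (b - a)"] exI[of _ a]) simp
    then obtain n where "\<exists>i. 0 < n \<and> w i = w (i + int n)"
        and least: "\<And>m. m < n \<Longrightarrow> \<not> (\<exists>i. 0 < m \<and> w i = w (i + int m))"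
      using exists_least_iff[of "\<lambda>n. \<exists>i. 0 < n \<and> w i = w (i + int n)"] by blast
    then obtain i where i: "0 < n" "w i = w (i + int n)" by blast
    have "n \<noteq> 1" using irr[of i] i(2) by auto
    moreover have "n \<noteq> 2" using w[of "i + 1"] i(2) by (auto simp: add.commute)
    ultimately have n3: "3 \<le> n" using i(1) by linarith
    \<comment> \<open>These indices differ by \<open>n - 2\<close>, so minimality of the period
      \<open>n\<close> separates the vertices. Equality of the two neighbourhoods then makes
      \<open>w (i + int n - 1)\<close> the predecessor of \<open>w i\<close>, and the stretch from
      \<open>i\<close> to \<open>i + n\<close> is closed under neighbours.\<close>
    have "w (i + 1) \<noteq> w (i + int n - 1)"
      using least[of "n - 2"] n3 by (auto simp: of_nat_diff dest: spec[of _ "i + 1"])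
    moreover have "{w (i - 1), w (i + 1)} = {w (i + int n - 1), w (i + int n + 1)}"
      using w[of i] w[of "i + int n"] i(2) by metis
    ultimately have Ni: "N (w i) = {w (i + int n - 1), w (i + 1)}"
      using w[of i] by (auto simp: doubleton_eq_iff)
    define X where "X = w ` {i..i + int n}"
    have "X = V"
    proof (rule conn)
      show "X \<subseteq> V" "X \<noteq> {}" using w by (auto simp: X_def)
      fix u assume "u \<in> X"
      then obtain j where j: "u = w j" "i \<le> j" "j \<le> i + int n" by (auto simp: X_def)
      show "N u \<subseteq> X"
      proof (cases "j = i \<or> j = i + int n")
        case True
        then have "u = w i" using j(1) i(2) by metis
        then have "N u = {w (i + int n - 1), w (i + 1)}" by (simp only: Ni)
        moreover have "w (i + int n - 1) \<in> X" "w (i + 1) \<in> X"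
          unfolding X_def using n3 by (intro imageI; simp)+
        ultimately show ?thesis by simp
      next
        case False
        then have "j - 1 \<in> {i..i + int n}" "j + 1 \<in> {i..i + int n}" using j(2,3) by auto
        then have "w (j - 1) \<in> X" "w (j + 1) \<in> X" unfolding X_def by blast+
        then show ?thesis using w[of j] unfolding j(1) by simp
      qed
    qed
    then show False using inf by (auto simp: X_def)
  qed
  have s: "simple_graph two_way_infinite_path"
    by (auto simp: simple_graph_def two_way_infinite_path_def)
  have "graph_iso w two_way_infinite_path gr"
    unfolding graph_iso_def
  proof
    show "bij_betw w (verts two_way_infinite_path) (verts gr)"
      using \<open>inj w\<close> ran by (simp add: bij_betw_def two_way_infinite_path_def)
    show "edges gr = (`) w ` edges two_way_infinite_path"
    proof (intro set_eqI iffI)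
      fix E assume "E \<in> edges gr"
      then obtain u v where uv: "E = {u, v}" "u \<in> V" "v \<in> N u" by (auto elim!: edges_gr_cases)
      then obtain i where i: "u = w i" using ran by blast
      then consider "v = w (i - 1)" | "v = w (i + 1)" using uv w[of i] by auto
      then show "E \<in> (`) w ` edges two_way_infinite_path"
      proof cases
        case 1
        then have "E = w ` {i - 1, i - 1 + 1}" using uv i by auto
        then show ?thesis unfolding two_way_infinite_path_def snd_conv by blast
      next
        case 2
        then have "E = w ` {i, i + 1}" using uv i by auto
        then show ?thesis unfolding two_way_infinite_path_def snd_conv by blast
      qed
    next
      fix E assume "E \<in> (`) w ` edges two_way_infinite_path"
      then obtain i where "E = {w i, w (i + 1)}" by (auto simp: two_way_infinite_path_def)
      then show "E \<in> edges gr" using w[of i] by (simp add: edge_gr)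
    qed
  qed
  then show ?thesis using graph_iso_sym[OF s] unfolding isomorphic_def by blast
qed

section \<open>Sets of at most four vertices\<close>

lemma N_obtain:
  assumes "x \<in> V" "card S < d" "finite S"
  obtains y where "y \<in> N x" "y \<notin> S"
proof -
  have "\<not> N x \<subseteq> S" using assms N_card card_mono by (metis leD)
  then show ?thesis using that by blast
qed

lemma N_eqI:
  assumes "x \<in> V" "S \<subseteq> N x" "card S = d"
  shows "N x = S"
  using assms N_fin N_card by (metis card_subset_eq)

text \<open>Edge-transitivity moves edges as unordered pairs only; the symmetry of \<open>g\<close>
  absorbs a reversal.\<close>

lemma edge_count:
  assumes "x \<in> V" "y \<in> N x" "x' \<in> V" "y' \<in> N x'"
    and sym: "\<And>x y. x \<in> V \<Longrightarrow> y \<in> N x \<Longrightarrow> g x y = g y x"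
    and inv: "\<And>f x y. aut f \<Longrightarrow> x \<in> V \<Longrightarrow> y \<in> N x \<Longrightarrow> g (f x) (f y) = g x y"
  shows "g x y = (g x' y' :: nat)"
proof -
  obtain f where f: "aut f" "{f x, f y} = {x', y'}"
    using edge_trans[OF assms(1-4)] by (auto simp: aut_def)
  then consider "f x = x'" "f y = y'" | "f x = y'" "f y = x'" by (auto simp: doubleton_eq_iff)
  then show ?thesis
    using inv[OF f(1) assms(1,2)] sym[OF assms(3,4)] by cases auto
qed

lemma tri_const:
  assumes "x \<in> V" "y \<in> N x" "x' \<in> V" "y' \<in> N x'"
  shows "card (N x \<inter> N y) = card (N x' \<inter> N y')"
proof (rule edge_count[OF assms])
  fix f x y assume f: "aut f" and xy: "x \<in> V" "y \<in> N x"
  then have V: "y \<in> V" "N x \<subseteq> V" "N y \<subseteq> V" using N_sub by blast+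
  then have "N (f x) \<inter> N (f y) = f ` (N x \<inter> N y)"
    using f xy aut_Int[OF f V(2,3)] by (simp add: aut_def)
  then show "card (N (f x) \<inter> N (f y)) = card (N x \<inter> N y)"
    using aut_card[OF f] V by (metis le_infI1)
qed (simp add: Int_commute)

text \<open>The neighbourhood of \<open>x\<close> induces a \<open>t\<close>-regular graph on
  \<open>d\<close> vertices, so its degree sum \<open>d * t\<close> is even.\<close>

lemma tri_parity:
  assumes "x \<in> V" "\<And>y. y \<in> N x \<Longrightarrow> card (N x \<inter> N y) = t"
  shows "even (d * t)"
proof -
  have "e (N x) (N x) = d * t"
    unfolding e_def using assms N_card by (simp add: Int_commute)
  then show ?thesis using e_parity[of "N x"] N_fin N_sub assms(1) by metis
qed

text \<open>The \<open>d - 1\<close> common neighbours of \<open>x\<close> and \<open>y\<close>,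
  together with \<open>x\<close>, exhaust \<open>N y\<close>. Hence a closed neighbourhood is closed
  under neighbours.\<close>

lemma complete:
  assumes t: "\<And>x y. x \<in> V \<Longrightarrow> y \<in> N x \<Longrightarrow> card (N x \<inter> N y) + 1 = d"
  shows "finite V" "card V = d + 1" "\<And>x y. x \<in> V \<Longrightarrow> y \<in> V \<Longrightarrow> x \<noteq> y \<Longrightarrow> y \<in> N x"
proof -
  have eq: "insert x (N x) = V" if x: "x \<in> V" for x
  proof (rule conn)
    fix y assume y: "y \<in> insert x (N x)"
    show "N y \<subseteq> insert x (N x)"
    proof (cases "y = x")
      case False
      then have yx: "y \<in> N x" "y \<in> V" "x \<in> N y" using y x N_sub N_sym by auto
      have "N y = insert x (N x \<inter> N y)"
      proof (rule N_eqI[OF yx(2)])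
        show "card (insert x (N x \<inter> N y)) = d"
          using t[OF x yx(1)] N_irrefl[OF x] N_fin[OF x] by simp
      qed (use yx in auto)
      then show ?thesis by auto
    qed auto
  qed (use x N_sub in auto)
  obtain x where x: "x \<in> V" using V_ne by blast
  show "finite V" "card V = d + 1"
    using eq[OF x] N_fin[OF x] N_card[OF x] N_irrefl[OF x]
    by (metis finite_insert, metis card_insert_disjoint Suc_eq_plus1)
  show "y \<in> N x" if "x \<in> V" "y \<in> V" "x \<noteq> y" for x y using eq[OF that(1)] that by blast
qed

lemma c_pair:
  assumes "{x, y} \<subseteq> V" "x \<noteq> y"
  shows "c {x, y} + 2 * of_bool (y \<in> N x) = 2 * d"
  using c_insert[of "{y}" x] c_single[of y] card_N_insert[of x "{}" y] assms by simp

lemma c_triple: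
  assumes "{x, y, z} \<subseteq> V" "distinct [x, y, z]"
  shows "c {x, y, z} + 2 * (of_bool (y \<in> N x) + of_bool (z \<in> N x) + of_bool (z \<in> N y)) = 3 * d"
proof -
  have "c {x, y, z} + 2 * card (N x \<inter> {y, z}) = c {y, z} + d"
    by (rule c_insert) (use assms in auto)
  moreover have "card (N x \<inter> {y, z}) = of_bool (y \<in> N x) + card (N x \<inter> {z})"
    by (rule card_N_insert) (use assms in auto)
  moreover have "card (N x \<inter> {z}) = of_bool (z \<in> N x)" by simp
  moreover have "c {y, z} + 2 * of_bool (z \<in> N y) = 2 * d"
    by (rule c_pair) (use assms in auto)
  ultimately show ?thesis by (simp add: algebra_simps)
qed

lemma c_quad:
  assumes "{w, x, y, z} \<subseteq> V" "distinct [w, x, y, z]"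
  shows "c {w, x, y, z} + 2 * (of_bool (x \<in> N w) + of_bool (y \<in> N w) + of_bool (z \<in> N w) +
    of_bool (y \<in> N x) + of_bool (z \<in> N x) + of_bool (z \<in> N y)) = 4 * d"
proof -
  have "c {w, x, y, z} + 2 * card (N w \<inter> {x, y, z}) = c {x, y, z} + d"
    by (rule c_insert) (use assms in auto)
  moreover have "card (N w \<inter> {x, y, z}) = of_bool (x \<in> N w) + card (N w \<inter> {y, z})"
    by (rule card_N_insert) (use assms in auto)
  moreover have "card (N w \<inter> {y, z}) = of_bool (y \<in> N w) + card (N w \<inter> {z})"
    by (rule card_N_insert) (use assms in auto)
  moreover have "card (N w \<inter> {z}) = of_bool (z \<in> N w)" by simp
  moreover have
    "c {x, y, z} + 2 * (of_bool (y \<in> N x) + of_bool (z \<in> N x) + of_bool (z \<in> N y)) = 3 * d"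
    by (rule c_triple) (use assms in auto)
  ultimately show ?thesis by (simp add: algebra_simps)
qed

lemma singleton_path:
  assumes "A \<subseteq> V" "card A = 1"
  shows "isomorphic (induced gr A) (path_graph 0)"
proof -
  obtain x where x: "A = {x}" using assms(2) by (rule card_1_singletonE)
  then have "ipath [x]" using assms(1) N_irrefl by (simp add: ipath_def)
  then show ?thesis using ipath_path_graph[of "[x]" 0] x by simp
qed

lemma pair_path:
  assumes "A \<subseteq> V" "card A = 2" "c A < 2 * d"
  shows "isomorphic (induced gr A) (path_graph 1)"
proof -
  obtain x y where x: "A = {x, y}" "x \<noteq> y" using assms(2) by (auto simp: card_2_iff)
  then have "y \<in> N x" using c_pair[of x y] assms by (auto split: if_splits simp: of_bool_def)
  then have "ipath [x, y]"
    using x assms(1) N_irrefl N_sym by (auto simp: ipath_def less_Suc_eq nth_Cons')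
  then show ?thesis using ipath_path_graph[of "[x, y]" 1] x by simp
qed

lemma ipath3:
  assumes "{x, y, z} \<subseteq> V" "distinct [x, y, z]" "y \<in> N x" "z \<in> N y" "z \<notin> N x"
  shows "isomorphic (induced gr {x, y, z}) (path_graph 2)"
proof -
  have "x \<in> N y" "y \<in> N z" "x \<notin> N z" using assms N_sym by blast+
  then have "ipath [x, y, z]"
    using assms N_irrefl by (auto simp: ipath_def less_Suc_eq nth_Cons' numeral_3_eq_3)
  then show ?thesis using ipath_path_graph[of "[x, y, z]" 2] by simp
qed

text \<open>With \<open>m\<close> inner edges the cut is \<open>3 * d - 2 * m\<close>. Being below
  \<open>2 * d\<close>, it allows \<open>m \<le> 1\<close> only for \<open>d < 2\<close>,
  \<open>m = 2\<close> only for \<open>d < 4\<close>, and \<open>m = 3\<close> only for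
  \<open>d < 6\<close>.\<close>

lemma triple_cases:
  assumes "A \<subseteq> V" "card A = 3" "c A < 2 * d" "3 \<le> d"
  obtains "d = 3" "isomorphic (induced gr A) (path_graph 2)" "c A = 5"
  | x y z where "A = {x, y, z}" "distinct [x, y, z]" "y \<in> N x" "z \<in> N x" "z \<in> N y" "d < 6"
      "c A + 6 = 3 * d"
proof -
  obtain x y z where A: "A = {x, y, z}" "distinct [x, y, z]"
    using assms(2) by (auto simp: card_3_iff)
  have V: "{x, y, z} \<subseteq> V" using assms A by simp
  have s: "y \<in> N x \<longleftrightarrow> x \<in> N y" "z \<in> N x \<longleftrightarrow> x \<in> N z" "z \<in> N y \<longleftrightarrow> y \<in> N z"
    using V N_iff by auto
  note f = c_triple[OF V A(2)]
  consider "y \<in> N x" "z \<in> N x" "z \<in> N y" | "y \<in> N x" "z \<in> N x" "z \<notin> N y" 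
    | "y \<in> N x" "z \<notin> N x" "z \<in> N y" | "y \<notin> N x" "z \<in> N x" "z \<in> N y"
    | "of_bool (y \<in> N x) + of_bool (z \<in> N x) + of_bool (z \<in> N y) \<le> (1::nat)"
    by (cases "y \<in> N x"; cases "z \<in> N x"; cases "z \<in> N y") auto
  then show ?thesis
  proof cases
    case 1
    then show ?thesis using that(2)[of x y z] A f assms(3) by auto
  next
    case 2
    then have "{x, y, z} = {y, x, z}" "isomorphic (induced gr {y, x, z}) (path_graph 2)"
      using ipath3[of y x z] A V s by auto
    moreover have "c A = 5" "d = 3" using f 2 A assms(3,4) by auto
    ultimately show ?thesis using that(1) A by simp
  next
    case 3
    then have "isomorphic (induced gr {x, y, z}) (path_graph 2)"
      using ipath3[of x y z] A V s by auto
    moreover have "c A = 5" "d = 3" using f 3 A assms(3,4) by auto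
    ultimately show ?thesis using that(1) A by simp
  next
    case 4
    then have "{x, y, z} = {x, z, y}" "isomorphic (induced gr {x, z, y}) (path_graph 2)"
      using ipath3[of x z y] A V s by auto
    moreover have "c A = 5" "d = 3" using f 4 A assms(3,4) by auto
    ultimately show ?thesis using that(1) A by simp
  next
    case 5
    then have "3 * d \<le> c A + 2" using f A by simp
    then show ?thesis using assms(3,4) by linarith
  qed
qed

lemma triangle_cycle:
  assumes "{x, y, z} \<subseteq> V" "distinct [x, y, z]" "y \<in> N x" "z \<in> N x" "z \<in> N y"
  shows "is_cycle (induced gr {x, y, z}) 3"
proof -
  have "x \<in> N y" "x \<in> N z" "y \<in> N z" using assms N_sym by blast+
  moreover have "x \<notin> N x" "y \<notin> N y" "z \<notin> N z" using assms(1) N_irrefl by auto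
  moreover have "i = 0 \<or> i = 1 \<or> i = 2" if "i < 3" for i :: nat using that by linarith
  ultimately have "[x, y, z] ! j \<in> N ([x, y, z] ! i) \<longleftrightarrow> j = (i + 1) mod 3 \<or> i = (j + 1) mod 3"
    if "i < 3" "j < 3" for i j
    using assms that[THEN \<open>\<And>i. i < 3 \<Longrightarrow> i = 0 \<or> i = 1 \<or> i = 2\<close>] by (elim disjE) simp_all
  then have "is_cycle (induced gr (set [x, y, z])) 3"
    using assms by (intro cycle_induced) auto
  then show ?thesis by simp
qed

lemma regular_4_cycle:
  assumes F: "F \<subseteq> V" "card F = 4" and two: "\<And>x. x \<in> F \<Longrightarrow> card (N x \<inter> F) = 2"
  obtains p q r s where "F = {p, q, r, s}" "distinct [p, q, r, s]"
    "N p \<inter> F = {q, s}" "N q \<inter> F = {p, r}" "N r \<inter> F = {q, s}" "N s \<inter> F = {p, r}"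
proof -
  have fin: "finite F" using F(2) card.infinite by fastforce
  have set2: "N x \<inter> F = {u, v}" if "x \<in> F" "u \<in> N x" "v \<in> N x" "u \<in> F" "v \<in> F" "u \<noteq> v" for x u v
    using that two[OF that(1)] fin by (intro card_subset_eq[symmetric]) auto
  obtain p where p: "p \<in> F" using F(2) by fastforce
  obtain q s where qs: "N p \<inter> F = {q, s}" "q \<noteq> s" using two[OF p] by (auto simp: card_2_iff)
  have m: "q \<in> F" "s \<in> F" "p \<noteq> q" "p \<noteq> s" using qs N_irrefl p F(1) by auto
  have "card (F - {p, q, s}) = 1" using m qs p F(2) fin by (subst card_Diff_subset) auto
  then obtain r where r: "F - {p, q, s} = {r}" by (rule card_1_singletonE)
  have rF: "r \<in> F" "r \<noteq> p" "r \<noteq> q" "r \<noteq> s" and Feq: "F = {p, q, r, s}" using r m p by auto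
  have rp: "p \<notin> N r" using qs rF p F(1) N_sym by blast
  have Nr: "N r \<inter> F = {q, s}"
  proof (rule card_subset_eq)
    show "N r \<inter> F \<subseteq> {q, s}" using Feq rp N_irrefl[of r] rF F(1) by auto
  qed (use two[OF rF(1)] qs in auto)
  have sym: "p \<in> N q" "p \<in> N s" "r \<in> N q" "r \<in> N s" using qs Nr N_sym p rF F(1) by blast+
  show ?thesis
    using that[of p q r s] Feq rF m qs Nr p sym set2[of q p r] set2[of s p r] by auto
qed

lemma regular_5_cycle:
  assumes F: "F \<subseteq> V" "card F = 5" and two: "\<And>x. x \<in> F \<Longrightarrow> card (N x \<inter> F) = 2"
  obtains p q r s t where "F = {p, q, r, s, t}" "distinct [p, q, r, s, t]"
    "N p \<inter> F = {q, t}" "N q \<inter> F = {p, r}" "N r \<inter> F = {q, s}" "N s \<inter> F = {r, t}" "N t \<inter> F = {s, p}"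
proof -
  have fin: "finite F" using F(2) card.infinite by fastforce
  have set2: "N x \<inter> F = {u, v}" if "x \<in> F" "u \<in> N x" "v \<in> N x" "u \<in> F" "v \<in> F" "u \<noteq> v" for x u v
    using that two[OF that(1)] fin by (intro card_subset_eq[symmetric]) auto
  have sym: "x \<in> N y" if "x \<in> F" "y \<in> N x" for x y using that F(1) N_sym by blast
  have irr: "x \<notin> N x" if "x \<in> F" for x using that F(1) N_irrefl by blast
  obtain p where p: "p \<in> F" using F(2) by fastforce
  obtain q t where qt: "N p \<inter> F = {q, t}" "q \<noteq> t" using two[OF p] by (auto simp: card_2_iff)
  have m: "q \<in> F" "t \<in> F" "p \<noteq> q" "p \<noteq> t" using qt irr p by auto
  have "card (F - {p, q, t}) = 2" using m qt p F(2) fin by (subst card_Diff_subset) auto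
  then obtain a b where ab: "F - {p, q, t} = {a, b}" "a \<noteq> b" by (auto simp: card_2_iff)
  have Feq: "F = {p, q, t, a, b}" and dis: "distinct [p, q, t, a, b]" using ab m p qt by auto
  have abF: "a \<in> F" "b \<in> F" using Feq by auto
  have "a \<notin> N p \<inter> F" "b \<notin> N p \<inter> F" using qt dis by auto
  then have pab: "p \<notin> N a" "p \<notin> N b" using sym[OF abF(1)] sym[OF abF(2)] abF by blast+
  have single: "\<not> N x \<inter> F \<subseteq> {y}" if "x \<in> F" for x y
    using two[OF that] card_mono[of "{y}" "N x \<inter> F"] by fastforce
  \<comment> \<open>A triangle \<open>p q t\<close> would use up the degrees of its vertices and
    leave \<open>a\<close> with \<open>b\<close> as its only possible neighbour.\<close>
  have "t \<notin> N q"
  proof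
    assume tq: "t \<in> N q"
    have "p \<in> N q" "p \<in> N t" using qt p sym[of p] by blast+
    then have "N q \<inter> F = {p, t}" "N t \<inter> F = {p, q}"
      using set2[of q p t] set2[of t p q] tq sym[OF m(1) tq] m p by simp_all
    moreover have "a \<notin> {p, t}" "a \<notin> {p, q}" using dis by auto
    ultimately have "q \<notin> N a" "t \<notin> N a" using sym[OF abF(1)] abF(1) by blast+
    then have "N a \<inter> F \<subseteq> {b}" using Feq pab irr[OF abF(1)] by blast
    then show False using single abF by blast
  qed
  then have "\<exists>r s. {r, s} = {a, b} \<and> N q \<inter> F = {p, r}"
  proof -
    have "p \<in> N q" using sym[of p q] p qt by blast
    moreover obtain z where "z \<in> N q \<inter> F" "z \<noteq> p" using single[of q p] m by blast
    moreover have "z = a \<or> z = b" using calculation \<open>t \<notin> N q\<close> irr[OF m(1)] Feq by blast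
    ultimately have "N q \<inter> F = {p, z}" using set2[of q p z] m(1) p by blast
    then show ?thesis using \<open>z = a \<or> z = b\<close> by (metis insert_commute)
  qed
  then obtain r s where rs: "{r, s} = {a, b}" "N q \<inter> F = {p, r}" by blast
  have dis': "distinct [p, q, r, s, t]" and Feq': "F = {p, q, r, s, t}"
    using dis Feq rs(1) by (auto simp: doubleton_eq_iff)
  have rsF: "r \<in> F" "s \<in> F" and prs: "p \<notin> N r" "p \<notin> N s"
    using pab abF rs(1) by (auto simp: doubleton_eq_iff)
  have qs: "q \<notin> N s" 
  proof
    assume "q \<in> N s"
    then have "s \<in> N q \<inter> F" using sym[OF rsF(2)] rsF by blast
    then show False using rs(2) dis' by auto
  qed
  have qr: "q \<in> N r" using rs(2) sym[OF m(1), of r] by blast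
  have rt: "t \<notin> N r"
  proof
    assume "t \<in> N r"
    then have "N r \<inter> F = {q, t}" using set2[of r q t] qr m rsF qt(2) by blast
    moreover have "s \<notin> {q, t}" using dis' by auto
    ultimately have "r \<notin> N s" using sym[OF rsF(2)] rsF by blast
    then have "N s \<inter> F \<subseteq> {t}" using Feq' prs qs irr[OF rsF(2)] by blast
    then show False using single rsF by blast
  qed
  have "N r \<inter> F = {q, s}"
  proof (rule card_subset_eq)
    show "N r \<inter> F \<subseteq> {q, s}" using Feq' prs rt irr[OF rsF(1)] by blast
  qed (use two[OF rsF(1)] dis' in auto)
  moreover have "N s \<inter> F = {r, t}"
  proof (rule card_subset_eq)
    show "N s \<inter> F \<subseteq> {r, t}" using Feq' prs qs irr[OF rsF(2)] by blast
  qed (use two[OF rsF(2)] dis' in auto)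
  moreover have "N t \<inter> F = {s, p}"
  proof (rule set2)
    show "s \<in> N t" "p \<in> N t" using calculation(2) qt(1) sym[OF rsF(2)] sym[OF p] by blast+
  qed (use m p rsF dis' in auto)
  ultimately show ?thesis using that[of p q r s t] dis' Feq' qt rs by blast
qed

section \<open>The octahedron and the icosahedron\<close>

text \<open>The form with \<open>list_all2\<close> lets simplification run along the vertex list and
  the table in parallel.\<close>

lemma embed_list:
  assumes "xs \<noteq> []" "distinct xs" "set xs \<subseteq> V"
    and T: "list_all2 (\<lambda>x js. distinct js \<and> length js = d \<and>
      (\<forall>j\<in>set js. j < length xs \<and> xs ! j \<in> N x)) xs T"
  shows "set xs = V" "isomorphic gr (label_graph T)"
proof -
  have len: "length xs = length T" using T by (rule list_all2_lengthD)
  have *: "distinct (T ! i) \<and> length (T ! i) = d \<and>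
      (\<forall>j\<in>set (T ! i). j < length xs \<and> xs ! j \<in> N (xs ! i))" if "i < length T" for i
    using list_all2_nthD[OF T, of i] that len by simp
  show "set xs = V" "isomorphic gr (label_graph T)"
    using embed_label_graph[OF len assms(1-3)] * len by auto
qed

text \<open>The neighbourhood of \<open>v\<close> is a 4-cycle. The remaining neighbour
  \<open>w\<close> of \<open>p\<close> is passed around it: the edge \<open>p q\<close> lies in a
  second triangle besides the one with \<open>v\<close>, and only \<open>w\<close> can be its third
  vertex.\<close>

lemma octahedron:
  assumes d: "d = 4" and t: "\<And>x y. x \<in> V \<Longrightarrow> y \<in> N x \<Longrightarrow> card (N x \<inter> N y) = 2"
  shows "finite V" "card V = 6" "isomorphic gr (label_graph octahedron_table)"
proof -
  obtain v where v: "v \<in> V" using V_ne by blast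
  have "card (N x \<inter> N v) = 2" if "x \<in> N v" for x using t[OF v that] by (simp add: Int_commute)
  then obtain p q r s where F: "N v = {p, q, r, s}" "distinct [p, q, r, s]"
      and L: "N p \<inter> N v = {q, s}" "N q \<inter> N v = {p, r}" "N r \<inter> N v = {q, s}" "N s \<inter> N v = {p, r}"
    using regular_4_cycle[of "N v"] N_sub[OF v] N_card[OF v] d by metis
  have V: "p \<in> V" "q \<in> V" "r \<in> V" "s \<in> V" using N_sub[OF v] F by auto
  have vN: "v \<in> N p" "v \<in> N q" "v \<in> N r" "v \<in> N s" using N_sym[OF v] F by auto
  have inN: "q \<in> N p" "s \<in> N p" "p \<in> N q" "r \<in> N q" "q \<in> N r" "s \<in> N r" "p \<in> N s" "r \<in> N s"
    using L[THEN equalityD2] by simp_all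
  have notN: "r \<notin> N p" "s \<notin> N q" "p \<notin> N r" "q \<notin> N s" using L F by auto
  have vne: "v \<notin> {p, q, r, s}" using N_irrefl[OF v] F by auto
  have pqrs: "p \<noteq> q" "p \<noteq> r" "p \<noteq> s" "q \<noteq> r" "q \<noteq> s" "r \<noteq> s" using F by auto
  obtain w where w: "w \<in> N p" "w \<notin> {v, q, s}"
  proof -
    have "card {v, q, s} < d" using card_length[of "[v, q, s]"] d by simp
    then show thesis using N_obtain[OF V(1), of "{v, q, s}"] that by blast
  qed
  have Np: "N p = {v, q, s, w}"
    by (rule N_eqI[OF V(1)]) (use vN inN w vne pqrs d in auto)
  have wV: "w \<in> V" using N_sub[OF V(1)] w by blast
  have wv: "w \<notin> N v" using w L(1) by blast
  have common: "\<exists>z. z \<in> N x \<inter> N y \<and> z \<noteq> v" if "x \<in> V" "y \<in> N x" for x y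
    using not_le_singleton[of "N x \<inter> N y" v] t[OF that] by auto
  have wq: "w \<in> N q" using common[OF V(1) inN(1)] Np notN(2) N_irrefl[OF V(2)] by blast
  have ws: "w \<in> N s" using common[OF V(1) inN(2)] Np notN(4) N_irrefl[OF V(4)] by blast
  have pw: "p \<noteq> w" "r \<noteq> w" using w wv F N_irrefl[OF V(1)] notN by auto
  have Nq: "N q = {v, p, r, w}"
    by (rule N_eqI[OF V(2)]) (use vN inN wq w pw vne pqrs d in auto)
  have wr: "w \<in> N r" using common[OF V(2) inN(4)] Nq notN(3) N_irrefl[OF V(3)] by blast
  have Nw: "p \<in> N w" "q \<in> N w" "r \<in> N w" "s \<in> N w"
    using N_sym w(1) wq wr ws V by blast+
  have dis: "distinct [v, p, q, r, s, w]" using vne pqrs w pw by auto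
  have V6: "set [v, p, q, r, s, w] \<subseteq> V" using v V wV by simp
  have T: "list_all2 (\<lambda>x js. distinct js \<and> length js = d \<and>
      (\<forall>j\<in>set js. j < length [v, p, q, r, s, w] \<and> [v, p, q, r, s, w] ! j \<in> N x))
      [v, p, q, r, s, w] octahedron_table"
    unfolding octahedron_table_def using d F(1) vN inN w(1) wq wr ws Nw by simp
  have "set [v, p, q, r, s, w] = V" "isomorphic gr (label_graph octahedron_table)"
    using embed_list[OF _ dis V6 T] by simp_all
  then show "finite V" "card V = 6" "isomorphic gr (label_graph octahedron_table)"
    using distinct_card[OF dis] by (metis List.finite_set, simp, simp)
qed

text \<open>Indices are read modulo 5: the neighbours \<open>A i\<close> of \<open>v\<close> form a cycle, \<open>B i\<close> is the common neighbour
  of \<open>A i\<close> and \<open>A (i + 1)\<close> other than \<open>v\<close>, and the fifth neighbour \<open>W i\<close> of \<open>B i\<close> does not depend on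
  \<open>i\<close>.\<close>

lemma icosahedron:
  assumes d: "d = 5" and t: "\<And>x y. x \<in> V \<Longrightarrow> y \<in> N x \<Longrightarrow> card (N x \<inter> N y) = 2"
  shows "isomorphic gr (label_graph icosahedron_table)"
proof -
  obtain v where v: "v \<in> V" using V_ne by blast
  have "card (N x \<inter> N v) = 2" if "x \<in> N v" for x using t[OF v that] by (simp add: Int_commute)
  then obtain p q r s u where F: "N v = {p, q, r, s, u}" and dis: "distinct [p, q, r, s, u]"
      and L: "N p \<inter> N v = {q, u}" "N q \<inter> N v = {p, r}" "N r \<inter> N v = {q, s}" "N s \<inter> N v = {r, u}"
        "N u \<inter> N v = {s, p}"
    using regular_5_cycle[of "N v"] N_sub[OF v] N_card[OF v] d by metis
  define A where "A = cyc5 p q r s u"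
  have A_per: "A (i + 5) = A i" for i unfolding A_def by (rule cyc5_period)
  have ANv: "A i \<in> N v" for i
    unfolding A_def by (rule cyc5_all[where P = "\<lambda>p q r s u. p \<in> N v"]) (use F in auto)
  have AL: "N (A i) \<inter> N v = {A (i + 1), A (i - 1)}" for i
    unfolding A_def by (rule cyc5_all[where P = "\<lambda>p q r s u. N p \<inter> N v = {q, u}"])
      (use L in auto)
  have Adis: "distinct [A i, A (i + 1), A (i + 2), A (i - 2), A (i - 1)]" for i
    unfolding A_def by (rule cyc5_all[where P = "\<lambda>p q r s u. distinct [p, q, r, s, u]"])
      (use dis in auto)
  have Ane: "A i \<noteq> A (i + 1)" "A i \<noteq> A (i + 2)" "A i \<noteq> A (i - 1)" "A i \<noteq> A (i - 2)"
      "A (i + 1) \<noteq> A (i - 1)" "A (i - 1) \<noteq> A (i + 2)" "A (i + 1) \<noteq> A (i - 2)" for i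
    using Adis[of i] by auto
  have AL1: "N (A (i + 1)) \<inter> N v = {A (i + 2), A i}" for i
    using AL[of "i + 1", unfolded int_shift] .
  have AV: "A i \<in> V" for i using ANv N_sub[OF v] by blast
  have vA: "v \<in> N (A i)" for i using N_sym[OF v ANv] .
  have AA: "A (i + 1) \<in> N (A i)" "A (i - 1) \<in> N (A i)" for i using AL[of i] by blast+
  define B where "B i = (SOME z. N (A i) \<inter> N (A (i + 1)) = {v, z} \<and> z \<noteq> v)" for i
  have B: "N (A i) \<inter> N (A (i + 1)) = {v, B i}" "B i \<noteq> v" for i
  proof -
    have "card (N (A i) \<inter> N (A (i + 1))) = 2" using t[OF AV AA(1)] .
    then obtain a b where "N (A i) \<inter> N (A (i + 1)) = {a, b}" "a \<noteq> b" by (auto simp: card_2_iff)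
    moreover have "v \<in> N (A i) \<inter> N (A (i + 1))" using vA by simp
    ultimately have "\<exists>z. N (A i) \<inter> N (A (i + 1)) = {v, z} \<and> z \<noteq> v"
      by (metis insertE insert_commute singletonD)
    then have "N (A i) \<inter> N (A (i + 1)) = {v, B i} \<and> B i \<noteq> v" unfolding B_def by (rule someI_ex)
    then show "N (A i) \<inter> N (A (i + 1)) = {v, B i}" "B i \<noteq> v" by auto
  qed
  have B': "N (A i) \<inter> N (A (i - 1)) = {v, B (i - 1)}" for i
    using B(1)[of "i - 1", unfolded int_shift] by (simp add: Int_commute)
  have B1: "N (A (i + 1)) \<inter> N (A (i + 2)) = {v, B (i + 1)}" for i
    using B(1)[of "i + 1", unfolded int_shift] by simp
  have B_per: "B (i + 5) = B i" for i
    unfolding B_def int_shift using A_per[of i] A_per[of "i + 1", unfolded int_shift] by simp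
  have BA: "B i \<in> N (A i)" "B i \<in> N (A (i + 1))" "B (i - 1) \<in> N (A i)" for i
    using B(1)[of i] B'[of i] by blast+
  have BV: "B i \<in> V" for i using BA(1) N_sub[OF AV] by blast
  have AB: "A i \<in> N (B i)" "A (i + 1) \<in> N (B i)" "A i \<in> N (B (i - 1))" for i
    using BA N_sym[OF AV] by blast+
  have Bv: "B i \<notin> N v" for i
  proof
    assume "B i \<in> N v"
    then have "B i \<in> {A (i + 1), A (i - 1)}" "B i \<in> {A (i + 2), A i}"
      using AL[of i] AL1[of i] BA[of i] by blast+
    then show False using Ane[of i] Ane(1)[of "i + 1", unfolded int_shift] by auto
  qed
  have BneA: "B i \<noteq> A j" "A j \<noteq> B i" for i j using Bv ANv by metis+
  have only2: False
    if "x \<in> V" "x' \<in> N x" "{y, y', z} \<subseteq> N x \<inter> N x'" "distinct [y, y', z]" for x x' y y' z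
  proof -
    have "card {y, y', z} = 3" using that(4) by auto
    moreover have "card {y, y', z} \<le> card (N x \<inter> N x')" using that N_fin by (intro card_mono) auto
    ultimately show False using t[OF that(1,2)] by simp
  qed
  have another: "\<exists>z. z \<in> N x \<and> z \<in> N y \<and> z \<noteq> k" if "x \<in> V" "y \<in> N x" for x y k
    using not_le_singleton[of "N x \<inter> N y" k] t[OF that] by auto
  have N_eq5: "N x = {a, b, e, f, g}"
    if "x \<in> V" "{a, b, e, f, g} \<subseteq> N x" "distinct [a, b, e, f, g]" for x a b e f g
    by (rule N_eqI) (use that d in auto)
  have N_new: "\<exists>z. z \<in> N x \<and> z \<notin> {a, b, e, f}" if "x \<in> V" for x a b e f
  proof -
    have "card {a, b, e, f} < d" using card_length[of "[a, b, e, f]"] d by simp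
    then show ?thesis using N_obtain[OF that, of "{a, b, e, f}"] by blast
  qed
  \<comment> \<open>Otherwise the fifth neighbour \<open>z\<close> of \<open>A (i + 1)\<close> would
    be adjacent to none of the other four, so the edge to \<open>z\<close> would lie in no
    triangle.\<close>
  have Bne1: "B i \<noteq> B (i + 1)" for i
  proof
    assume eq: "B i = B (i + 1)"
    let ?a = "A (i + 1)"
    have nb: "A i \<in> N ?a" "A (i + 2) \<in> N ?a" "B i \<in> N ?a" "v \<in> N ?a"
      using AA[of "i + 1", unfolded int_shift] BA vA by auto
    obtain z where z: "z \<in> N ?a" "z \<notin> {v, A i, A (i + 2), B i}" using N_new[OF AV] by blast
    have zV: "z \<in> V" using z N_sub[OF AV] by blast
    have "v \<noteq> A i" "v \<noteq> A (i + 2)" using ANv N_irrefl[OF v] by metis+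
    then have Na: "N ?a = {v, A i, A (i + 2), B i, z}"
      using nb z BneA B(2)[of i] Ane(2)[of i] by (intro N_eq5[OF AV]) auto
    have "v \<notin> N z"
    proof
      assume "v \<in> N z"
      then have "z \<in> N ?a \<inter> N v" using z N_sym[OF zV] by blast
      then show False using AL1[of i] z(2) by blast
    qed
    moreover have "A i \<notin> N z"
    proof
      assume "A i \<in> N z"
      then have "z \<in> N (A i) \<inter> N ?a" using z N_sym[OF zV] by blast
      then show False using B(1)[of i] z(2) by blast
    qed
    moreover have "A (i + 2) \<notin> N z"
    proof
      assume "A (i + 2) \<in> N z"
      then have "z \<in> N ?a \<inter> N (A (i + 2))" using z N_sym[OF zV] by blast
      then show False using B1[of i] z(2) eq by auto
    qed
    moreover have "B i \<notin> N z"
    proof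
      assume "B i \<in> N z"
      then have "z \<in> N (B i)" using N_sym[OF zV] by blast
      moreover have "A (i + 2) \<in> N (B i)" using AB(2)[of "i + 1", unfolded int_shift] eq by simp
      ultimately show False
        using only2[OF AV nb(3), of "A i" "A (i + 2)" z] z nb AB(1)[of i] Ane(2)[of i] by auto
    qed
    ultimately have "N ?a \<inter> N z = {}" using N_irrefl[OF zV] unfolding Na by auto
    then show False using t[OF AV z(1)] by simp
  qed
  \<comment> \<open>The edge from \<open>A i\<close> to \<open>B i\<close> lies in a second triangle
    besides the one with \<open>A (i + 1)\<close>; among the neighbours of \<open>A i\<close> only
    \<open>B (i - 1)\<close> is left as its third vertex.\<close>
  have BB: "B (i - 1) \<in> N (B i)" for i
  proof -
    have NA: "N (A i) = {v, A (i - 1), A (i + 1), B i, B (i - 1)}"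
      using AA[of i] BA[of i] vA Bne1[of "i - 1", unfolded int_shift] BneA B(2)[of i]
        B(2)[of "i - 1"] Ane(5)[of i] ANv[of "i - 1", unfolded int_shift]
        ANv[of "i + 1", unfolded int_shift]
        N_irrefl[OF v] by (intro N_eq5[OF AV]) auto
    obtain z where z: "z \<in> N (A i)" "z \<in> N (B i)" "z \<noteq> A (i + 1)"
      using another[OF AV BA(1)] by blast
    have "z \<noteq> v" using z(2) Bv N_sym[OF BV] by blast
    moreover have "z \<noteq> B i" using z(2) N_irrefl[OF BV] by blast
    moreover have "z \<noteq> A (i - 1)"
    proof
      assume "z = A (i - 1)"
      then have "B i \<in> N (A i) \<inter> N (A (i - 1))" using z(2) N_sym[OF BV] BA(1) by blast
      then show False using B'[of i] B(2)[of i] Bne1[of "i - 1", unfolded int_shift] by auto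
    qed
    ultimately show ?thesis using z NA by blast
  qed
  have NA: "N (A i) = {v, A (i - 1), A (i + 1), B i, B (i - 1)}" for i
    using AA[of i] BA[of i] vA Bne1[of "i - 1", unfolded int_shift] BneA B(2)[of i] B(2)[of "i - 1"]
      Ane(5)[of i] ANv[of "i - 1", unfolded int_shift] ANv[of "i + 1", unfolded int_shift]
      N_irrefl[OF v] by (intro N_eq5[OF AV]) auto
  have BB': "B (i + 1) \<in> N (B i)" for i
    using BB[of "i + 1", unfolded int_shift] N_sym[OF BV] by simp
  \<comment> \<open>Otherwise the adjacent vertices \<open>A (i + 1)\<close> and \<open>B i\<close>
    would have the three common neighbours \<open>A i\<close>, \<open>A (i + 2)\<close> and
    \<open>B (i + 1)\<close>.\<close>
  have Bne2: "B i \<noteq> B (i + 2)" for i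
  proof
    assume eq: "B i = B (i + 2)"
    have "A (i + 2) \<in> N (B i)" "B (i + 1) \<in> N (B i)"
      using AB(1)[of "i + 2", unfolded int_shift] BB'[of i] eq by simp_all
    moreover have "A i \<in> N (A (i + 1))" "A (i + 2) \<in> N (A (i + 1))"
      using AA[of "i + 1", unfolded int_shift] by auto
    ultimately show False
      using only2[OF AV BA(2)[of i], of "A i" "A (i + 2)" "B (i + 1)"] AB(1)[of i]
        BA(1)[of "i + 1", unfolded int_shift]
        Ane(2)[of i] BneA by auto
  qed
  have Bne3: "B (i - 1) \<noteq> B (i + 2)" "B (i - 1) \<noteq> B (i + 1)" "B (i - 2) \<noteq> B (i + 1)" for i
    using Bne2[of "i + 2", unfolded int_shift] Bne2[of "i - 1", unfolded int_shift]
      Bne2[of "i + 1", unfolded int_shift] B_per[of "i - 1", unfolded int_shift]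
      B_per[of "i - 2", unfolded int_shift] by auto
  have notAB: "A j \<notin> N (B i)" if "B i \<noteq> B j" "B i \<noteq> B (j - 1)" for i j
  proof
    assume "A j \<in> N (B i)"
    then have "B i \<in> N (A j)" using N_sym[OF BV] by blast
    then show False using NA[of j] BneA B(2) that by auto
  qed
  \<comment> \<open>Such an edge would complete the neighbourhood of \<open>B i\<close>, and then
    the edge from \<open>B i\<close> to \<open>B (i - 1)\<close> would lie in no triangle but the
    one with \<open>A i\<close>.\<close>
  have far: "B (i + 2) \<notin> N (B i)" for i
  proof
    assume a: "B (i + 2) \<in> N (B i)"
    then have a': "B i \<in> N (B (i + 2))" using N_sym[OF BV] by blast
    have NB: "N (B i) = {A i, A (i + 1), B (i + 1), B (i - 1), B (i + 2)}"
      using AB[of i] BB[of i] BB'[of i] a BneA Ane(1)[of i] Bne1[of "i + 1", unfolded int_shift]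
        Bne3[of i]
      by (intro N_eq5[OF BV]) auto
    have NB2: "N (B (i + 2)) = {A (i + 2), A (i + 3), B (i + 3), B (i + 1), B i}"
      using AB[of "i + 2", unfolded int_shift] BB[of "i + 2", unfolded int_shift]
        BB'[of "i + 2", unfolded int_shift] a' BneA Ane(1)[of "i + 2", unfolded int_shift]
        Bne3(2)[of "i + 2", unfolded int_shift] Bne1[of i] Bne3(1)[of "i + 1", unfolded int_shift]
      by (intro N_eq5[OF BV]) auto
    obtain z where z: "z \<in> N (B i)" "z \<in> N (B (i - 1))" "z \<noteq> A i"
      using another[OF BV BB] by blast
    have "B (i - 1) \<noteq> B (i + 1)" "B (i - 1) \<noteq> B i"
      using Bne3(2) Bne1[of "i - 1", unfolded int_shift] by auto
    then have "z \<noteq> A (i + 1)" using notAB[of "i - 1" "i + 1", unfolded int_shift] z(2) by auto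
    moreover have "z \<noteq> B (i - 1)" using z(2) N_irrefl[OF BV] by blast
    moreover have "z \<noteq> B (i + 1)"
    proof
      assume "z = B (i + 1)"
      then have "B (i - 1) \<in> N (B (i + 1))" using z(2) N_sym[OF BV] by blast
      moreover have "A (i + 1) \<in> N (B (i + 1))" "B (i + 2) \<in> N (B (i + 1))"
        using AB(1)[of "i + 1", unfolded int_shift] BB'[of "i + 1", unfolded int_shift] by auto
      ultimately show False
        using only2[OF BV BB'[of i], of "A (i + 1)" "B (i + 2)" "B (i - 1)"] AB(2)[of i] BB[of i] a
          BneA Bne3(1)[of i] by auto
    qed
    moreover have "z \<noteq> B (i + 2)"
    proof
      assume "z = B (i + 2)"
      then have "B (i - 1) \<in> N (B (i + 2))" using z(2) N_sym[OF BV] by blast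
      moreover have "B (i - 1) \<noteq> B (i + 3)"
        using Bne1[of "i + 3", unfolded int_shift] B_per[of "i - 1", unfolded int_shift] by simp
      ultimately show False
        using NB2 BneA Bne3(2)[of i] Bne1[of "i - 1", unfolded int_shift] by auto
    qed
    ultimately show False using z NB by blast
  qed
  define W where "W i = (SOME z. z \<in> N (B i) \<and> z \<notin> {A i, A (i + 1), B (i + 1), B (i - 1)})" for i
  have W: "W i \<in> N (B i)" "W i \<notin> {A i, A (i + 1), B (i + 1), B (i - 1)}" for i
    using someI_ex[OF N_new[OF BV, of i "A i" "A (i + 1)" "B (i + 1)" "B (i - 1)"]]
    unfolding W_def by auto
  have NB: "N (B i) = {A i, A (i + 1), B (i + 1), B (i - 1), W i}" for i
    using AB[of i] BB[of i] BB'[of i] W[of i] BneA Ane(1)[of i] Bne3[of i]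
    by (intro N_eq5[OF BV]) auto
  \<comment> \<open>The edge from \<open>B i\<close> to \<open>B (i + 1)\<close> needs a second
    triangle, whose third vertex can only be the fifth neighbour of both.\<close>
  have W_step: "W i = W (i + 1)" for i
  proof -
    obtain z where z: "z \<in> N (B i)" "z \<in> N (B (i + 1))" "z \<noteq> A (i + 1)"
      using another[OF BV BB'] by blast
    have "B (i + 1) \<noteq> B i" "B (i + 1) \<noteq> B (i - 1)" using Bne1[of i] Bne3(2)[of i] by auto
    then have "z \<noteq> A i" using notAB[of "i + 1" i] z(2) by auto
    moreover have "z \<noteq> B (i + 1)" using z(2) N_irrefl[OF BV] by blast
    moreover have "z \<noteq> B (i - 1)"
    proof
      assume "z = B (i - 1)"
      then have "B (i + 1) \<in> N (B (i - 1))" using z(2) N_sym[OF BV] by blast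
      then show False using far[of "i - 1", unfolded int_shift] by simp
    qed
    ultimately have zW: "z = W i" using z NB[of i] by blast
    have "B i \<noteq> B (i + 1)" "B i \<noteq> B (i + 2)" using Bne1 Bne2 by auto
    then have "z \<noteq> A (i + 2)" using notAB[of i "i + 2", unfolded int_shift] z(1) by auto
    moreover have "z \<noteq> B (i + 2)" using z(1) far by blast
    moreover have "z \<noteq> B i" using z(1) N_irrefl[OF BV] by blast
    ultimately show ?thesis using z NB[of "i + 1", unfolded int_shift] zW by auto
  qed
  define w where "w = W 0"
  have Ww: "W 0 = w" "W 1 = w" "W 2 = w" "W 3 = w" "W 4 = w"
    using W_step[of 0] W_step[of 1] W_step[of 2] W_step[of 3] by (simp_all add: w_def)
  have wV: "w \<in> V" using W(1)[of 0] N_sub[OF BV] by (auto simp: w_def)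
  have wB: "w \<in> N (B 0)" "w \<in> N (B 1)" "w \<in> N (B 2)" "w \<in> N (B 3)" "w \<in> N (B 4)"
    using W(1)[of 0] W(1)[of 1] W(1)[of 2] W(1)[of 3] W(1)[of 4] by (simp_all add: Ww)
  have Bw: "B 0 \<in> N w" "B 1 \<in> N w" "B 2 \<in> N w" "B 3 \<in> N w" "B 4 \<in> N w"
    using wB N_sym[OF BV] by blast+
  have wne: "w \<notin> {A 0, A 1, A 2, A 3, A 4, B 0, B 1, B 2, B 3, B 4}"
    using W(2)[of 0] W(2)[of 1] W(2)[of 2] W(2)[of 3] W(2)[of 4] B_per[of 0] by (auto simp: Ww)
  have wv: "w \<noteq> v" using wB(1) Bv N_sym[OF BV] by blast
  have A5: "A 5 = A 0" "A (-1) = A 4" "B 5 = B 0" "B (-1) = B 4"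
    using A_per[of 0] A_per[of "-1"] B_per[of 0] B_per[of "-1"] by simp_all
  have disA: "distinct [A 0, A 1, A 2, A 3, A 4]"
    using dis unfolding A_def cyc5_vals .
  have disB: "distinct [B 0, B 1, B 2, B 3, B 4]"
    using Bne1[of 0] Bne1[of 1] Bne1[of 2] Bne1[of 3] Bne1[of 4] Bne2[of 0] Bne2[of 1] Bne2[of 2]
      Bne2[of 3] Bne2[of 4] B_per[of 0] B_per[of 1] by auto
  let ?xs = "[v, A 0, A 1, A 2, A 3, A 4, B 0, B 1, B 2, B 3, B 4, w]"
  have dis: "distinct ?xs"
    using disA disB wne wv BneA B(2)[symmetric] ANv N_irrefl[OF v] by auto
  have sub: "set ?xs \<subseteq> V" using v AV BV wV by simp
  have T: "list_all2 (\<lambda>x js. distinct js \<and> length js = d \<and>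
      (\<forall>j\<in>set js. j < length ?xs \<and> ?xs ! j \<in> N x)) ?xs icosahedron_table"
    unfolding icosahedron_table_def
    using d ANv vA AA[of 0] AA[of 1] AA[of 2] AA[of 3] AA[of 4] BA[of 0] BA[of 1] BA[of 2] BA[of 3]
      BA[of 4] AB[of 0] AB[of 1] AB[of 2] AB[of 3] AB[of 4] BB[of 0] BB[of 1] BB[of 2] BB[of 3]
        BB[of 4]
      BB'[of 0] BB'[of 1] BB'[of 2] BB'[of 3] BB'[of 4] wB Bw
    by (simp add: A5)
  show ?thesis using embed_list(2)[OF _ dis sub T] by simp
qed

section \<open>Line graphs of cubic graphs\<close>

definition tri :: "'a \<Rightarrow> 'a \<Rightarrow> 'a set" where
  "tri x y = {x, y} \<union> (N x \<inter> N y)"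

definition triangles :: "'a set set" where
  "triangles = {tri x y |x y. x \<in> V \<and> y \<in> N x}"

text \<open>The graph is the line graph of the graph whose vertices are the triangles; the edge corresponding
  to \<open>x\<close> joins the two triangles through \<open>x\<close>.\<close>

lemma cubic_line_graph_gr:
  assumes d: "d = 4" and t: "\<And>x y. x \<in> V \<Longrightarrow> y \<in> N x \<Longrightarrow> card (N x \<inter> N y) = 1"
  shows "cubic_line_graph gr"
proof -
  have tri: "\<exists>z. N x \<inter> N y = {z} \<and> tri x y = {x, y, z} \<and> distinct [x, y, z] \<and> z \<in> V \<and> y \<in> V \<and>
      N x \<inter> N z = {y} \<and> N y \<inter> N z = {x} \<and>
      z \<in> N x \<and> z \<in> N y \<and> x \<in> N y \<and> x \<in> N z \<and> y \<in> N z"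
    if xy: "x \<in> V" "y \<in> N x" for x y
  proof -
    obtain z where z: "N x \<inter> N y = {z}" using t[OF xy] by (rule card_1_singletonE)
    have V: "y \<in> V" "z \<in> V" using N_sub[OF xy(1)] xy(2) z by blast+
    have zs: "z \<in> N x" "z \<in> N y" "x \<in> N y" "x \<in> N z" "y \<in> N z"
      using z N_sym[OF xy] N_sym[OF xy(1)] N_sym[OF V(1)] by blast+
    have dis: "distinct [x, y, z]" using zs xy N_irrefl V by auto
    obtain u where u: "N x \<inter> N z = {u}" using t[OF xy(1) zs(1)] by (rule card_1_singletonE)
    obtain v where v: "N y \<inter> N z = {v}" using t[OF V(1) zs(2)] by (rule card_1_singletonE)
    have "y = u" "x = v" using u v zs xy by blast+
    then have "N x \<inter> N z = {y}" "N y \<inter> N z = {x}" using u v by simp_all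
    then show ?thesis using z dis V zs by (auto simp: tri_def)
  qed
  \<comment> \<open>A triangle is determined by any two of its vertices, because each edge lies in
    just one.\<close>
  have tri_eq: "T = tri u v \<and> v \<in> N u" if T: "T \<in> triangles" "u \<in> T" "v \<in> T" "u \<noteq> v" for T u v
  proof -
    obtain x y where xy: "x \<in> V" "y \<in> N x" "T = tri x y" using T(1) by (auto simp: triangles_def)
    obtain z where z: "N x \<inter> N y = {z}" "tri x y = {x, y, z}" "distinct [x, y, z]" "z \<in> V" "y \<in> V"
      "N x \<inter> N z = {y}" "N y \<inter> N z = {x}"
      and zs: "z \<in> N x" "z \<in> N y" "x \<in> N y" "x \<in> N z" "y \<in> N z"
      using tri[OF xy(1,2)] by (elim exE conjE) (rule that)
    have "N y \<inter> N x = {z}" "N z \<inter> N x = {y}" "N z \<inter> N y = {x}"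
      using z(1,6,7) by (simp_all add: Int_commute)
    then have eqs: "tri x y = T" "tri y x = T" "tri x z = T" "tri z x = T" "tri y z = T"
      "tri z y = T"
      using z(1,6,7) by (simp_all add: xy(3) tri_def insert_commute)
    have "u \<in> {x, y, z}" "v \<in> {x, y, z}" using T(2,3) xy(3) z(2) by simp_all
    then show ?thesis
      using T(4) by (elim insertE emptyE; use eqs zs xy(2) in metis)
  qed
  have sub: "T \<subseteq> V \<and> card T = 3" if "T \<in> triangles" for T
    using that tri unfolding triangles_def by fastforce
  define h where "h x = {T \<in> triangles. x \<in> T}" for x
  \<comment> \<open>The four neighbours of \<open>x\<close> fall into two adjacent pairs,
    \<open>a b\<close> and \<open>p q\<close>.\<close>
  have h2: "card (h x) = 2" if x: "x \<in> V" for x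
  proof -
    obtain a where a: "a \<in> N x" using N_card[OF x] d by fastforce
    obtain b where b: "N x \<inter> N a = {b}" using t[OF x a] by (rule card_1_singletonE)
    have "card {a, b} < d" using card_length[of "[a, b]"] d by simp
    then obtain p where p: "p \<in> N x" "p \<notin> {a, b}" using N_obtain[OF x, of "{a, b}"] by blast
    have xa: "tri x a = {x, a, b}" and ab: "b \<in> N x" "a \<noteq> b" "x \<noteq> a" "x \<noteq> b"
      using tri[OF x a] b by auto
    obtain q where q: "N x \<inter> N p = {q}" "tri x p = {x, p, q}" "distinct [x, p, q]"
      using tri[OF x p(1)] by blast
    have qa: "q \<noteq> a"
    proof
      assume "q = a"
      then have "p \<in> N x \<inter> N a" using q(1) p N_sym tri[OF x p(1)] N_sub[OF x] by blast
      then show False using b p by simp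
    qed
    have qb: "q \<noteq> b"
    proof
      assume "q = b"
      then have "p \<in> N x \<inter> N b" using q(1) p N_sym N_sub[OF x] by blast
      moreover have "N x \<inter> N b = {a}" using tri[OF x a] b by auto
      ultimately show False using p by simp
    qed
    have Nx: "N x = {a, b, p, q}"
      by (rule N_eqI[OF x]) (use a ab p q qa qb d in auto)
    have "h x = {tri x a, tri x p}"
    proof
      show "{tri x a, tri x p} \<subseteq> h x" using x a p by (auto simp: h_def triangles_def tri_def)
      show "h x \<subseteq> {tri x a, tri x p}"
      proof
        fix T assume T: "T \<in> h x"
        then have T': "T \<in> triangles" "x \<in> T" by (auto simp: h_def)
        then have "card (T - {x}) = 2" using sub[of T] by (subst card_Diff_singleton) auto
        then have "T - {x} \<noteq> {}" by (metis card.empty zero_neq_numeral)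
        then obtain v where v: "v \<in> T" "v \<noteq> x" by blast
        then have Tv: "T = tri x v" "v \<in> N x" using tri_eq[OF T' v(1)] by auto
        have "tri x b = tri x a" "tri x q = tri x p"
          using tri[OF x a] tri[OF x p(1)] b q by (auto simp: tri_def)
        then show "T \<in> {tri x a, tri x p}" using Tv Nx by auto
      qed
    qed
    moreover have "tri x a \<noteq> tri x p" using xa q p by auto
    ultimately show ?thesis by simp
  qed
  have hinj: "inj_on h V"
  proof (rule inj_onI, rule ccontr)
    fix x y assume xy: "x \<in> V" "y \<in> V" "h x = h y" "x \<noteq> y"
    obtain S T where "h x = {S, T}" "S \<noteq> T" using h2[OF xy(1)] by (auto simp: card_2_iff)
    then have "S \<in> h x" "T \<in> h x" "S \<in> h y" "T \<in> h y" "S \<noteq> T" using xy(3) by auto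
    then show False using tri_eq[of S x y] tri_eq[of T x y] xy(4) by (auto simp: h_def)
  qed
  have meet: "h x \<inter> h y \<noteq> {} \<longleftrightarrow> y \<in> N x" if xy: "x \<in> V" "x \<noteq> y" for x y
  proof
    assume "h x \<inter> h y \<noteq> {}"
    then show "y \<in> N x" using tri_eq[of _ x y] xy by (auto simp: h_def)
  next
    assume "y \<in> N x"
    then have "tri x y \<in> h x \<inter> h y" using xy by (auto simp: h_def triangles_def tri_def)
    then show "h x \<inter> h y \<noteq> {}" by blast
  qed
  define Y where "Y = (triangles, h ` V)"
  have s: "simple_graph Y"
    using h2 by (auto simp: simple_graph_def Y_def h_def)
  have c: "cubic Y"
    unfolding regular_graph_def
  proof
    fix T assume "T \<in> verts Y"
    then have T: "T \<in> triangles" by (simp add: Y_def)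
    have "{E \<in> edges Y. T \<in> E} = h ` T"
      using sub[OF T] T by (auto simp: Y_def h_def)
    moreover have "card (h ` T) = 3" "finite T"
      using sub[OF T] hinj by (metis card_image inj_on_subset, metis card.infinite zero_neq_numeral)
    ultimately show "finite {E \<in> edges Y. T \<in> E} \<and> card {E \<in> edges Y. T \<in> E} = 3" by simp
  qed
  have g: "4 \<le> girth Y"
    unfolding girth_def
  proof (rule Inf_greatest)
    fix m assume "m \<in> {enat n |n. \<exists>C. subgraph C Y \<and> is_cycle C n}"
    then obtain n C where C: "m = enat n" "subgraph C Y" "is_cycle C n" by auto
    \<comment> \<open>Three triangles meeting pairwise in distinct vertices \<open>x\<close>,
      \<open>y\<close>, \<open>z\<close> make these vertices pairwise adjacent. Then
      \<open>z\<close> belongs to the triangle through \<open>x\<close> and \<open>y\<close>, that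
      is to \<open>w 1\<close>, which it must avoid.\<close>
    have "n \<noteq> 3"
    proof
      assume n: "n = 3"
      obtain w where w: "inj_on w {..<n}" "\<And>i. i < n \<Longrightarrow> w i \<in> verts Y"
          "\<And>i. i < n \<Longrightarrow> {w i, w ((i + 1) mod n)} \<in> edges Y"
        using subgraph_cycle[OF C(2,3)] by blast
      have md: "(0 + 1) mod n = 1" "(1 + 1) mod n = 2" "(2 + 1) mod n = 0"
        unfolding n by simp_all
      have "{w 0, w 1} \<in> edges Y" "{w 1, w 2} \<in> edges Y" "{w 2, w 0} \<in> edges Y"
        using w(3)[of 0, unfolded md] w(3)[of 1, unfolded md] w(3)[of 2, unfolded md] n by linarith+
      then obtain x y z where xyz: "x \<in> V" "y \<in> V" "z \<in> V"
          "{w 0, w 1} = h x" "{w 1, w 2} = h y" "{w 2, w 0} = h z"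
        unfolding Y_def by auto
      have dw: "w 0 \<noteq> w 1" "w 1 \<noteq> w 2" "w 0 \<noteq> w 2"
        using inj_on_eq_iff[OF w(1), of 0 1] inj_on_eq_iff[OF w(1), of 1 2]
          inj_on_eq_iff[OF w(1), of 0 2] n by simp_all
      have T: "w 0 \<in> triangles" "w 1 \<in> triangles" "w 2 \<in> triangles"
        using w(2)[of 0] w(2)[of 1] w(2)[of 2] n by (simp_all add: Y_def)
      have "w 0 \<in> h x" "w 1 \<in> h x" "w 2 \<notin> h x" "w 1 \<in> h y" "w 2 \<in> h y" "w 0 \<notin> h y"
          "w 2 \<in> h z" "w 0 \<in> h z" "w 1 \<notin> h z"
        using dw unfolding xyz(4-6)[symmetric] by auto
      then have mem: "x \<in> w 0" "x \<in> w 1" "x \<notin> w 2" "y \<in> w 1" "y \<in> w 2" "y \<notin> w 0"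
          "z \<in> w 2" "z \<in> w 0" "z \<notin> w 1" using T by (auto simp: h_def)
      then have "x \<noteq> y" "x \<noteq> z" "y \<noteq> z" by auto
      then have "w 1 = tri x y" "y \<in> N x" "z \<in> N x" "z \<in> N y"
        using tri_eq[OF T(2) mem(2,4)] tri_eq[OF T(1) mem(1,8)] tri_eq[OF T(3) mem(5,7)] by auto
      then show False using mem(9) by (simp add: tri_def)
    qed
    moreover have "3 \<le> n" using C(3) by (simp add: is_cycle_def)
    ultimately have "4 \<le> n" by linarith
    then show "4 \<le> m" using C(1) by (metis enat_ord_simps(1) numeral_eq_enat)
  qed
  have "graph_iso h gr (line_graph Y)"
    unfolding graph_iso_def
  proof
    show "bij_betw h (verts gr) (verts (line_graph Y))"
      using hinj by (simp add: bij_betw_def line_graph_def Y_def)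
    show "edges (line_graph Y) = (`) h ` edges gr"
    proof (intro set_eqI iffI)
      fix D assume "D \<in> edges (line_graph Y)"
      then obtain x y where xy: "D = {h x, h y}" "x \<in> V" "y \<in> V" "h x \<noteq> h y" "h x \<inter> h y \<noteq> {}"
        by (auto simp: line_graph_def Y_def)
      then have "{x, y} \<in> edges gr" using meet[of x y] by (auto simp: edge_gr)
      then show "D \<in> (`) h ` edges gr" using xy(1) by (intro image_eqI[of _ _ "{x, y}"]) auto
    next
      fix D assume "D \<in> (`) h ` edges gr"
      then obtain x y where xy: "D = {h x, h y}" "x \<in> V" "y \<in> V" "y \<in> N x" "x \<noteq> y"
        by (auto elim!: edges_gr_cases)
      then have "h x \<noteq> h y" "h x \<inter> h y \<noteq> {}" using meet[of x y] hinj by (auto simp: inj_on_def)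
      then show "D \<in> edges (line_graph Y)" using xy by (auto simp: line_graph_def Y_def)
    qed
  qed
  then show ?thesis using cubic_line_graphI[OF s c g] unfolding isomorphic_def by blast
qed

section \<open>Sets of small cut in the line-graph case\<close>

lemma degree_le_average:
  assumes "X \<subseteq> V" "finite X" "d * card X < c X + (k + 1) * card X"
  shows "\<exists>x\<in>X. card (N x \<inter> X) \<le> k"
proof (rule ccontr)
  assume "\<not> ?thesis"
  then have "k + 1 \<le> card (N x \<inter> X)" if "x \<in> X" for x using that by force
  then have "of_nat (card X) * (k + 1) \<le> e X X"
    unfolding e_def by (intro sum_bounded_below) auto
  then show False using c_e[OF assms(2,1)] assms(3) by (simp add: mult.commute)
qed

text \<open>By \<open>c_e\<close> the inner degrees sum to at most \<open>k * card X\<close>, while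
  each is at least \<open>k\<close>.\<close>

lemma degree_eq_average:
  assumes "X \<subseteq> V" "finite X" "\<And>x. x \<in> X \<Longrightarrow> k \<le> card (N x \<inter> X)" "d * card X \<le> c X + k * card X"
    and x: "x \<in> X"
  shows "card (N x \<inter> X) = k"
proof -
  have "of_nat (card (X - {x})) * k \<le> (\<Sum>y\<in>X - {x}. card (N y \<inter> X))"
    using assms(3) by (intro sum_bounded_below) auto
  moreover have "e X X = card (N x \<inter> X) + (\<Sum>y\<in>X - {x}. card (N y \<inter> X))"
    unfolding e_def using x assms(2) by (rule sum.remove[rotated])
  moreover have "k * card X = k + of_nat (card (X - {x})) * k"
    using card_Suc_Diff1[OF assms(2) x] by (metis mult.commute mult_Suc_right of_nat_id)
  moreover have "k \<le> card (N x \<inter> X)" using assms(3) x by blast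
  ultimately show ?thesis using c_e[OF assms(2,1)] assms(4) by linarith
qed

lemma quad_count:
  assumes "X \<subseteq> V" "card X = 4"
  obtains w x y z S where "X = {w, x, y, z}" "distinct [w, x, y, z]" "c X + 2 * S = 4 * d"
    "S = of_bool (x \<in> N w) + of_bool (y \<in> N w) + of_bool (z \<in> N w) +
      of_bool (y \<in> N x) + of_bool (z \<in> N x) + of_bool (z \<in> N y)"
proof -
  have "card X = Suc 3" using assms(2) by simp
  then obtain w Y where wY: "X = insert w Y" "w \<notin> Y" "card Y = 3" using card_eq_SucD by metis
  obtain x y z where "Y = {x, y, z}" "x \<noteq> y" "y \<noteq> z" "x \<noteq> z"
    using wY(3) by (auto simp: card_3_iff)
  then have X: "X = {w, x, y, z}" "distinct [w, x, y, z]" using wY by auto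
  have "{w, x, y, z} \<subseteq> V" using X assms(1) by simp
  from c_quad[OF this X(2)] show thesis using that[OF X _ refl] X(1) by simp
qed

text \<open>A cut of at most 6 means at least five inner edges, and then two triangles share an
  edge.\<close>

lemma line_quad:
  assumes d: "d = 4" and t: "\<And>x y. x \<in> V \<Longrightarrow> y \<in> N x \<Longrightarrow> card (N x \<inter> N y) = 1"
    and X: "X \<subseteq> V" "card X = 4"
  shows "6 < c X"
proof (rule ccontr)
  assume "\<not> 6 < c X"
  have two: False if "u \<in> V" "v \<in> N u" "a \<in> N u" "a \<in> N v" "b \<in> N u" "b \<in> N v" "a \<noteq> b" for u v a b
    using common_unique[OF that(1,3-6)] t[OF that(1,2)] that(7) by simp
  obtain w x y z S where X': "X = {w, x, y, z}" "distinct [w, x, y, z]"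
    "c X + 2 * S = 4 * d"
    "S = of_bool (x \<in> N w) + of_bool (y \<in> N w) + of_bool (z \<in> N w) +
      of_bool (y \<in> N x) + of_bool (z \<in> N x) + of_bool (z \<in> N y)"
    by (rule quad_count[OF X])
  have V: "{w, x, y, z} \<subseteq> V" using X X' by simp
  have s: "x \<in> N w \<longleftrightarrow> w \<in> N x" "y \<in> N w \<longleftrightarrow> w \<in> N y" "z \<in> N w \<longleftrightarrow> w \<in> N z"
    "y \<in> N x \<longleftrightarrow> x \<in> N y" "z \<in> N x \<longleftrightarrow> x \<in> N z" "z \<in> N y \<longleftrightarrow> y \<in> N z"
    using V N_iff by auto
  have "5 \<le> S" using X'(3) \<open>\<not> 6 < c X\<close> d by linarith
  then have "(x \<in> N w \<and> y \<in> N w \<and> z \<in> N w \<and> y \<in> N x \<and> z \<in> N x) \<or>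
    (x \<in> N w \<and> y \<in> N w \<and> z \<in> N w \<and> y \<in> N x \<and> z \<in> N y) \<or>
    (x \<in> N w \<and> y \<in> N w \<and> z \<in> N w \<and> z \<in> N x \<and> z \<in> N y) \<or>
    (x \<in> N w \<and> y \<in> N w \<and> y \<in> N x \<and> z \<in> N x \<and> z \<in> N y) \<or>
    (x \<in> N w \<and> z \<in> N w \<and> y \<in> N x \<and> z \<in> N x \<and> z \<in> N y) \<or>
    (y \<in> N w \<and> z \<in> N w \<and> y \<in> N x \<and> z \<in> N x \<and> z \<in> N y)"
    unfolding X'(4)
    by (cases "x \<in> N w"; cases "y \<in> N w"; cases "z \<in> N w"; cases "y \<in> N x";
        cases "z \<in> N x"; cases "z \<in> N y"; simp)
  then show False
    using two[of w x y z] two[of w y x z] two[of w z x y] two[of x y w z] two[of x z w y]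
      two[of y z w x] V X'(2) s by (elim disjE conjE) auto
qed

text \<open>Sizes 4 and 5 are excluded directly, so the two crossing sets have six vertices and
  share three. All uncrossing inequalities are then equalities. A vertex \<open>x\<close> of the
  common triangle has exactly one further neighbour \<open>b\<close> in \<open>A - B\<close> and one
  in \<open>B - A\<close>. The triangle on the edge \<open>x b\<close> must use a vertex of the
  common triangle, which puts an edge at \<open>x\<close> into two triangles.\<close>

lemma no_large_line:
  assumes d: "d = 4" and t: "\<And>x y. x \<in> V \<Longrightarrow> y \<in> N x \<Longrightarrow> card (N x \<inter> N y) = 1"
    and lower: "\<And>X. sep 3 X \<Longrightarrow> 6 \<le> c X"
    and X: "small X" "4 \<le> card X"
  shows "6 < c X"
proof (rule ccontr)
  assume "\<not> 6 < c X"
  then have cX: "c X \<le> 6" by simp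
  have two: False if "u \<in> V" "v \<in> N u" "a \<in> N u" "a \<in> N v" "b \<in> N u" "b \<in> N v" "a \<noteq> b" for u v a b
    using common_unique[OF that(1,3-6)] t[OF that(1,2)] that(7) by simp
  have no4: "6 < c X" if "X \<subseteq> V" "card X = 4" for X
    using line_quad[OF d t that] .
  have no5: "6 < c X" if X: "small X" "card X = 5" for X
  proof (rule ccontr)
    assume c: "\<not> 6 < c X"
    have f: "X \<subseteq> V" "finite X" using X by (auto simp: small_def)
    have "6 \<le> c X" using lower[OF small_sep[OF X(1)]] X(2) by simp
    \<comment> \<open>The inner degrees sum to at most \<open>4 * 5 - 6 = 14\<close>, so some vertex
      has at most two inner neighbours; deleting it keeps the cut at most 6.\<close>
    then have "d * card X < c X + (2 + 1) * card X" using X(2) d by simp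
    then obtain x where x: "x \<in> X" "card (N x \<inter> X) \<le> 2" using degree_le_average[OF f] by blast
    have "c (X - {x}) \<le> 6" using c_remove[OF f(2,1) x(1)] x(2) c d by linarith
    moreover have "6 < c (X - {x})"
    proof (rule no4)
      show "X - {x} \<subseteq> V" using f(1) by blast
      show "card (X - {x}) = 4" using card_Suc_Diff1[OF f(2) x(1)] X(2) by simp
    qed
    ultimately show False by linarith
  qed
  obtain A B where A: "small A" "small B" "card A = card B" "c A = 6" "c B = 6" "4 \<le> card A"
    "card (A - B) < 4" "card (A \<inter> B) < 4" "card (A - B) = card (B - A)"
    by (rule uncrossing[of 3 6 4 X]) (use lower X cX d in auto)
  have f: "A \<subseteq> V" "finite A" "B \<subseteq> V" "finite B" using A by (auto simp: small_def)
  have splitA: "card A = card (A - B) + card (A \<inter> B)"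
    using card_Diff_Int[OF f(2)] .
  have "card A \<noteq> 4" "card A \<noteq> 5" using no4[OF f(1)] no5[OF A(1)] A(4) by auto
  then have A6: "card A = 6" "card (A \<inter> B) = 3" "card (A - B) = 3" "card (B - A) = 3" "card B = 6"
    using A splitA by auto
  have deg: "card (N x \<inter> Y) = 3" if Y: "small Y" "card Y = 6" "c Y = 6" and x: "x \<in> Y" for x Y
  proof -
    have fY: "Y \<subseteq> V" "finite Y" using Y by (auto simp: small_def)
    have "3 \<le> card (N y \<inter> Y)" if y: "y \<in> Y" for y
    proof (rule ccontr)
      assume "\<not> ?thesis"
      then have "c (Y - {y}) \<le> 6" using c_remove[OF fY(2,1) y] Y(3) d by linarith
      moreover have "small (Y - {y})" "card (Y - {y}) = 5"
        using small_subset[OF Y(1)] fY Y(2) y by auto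
      ultimately show False using no5 by fastforce
    qed
    then show ?thesis using Y d by (intro degree_eq_average[OF fY _ _ x]) auto
  qed
  define M where "M = A \<inter> B"
  have sm: "small M" "small (A - B)" "small (B - A)"
    using small_subset A by (auto simp: M_def)
  have c3: "6 \<le> c M" "6 \<le> c (A - B)" "6 \<le> c (B - A)"
    using lower small_sep sm A6 M_def by auto
  have "card (A \<union> B) = 9" using card_Un_Int[OF f(2,4)] A6 by simp
  then have "sep 3 (A \<union> B)" using A(1) A6(1) f by (auto simp: sep_def small_def)
  then have "6 \<le> c (A \<union> B)" by (rule lower)
  then have eq: "c M = 6" "e (A - B) (B - A) = 0" "e M (V - (A \<union> B)) = 0"
    using uncross_union[OF f(1,3,2,4)] c3 A(4,5) unfolding M_def by linarith+
  obtain x y z where M: "M = {x, y, z}" "y \<in> N x" "z \<in> N x" "z \<in> N y" "distinct [x, y, z]"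
    by (rule triple_cases[of M]) (use sm A6(2) eq(1) d in \<open>auto simp: small_def M_def\<close>)
  have x: "x \<in> A" "x \<in> B" "x \<in> V" "x \<in> M" using M(1) f by (auto simp: M_def)
  have Nx: "N x \<inter> A = (N x \<inter> M) \<union> (N x \<inter> (A - B))" "N x \<inter> B = (N x \<inter> M) \<union> (N x \<inter> (B - A))"
    by (auto simp: M_def)
  have NM: "N x \<inter> M = {y, z}" using M N_irrefl[OF x(3)] by auto
  have "card (N x \<inter> A) = 2 + card (N x \<inter> (A - B))"
    unfolding Nx NM using M(5) f NM by (subst card_Un_disjoint) (auto simp: M_def)
  then have "card (N x \<inter> (A - B)) = 1" using deg[OF A(1) A6(1) A(4) x(1)] by simp
  then obtain b where b: "N x \<inter> (A - B) = {b}" by (rule card_1_singletonE)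
  have "card (N x \<inter> B) = 2 + card (N x \<inter> (B - A))"
    unfolding Nx NM using M(5) f NM by (subst card_Un_disjoint) (auto simp: M_def)
  then have "card (N x \<inter> (B - A)) = 1" using deg[OF A(2) A6(5) A(5) x(2)] by simp
  then obtain b' where b': "N x \<inter> (B - A) = {b'}" by (rule card_1_singletonE)
  have "N x \<inter> (V - (A \<union> B)) = {}" using e_zeroD[OF eq(3) _ _ x(4)] M(1) f by (auto simp: M_def)
  then have "N x \<subseteq> (N x \<inter> M) \<union> (N x \<inter> (A - B)) \<union> (N x \<inter> (B - A))"
    using N_sub[OF x(3)] unfolding M_def by blast
  then have Nx4: "N x \<subseteq> {y, z, b, b'}" unfolding NM b b' by auto
  have bx: "b \<in> N x" "b \<in> A - B" "b' \<in> B - A" using b b' by auto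
  obtain u where u: "N x \<inter> N b = {u}" using t[OF x(3) bx(1)] by (rule card_1_singletonE)
  have bV: "b \<in> V" using bx f by blast
  have "N b \<inter> (B - A) = {}" using e_zeroD[OF eq(2) _ _ bx(2)] f by auto
  then have "u \<noteq> b'" using u bx(3) by blast
  moreover have "u \<noteq> b" using u N_irrefl[OF bV] by blast
  ultimately have "u = y \<or> u = z" using u Nx4 by blast
  moreover have "y \<in> M" "z \<in> M" using M by auto
  then have "b \<noteq> y" "b \<noteq> z" using bx(2) by (auto simp: M_def)
  moreover have "b \<in> N u" using u N_sym[OF bV] by blast
  moreover have "y \<in> N z" using M(1,4) f N_sym by (auto simp: M_def)
  ultimately show False using two[of x y z b] two[of x z y b] M bx(1) x(3) by metis
qed

section \<open>Smallest sets with at least three vertices\<close>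

text \<open>Here \<open>k\<close> is the least cut with three vertices on either side, and
  \<open>3 \<le> d\<close> gives \<open>k < 3 * d\<close>. Both \<open>A - B\<close> and
  \<open>A \<inter> B\<close> have at most two vertices.\<close>

lemma small_minimal:
  assumes "sep 3 X" "c X < 2 * d" "3 \<le> d"
  obtains k A where "\<And>Y. sep 3 Y \<Longrightarrow> k \<le> c Y" "small A" "card A = 3 \<or> card A = 4" "c A = k" "k < 2 * d"
proof -
  obtain k Z where kZ: "\<And>Y. sep 3 Y \<Longrightarrow> k \<le> c Y" "small Z" "3 \<le> card Z" "c Z = k"
    using min_cut[OF assms(1)] by metis
  have k: "k < 2 * d" using kZ(1)[OF assms(1)] assms(2) by linarith
  obtain A B where A: "small A" "small B" "c A = k" "3 \<le> card A" "card (A - B) < 3"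
    "card (A \<inter> B) < 3"
    by (rule uncrossing[of 3 k 3 Z]) (use kZ k assms(3) in auto)
  have "card A = card (A - B) + card (A \<inter> B)"
    using A(1) by (metis card_Diff_Int small_def)
  then have "card A = 3 \<or> card A = 4" using A by linarith
  then show thesis using that[OF kZ(1) A(1) _ A(3) k] by blast
qed

text \<open>At least five of the six pairs are edges, and one missing pair cannot spoil all three
  triangles through \<open>w\<close>.\<close>

lemma quad_triangle:
  assumes X: "X \<subseteq> V" "card X = 4" "c X < 2 * d" and d: "4 \<le> d"
  shows "\<exists>x\<in>V. \<exists>y\<in>N x. N x \<inter> N y \<noteq> {}"
proof -
  obtain w x y z S where X': "X = {w, x, y, z}" "distinct [w, x, y, z]"
    "c X + 2 * S = 4 * d"
    "S = of_bool (x \<in> N w) + of_bool (y \<in> N w) + of_bool (z \<in> N w) +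
      of_bool (y \<in> N x) + of_bool (z \<in> N x) + of_bool (z \<in> N y)"
    by (rule quad_count[OF X(1,2)])
  have S5: "5 \<le> S" using X'(3) X(3) d by linarith
  have wV: "w \<in> V" using X' X by blast
  have "y \<in> N x \<and> x \<in> N w \<and> y \<in> N w \<or> z \<in> N x \<and> x \<in> N w \<and> z \<in> N w \<or>
      z \<in> N y \<and> y \<in> N w \<and> z \<in> N w"
    using S5 unfolding X'(4)
    by (cases "x \<in> N w"; cases "y \<in> N w"; cases "z \<in> N w"; cases "y \<in> N x"; cases "z \<in> N x";
        cases "z \<in> N y"; simp)
  then show ?thesis using wV by blast
qed

text \<open>A least separating set is a triangle with cut 9, since four vertices would have to be
  pairwise adjacent. Parity turns the result of the next uncrossing into five vertices, one of
  which, \<open>v\<close>, is joined to the other four. These are all but one vertex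
  \<open>u\<close> of the 5-cycle around \<open>v\<close>. A neighbour \<open>z\<close> of
  \<open>u\<close> on that cycle has at most two neighbours in the set, and deleting it lowers the
  cut to at most 8.\<close>

lemma no_large_icosahedron:
  assumes d: "d = 5" and t: "\<And>x y. x \<in> V \<Longrightarrow> y \<in> N x \<Longrightarrow> card (N x \<inter> N y) = 2"
    and X: "small X" "4 \<le> card X"
  shows "10 \<le> c X"
proof (rule ccontr)
  assume "\<not> 10 \<le> c X"
  then have cX: "c X < 2 * d" "c X \<le> 9" using d by auto
  have sepX: "sep 3 X" using X by (intro small_sep) auto
  \<comment> \<open>A triangle in the 2-regular neighbourhood of \<open>v\<close> would leave two
    vertices with only each other as possible neighbours there.\<close>
  have link: "\<not> {x, y, z} \<subseteq> N v" if "v \<in> V" "distinct [x, y, z]" "y \<in> N x" "z \<in> N x" "z \<in> N y"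
    for v x y z
  proof
    assume sub: "{x, y, z} \<subseteq> N v"
    have V: "x \<in> V" "y \<in> V" "z \<in> V" using sub N_sub[OF that(1)] by blast+
    have sy: "x \<in> N y" "x \<in> N z" "y \<in> N z" using that N_sym V by blast+
    have full: "N v \<inter> N x = {y, z}" "N v \<inter> N y = {x, z}" "N v \<inter> N z = {x, y}"
    proof -
      have *: "N v \<inter> N a = {b, b'}" if "a \<in> N v" "b \<in> N v" "b' \<in> N v" "b \<in> N a" "b' \<in> N a" "b \<noteq> b'"
        for a b b'
        using t[OF \<open>v \<in> V\<close> that(1)] that N_fin[OF \<open>v \<in> V\<close>] by (intro card_subset_eq[symmetric]) auto
      show "N v \<inter> N x = {y, z}" "N v \<inter> N y = {x, z}" "N v \<inter> N z = {x, y}"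
        by (rule *; use sub that sy in auto)+
    qed
    have "card (N v - {x, y, z}) = 2"
      using sub that(2) N_card[OF that(1)] d N_fin[OF that(1)] by (subst card_Diff_subset) auto
    then obtain u u' where u: "N v - {x, y, z} = {u, u'}" by (auto simp: card_2_iff)
    then have uN: "u \<in> N v" "u \<notin> {x, y, z}" by blast+
    have uV: "u \<in> V" using uN N_sub[OF that(1)] by blast
    have "N v \<inter> N u \<subseteq> {u'}"
    proof
      fix a assume a: "a \<in> N v \<inter> N u"
      then have "u \<in> N v \<inter> N a" using uN N_sym[OF uV] by blast
      then have "a \<notin> {x, y, z}" using full uN(2) by auto
      moreover have "a \<noteq> u" using a N_irrefl[OF uV] by blast
      ultimately show "a \<in> {u'}" using u a by blast
    qed
    then have "card (N v \<inter> N u) \<le> 1" using card_mono[of "{u'}" "N v \<inter> N u"] by simp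
    then show False using t[OF that(1) uN(1)] by simp
  qed
  obtain k A where k: "\<And>Y. sep 3 Y \<Longrightarrow> k \<le> c Y" "small A" "card A = 3 \<or> card A = 4" "c A = k"
    "k < 2 * d"
  proof -
    have "3 \<le> d" using d by simp
    then show thesis using small_minimal[OF sepX cX(1)] that by metis
  qed
  have A: "A \<subseteq> V" using k(2) by (simp add: small_def)
  have "card A \<noteq> 4"
  proof
    assume A4: "card A = 4"
    obtain w x y z S where X': "A = {w, x, y, z}" "distinct [w, x, y, z]"
      "c A + 2 * S = 4 * d"
      "S = of_bool (x \<in> N w) + of_bool (y \<in> N w) + of_bool (z \<in> N w) +
        of_bool (y \<in> N x) + of_bool (z \<in> N x) + of_bool (z \<in> N y)"
      by (rule quad_count[OF A A4])
    have S6: "6 \<le> S" using X'(3) k d by linarith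
    have "x \<in> N w \<and> y \<in> N w \<and> z \<in> N w \<and> y \<in> N x \<and> z \<in> N x \<and> z \<in> N y"
      using S6 unfolding X'(4)
      by (cases "x \<in> N w"; cases "y \<in> N w"; cases "z \<in> N w"; cases "y \<in> N x"; cases "z \<in> N x";
          cases "z \<in> N y"; simp)
    then show False using link[of w x y z] X' A by auto
  qed
  then have "card A = 3" using k(3) by blast
  have k9: "k = 9"
    by (rule triple_cases[OF A \<open>card A = 3\<close>]) (use k(4,5) d in auto)
  have p: "3 \<le> (4 :: nat)" "k < 4 * d" "c X \<le> k" using k9 d cX(2) by auto
  obtain F B where F: "small F" "c F = k" "4 \<le> card F" "card (F - B) < 4" "card (F \<inter> B) < 4"
    by (rule uncrossing[OF k(1) p(1) X p(3,2)])
  have f: "F \<subseteq> V" "finite F" using F by (auto simp: small_def)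
  have "card F = card (F - B) + card (F \<inter> B)"
    using card_Diff_Int[OF f(2)] .
  then have "card F = 4 \<or> card F = 5 \<or> card F = 6" using F(3-5) by linarith
  moreover have "odd (card F)" using c_parity[OF f(2,1)] F(2) k9 d by simp
  ultimately have F5: "card F = 5" by (elim disjE) simp_all
  have "e F F = 16" using c_e[OF f(2,1)] F(2) k9 F5 d by simp
  \<comment> \<open>The five inner degrees sum to 16, more than \<open>5 * 3\<close>.\<close>
  have "\<exists>v\<in>F. 4 \<le> card (N v \<inter> F)"
  proof (rule ccontr)
    assume "\<not> ?thesis"
    then have "card (N v \<inter> F) \<le> 3" if "v \<in> F" for v using that by force
    then have "e F F \<le> of_nat (card F) * 3" unfolding e_def by (intro sum_bounded_above) auto
    then show False using \<open>e F F = 16\<close> F5 by simp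
  qed
  then obtain v where v: "v \<in> F" "4 \<le> card (N v \<inter> F)" by blast
  have vV: "v \<in> V" using v f by blast
  define L where "L = F - {v}"
  have L4: "card L = 4" unfolding L_def using card_Suc_Diff1[OF f(2) v(1)] F5 by simp
  have "N v \<inter> F \<subseteq> L" using N_irrefl[OF vV] by (auto simp: L_def)
  then have "N v \<inter> F = L" using v(2) L4 f by (intro card_seteq) (auto simp: L_def)
  then have LN: "L \<subseteq> N v" by blast
  have "card (N v - L) = 1"
    using LN N_card[OF vV] N_fin[OF vV] d L4 by (subst card_Diff_subset) (auto intro: finite_subset)
  then obtain u where u: "N v - L = {u}" by (rule card_1_singletonE)
  then have uN: "u \<in> N v" "u \<notin> L" by blast+
  have uV: "u \<in> V" using uN N_sub[OF vV] by blast
  have "N v \<inter> N u \<noteq> {}" using t[OF vV uN(1)] by auto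
  then obtain z where z: "z \<in> N v" "z \<in> N u" by blast
  have "z \<noteq> u" using z(2) N_irrefl[OF uV] by metis
  then have zL: "z \<in> L" using z(1) u by auto
  have zF: "z \<in> F" "z \<in> V" using zL f by (auto simp: L_def)
  have "N z \<inter> F \<subseteq> insert v ((N v \<inter> N z) - {u})"
    using LN uN(2) unfolding L_def by blast
  moreover have "u \<in> N v \<inter> N z" using uN z N_sym[OF uV] by blast
  then have "card ((N v \<inter> N z) - {u}) = 1" using t[OF vV z(1)] by simp
  then have "card (insert v ((N v \<inter> N z) - {u})) \<le> 2"
    using N_fin[OF vV] by (simp add: card_insert_if)
  ultimately have "card (N z \<inter> F) \<le> 2"
    using card_mono[of "insert v ((N v \<inter> N z) - {u})" "N z \<inter> F"] N_fin[OF vV] by simp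
  then have "c (F - {z}) \<le> 8" using c_remove[OF f(2,1) zF(1)] F(2) k9 d by linarith
  moreover have "sep 3 (F - {z})"
    using small_subset[OF F(1), of "F - {z}"] card_Suc_Diff1[OF f(2) zF(1)] F5
    by (intro small_sep) auto
  ultimately show False using k(1) k9 by fastforce
qed

lemma complete_graph_6:
  assumes "finite V" "card V = 6" and all: "\<And>x y. x \<in> V \<Longrightarrow> y \<in> V \<Longrightarrow> x \<noteq> y \<Longrightarrow> y \<in> N x"
  shows "isomorphic gr (complete_graph 6)"
proof -
  obtain xs where xs: "set xs = V" "distinct xs" using finite_distinct_list[OF assms(1)] by blast
  have len: "length xs = 6" using distinct_card[OF xs(2)] xs(1) assms(2) by simp
  have "isomorphic (induced gr (set xs)) (complete_graph 6)"
  proof (rule induced_iso)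
    show "simple_graph (complete_graph 6)" by (auto simp: simple_graph_def complete_graph_def)
    show "verts (complete_graph 6) = {..<length xs}" by (simp add: complete_graph_def len)
    fix i j assume ij: "i < length xs" "j < length xs"
    then have "xs ! i \<in> V" "xs ! j \<in> V" using xs(1) by auto
    then have "xs ! j \<in> N (xs ! i) \<longleftrightarrow> i \<noteq> j"
      using all N_irrefl nth_eq_iff_index_eq[OF xs(2) ij] by metis
    moreover have "{i, j} \<in> edges (complete_graph 6) \<longleftrightarrow> i \<noteq> j"
      using ij len by (auto simp: complete_graph_def card_insert_if)
    ultimately show "{i, j} \<in> edges (complete_graph 6) \<longleftrightarrow> xs ! j \<in> N (xs ! i)" by blast
  qed (use xs in auto)
  then show ?thesis using xs(1) induced_V by simp
qed

end

section \<open>Triangle-free cubic graphs\<close>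

locale cubic_egraph = egraph +
  assumes d3: "d = 3"
    and no_tri: "x \<in> V \<Longrightarrow> y \<in> N x \<Longrightarrow> N x \<inter> N y = {}"
begin

lemma no_triD: "x \<in> V \<Longrightarrow> y \<in> N x \<Longrightarrow> z \<in> N x \<Longrightarrow> z \<in> N y \<Longrightarrow> False"
  using no_tri by blast

lemma N3: "x \<in> V \<Longrightarrow> card (N x) = 3"
  using N_card d3 by simp

lemma N_eq3: "x \<in> V \<Longrightarrow> {a, b, c'} \<subseteq> N x \<Longrightarrow> distinct [a, b, c'] \<Longrightarrow> N x = {a, b, c'}"
  by (rule N_eqI) (auto simp: d3)

lemma N_third:
  assumes "x \<in> V" "a \<in> N x" "b \<in> N x" "a \<noteq> b"
  obtains z where "N x = {a, b, z}" "z \<noteq> a" "z \<noteq> b"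
proof -
  have "card {a, b} < d" using d3 assms(4) by simp
  then obtain z where z: "z \<in> N x" "z \<notin> {a, b}" using N_obtain[OF assms(1), of "{a, b}"] by blast
  then have "N x = {a, b, z}" using assms by (intro N_eq3) auto
  then show thesis using that z(2) by blast
qed

text \<open>Three numbers with equal pairwise sums are equal: this transfers constancy from edges to 2-paths.\<close>

lemma path_count:
  fixes F :: "'a \<Rightarrow> 'a \<Rightarrow> 'a \<Rightarrow> nat"
  assumes sym: "\<And>v a b. v \<in> V \<Longrightarrow> a \<in> N v \<Longrightarrow> b \<in> N v \<Longrightarrow> a \<noteq> b \<Longrightarrow> F v a b = F v b a"
    and q: "\<And>v a. v \<in> V \<Longrightarrow> a \<in> N v \<Longrightarrow> (\<Sum>b\<in>N v - {a}. F v a b) = q"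
    and v: "v \<in> V" "a \<in> N v" "b \<in> N v" "a \<noteq> b"
  shows "2 * F v a b = q"
proof -
  obtain z where z: "N v = {a, b, z}" "z \<noteq> a" "z \<noteq> b" using N_third[OF v] by blast
  have "N v - {a} = {b, z}" "N v - {b} = {a, z}" "N v - {z} = {a, b}" using z v(4) by auto
  then have "F v a b + F v a z = q" "F v b a + F v b z = q" "F v z a + F v z b = q"
    using q[OF v(1), of a] q[OF v(1), of b] q[OF v(1), of z] z v(4) by auto
  moreover have "F v b a = F v a b" "F v z a = F v a z" "F v z b = F v b z"
    using sym[OF v(1)] z v(4) by auto
  ultimately show ?thesis by linarith
qed

text \<open>\<open>g x y\<close> counts the 4-cycles through the edge \<open>x y\<close>, and
  \<open>F v a b\<close> those through the 2-path \<open>a v b\<close>; the sum of the latter over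
  \<open>b\<close> is the former, so \<open>path_count\<close> applies. The vertex \<open>v\<close>
  itself accounts for the \<open>+ 1\<close>.\<close>

lemma quads_const:
  obtains m where "m \<le> 2"
    "\<And>v a b. v \<in> V \<Longrightarrow> a \<in> N v \<Longrightarrow> b \<in> N v \<Longrightarrow> a \<noteq> b \<Longrightarrow> card (N a \<inter> N b) = m + 1"
proof -
  define g where "g x y = e (N x - {y}) (N y - {x})" for x y
  have g_const: "g x y = g x' y'" if "x \<in> V" "y \<in> N x" "x' \<in> V" "y' \<in> N x'" for x y x' y'
  proof (rule edge_count[OF that])
    fix x y assume xy: "x \<in> V" "y \<in> N x"
    then have "N x \<subseteq> V" "N y \<subseteq> V" "finite (N x)" "finite (N y)" using N_sub N_V N_fin by metis+
    then show "g x y = g y x" unfolding g_def by (intro e_sym) auto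
  next
    fix f x y assume f: "aut f" and xy: "x \<in> V" "y \<in> N x"
    have V: "y \<in> V" "N x \<subseteq> V" "N y \<subseteq> V" using xy N_sub by blast+
    have "N (f x) - {f y} = f ` (N x - {y})" "N (f y) - {f x} = f ` (N y - {x})"
      using f V xy aut_inj[OF f] by (auto simp: aut_def inj_on_def)
    then show "g (f x) (f y) = g x y" unfolding g_def
      using aut_e[OF f] V by (metis Diff_subset dual_order.trans)
  qed
  obtain x y where x: "x \<in> V" "y \<in> N x"
    using V_ne N3 by (metis all_not_in_conv card.empty zero_neq_numeral)
  define F where "F v a b = card (N b \<inter> (N a - {v}))" for v a b
  have F: "2 * F v a b = g x y" if v: "v \<in> V" "a \<in> N v" "b \<in> N v" "a \<noteq> b" for v a b
  proof (rule path_count[OF _ _ v])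
    fix v a b assume v: "v \<in> V" "a \<in> N v" "b \<in> N v"
    have "N b \<inter> (N a - {v}) = N a \<inter> (N b - {v})" by blast
    then show "F v a b = F v b a" by (simp add: F_def)
  next
    fix v a assume v: "v \<in> V" "a \<in> N v"
    have "(\<Sum>b\<in>N v - {a}. F v a b) = e (N v - {a}) (N a - {v})" by (simp add: F_def e_def)
    also have "\<dots> = g x y" using g_const[OF v x] by (simp add: g_def)
    finally show "(\<Sum>b\<in>N v - {a}. F v a b) = g x y" .
  qed
  define m where "m = g x y div 2"
  have cN: "card (N a \<inter> N b) = m + 1" if v: "v \<in> V" "a \<in> N v" "b \<in> N v" "a \<noteq> b" for v a b
  proof -
    have "v \<in> N a" "v \<in> N b" "a \<in> V" using v N_sym N_V by blast+
    then have "N a \<inter> N b = insert v (N b \<inter> (N a - {v}))" "finite (N b \<inter> (N a - {v}))"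
      using N_fin by auto
    then have "card (N a \<inter> N b) = F v a b + 1" by (simp add: F_def)
    then show ?thesis using F[OF v] by (simp add: m_def)
  qed
  obtain b where b: "b \<in> N x" "b \<noteq> y"
    using N_obtain[OF x(1), of "{y}"] d3 by auto
  have "card (N y \<inter> N b) \<le> card (N y)" using N_fin N_V x by (intro card_mono) blast+
  then have "m \<le> 2" using cN[OF x b(1)] b(2) N3[of y] N_V x by fastforce
  then show thesis using that cN by blast
qed

text \<open>Vertices with a common neighbour have the same neighbourhood, so the neighbourhoods of
  the two ends of an edge together are closed under neighbours. This is the case of K_{3,3}.\<close>

lemma few_vertices:
  assumes m: "\<And>v a b. v \<in> V \<Longrightarrow> a \<in> N v \<Longrightarrow> b \<in> N v \<Longrightarrow> a \<noteq> b \<Longrightarrow> card (N a \<inter> N b) = 3"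
  shows "finite V" "card V \<le> 6"
proof -
  have eq: "N a = N b" if "v \<in> V" "a \<in> N v" "b \<in> N v" for v a b
  proof (cases "a = b")
    case False
    have V: "a \<in> V" "b \<in> V" using that N_V by blast+
    have "N a \<inter> N b = N a"
      by (rule card_subset_eq) (simp_all add: N_fin V N3 m[OF that False])
    moreover have "N a \<inter> N b = N b"
      by (rule card_subset_eq) (simp_all add: N_fin V N3 m[OF that False])
    ultimately show ?thesis by blast
  qed simp
  obtain v a where v: "v \<in> V" "a \<in> N v"
    using V_ne N3 by (metis all_not_in_conv card.empty zero_neq_numeral)
  have a: "a \<in> V" "v \<in> N a" using v N_V N_sym by blast+
  have "N v \<union> N a = V"
  proof (rule conn)
    show "N v \<union> N a \<subseteq> V" "N v \<union> N a \<noteq> {}" using N_sub v a by blast+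
    fix x assume "x \<in> N v \<union> N a"
    then show "N x \<subseteq> N v \<union> N a" using eq[OF v(1) _ v(2), of x] eq[OF a(1) _ a(2), of x] by auto
  qed
  then show "finite V" "card V \<le> 6"
    using N_fin[OF v(1)] N_fin[OF a(1)] card_Un_le[of "N v" "N a"] N3[OF v(1)] N3[OF a(1)] by auto
qed

text \<open>Besides \<open>v\<close>, the pairs of neighbours of \<open>v\<close> have the common
  neighbours \<open>p\<close>, \<open>q\<close> and \<open>r\<close>. The third neighbour
  \<open>w\<close> of \<open>p\<close> is also adjacent to \<open>q\<close> and \<open>r\<close>, as
  these pairs need a second common neighbour too.\<close>

lemma cube_graph:
  assumes m: "\<And>v a b. v \<in> V \<Longrightarrow> a \<in> N v \<Longrightarrow> b \<in> N v \<Longrightarrow> a \<noteq> b \<Longrightarrow> card (N a \<inter> N b) = 2"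
  shows "finite V" "card V = 8" "isomorphic gr (label_graph cube_table)"
proof -
  obtain v where v: "v \<in> V" using V_ne by blast
  obtain a b c' where abc: "N v = {a, b, c'}" "a \<noteq> b" "b \<noteq> c'" "a \<noteq> c'"
    using N3[OF v] by (auto simp: card_3_iff)
  have V: "a \<in> V" "b \<in> V" "c' \<in> V" and vN: "v \<in> N a" "v \<in> N b" "v \<in> N c'"
    using N_sub[OF v] N_sym[OF v] abc by auto
  have opp: "\<exists>p. N x \<inter> N y = {u, p} \<and> p \<noteq> u" if "u \<in> V" "x \<in> N u" "y \<in> N u" "x \<noteq> y" for u x y
  proof -
    have "u \<in> N x \<inter> N y" using that N_sym by blast
    then show ?thesis using m[OF that] by (metis card_2_iff doubleton_eq_iff insertE singletonD)
  qed
  obtain p where p: "N a \<inter> N b = {v, p}" "p \<noteq> v" using opp[OF v, of a b] abc by auto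
  obtain q where q: "N a \<inter> N c' = {v, q}" "q \<noteq> v" using opp[OF v, of a c'] abc by auto
  obtain r where r: "N b \<inter> N c' = {v, r}" "r \<noteq> v" using opp[OF v, of b c'] abc by auto
  have mem: "p \<in> N a" "p \<in> N b" "q \<in> N a" "q \<in> N c'" "r \<in> N b" "r \<in> N c'" using p q r by blast+
  \<comment> \<open>Such an \<open>x\<close> would have the neighbourhood of \<open>v\<close>, hence
    three common neighbours with it, although both are neighbours of \<open>a\<close>. It follows
    that \<open>p\<close>, \<open>q\<close>, \<open>r\<close> are distinct.\<close>
  have three: False if "x \<in> N a" "x \<in> N b" "x \<in> N c'" "x \<noteq> v" for x
  proof -
    have "x \<in> V" "a \<in> N x" "b \<in> N x" "c' \<in> N x" using that N_V[OF V(1)] N_sym V by blast+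
    then have "N x = N v"
      using abc
      by (metis N_eq3 distinct_length_2_or_more distinct_singleton empty_subsetI insert_subset)
    moreover have "card (N x \<inter> N v) = 2" using m[OF V(1) that(1) vN(1)] that(4) by simp
    ultimately show False using N3[OF v] by simp
  qed
  have pqr: "p \<noteq> q" "p \<noteq> r" "q \<noteq> r" using three mem p(2) q(2) r(2) by blast+
  have Na: "N a = {v, p, q}" and Nb: "N b = {v, p, r}" and Nc: "N c' = {v, q, r}"
    using N_eq3[OF V(1)] N_eq3[OF V(2)] N_eq3[OF V(3)] vN mem pqr p(2) q(2) r(2) by auto
  have pV: "p \<in> V" "q \<in> V" "r \<in> V" using mem N_V V by blast+
  have sy: "a \<in> N p" "b \<in> N p" "a \<in> N q" "c' \<in> N q" "b \<in> N r" "c' \<in> N r" using mem N_sym V by blast+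
  obtain w where w: "N p = {a, b, w}" "w \<noteq> a" "w \<noteq> b"
    using N_third[OF pV(1) sy(1,2) abc(2)] by blast
  have outer: "p \<notin> N v" "q \<notin> N v" "r \<notin> N v"
    using no_triD[OF v] abc mem by blast+
  have no: "p \<notin> N q" "p \<notin> N r" "q \<notin> N r" "p \<notin> N c'" "q \<notin> N b" "r \<notin> N a"
    using no_triD[OF V(1), of q p] no_triD[OF V(2), of r p] no_triD[OF V(3), of r q] mem Na Nb Nc
      pqr p(2) q(2) r(2)
    by auto
  have wq: "w \<in> N q"
  proof -
    have "N p \<inter> N q \<noteq> {a}" using m[OF V(1) mem(1,3) pqr(1)] by auto
    then obtain z where "z \<in> N p" "z \<in> N q" "z \<noteq> a" using sy by blast
    moreover have "b \<notin> N q" using no(5) N_sym[OF pV(2)] by blast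
    ultimately show ?thesis using w(1) by blast
  qed
  have wr: "w \<in> N r"
  proof -
    have "N p \<inter> N r \<noteq> {b}" using m[OF V(2) mem(2,5) pqr(2)] by auto
    then obtain z where "z \<in> N p" "z \<in> N r" "z \<noteq> b" using sy by blast
    moreover have "a \<notin> N r" using no(6) N_sym[OF pV(3)] by blast
    ultimately show ?thesis using w(1) by auto
  qed
  have wp: "w \<in> N p" using w by blast
  have wV: "w \<in> V" using wp N_V[OF pV(1)] by blast
  have Nw: "p \<in> N w" "q \<in> N w" "r \<in> N w" using wp wq wr N_sym pV by blast+
  have wv: "w \<noteq> v" using Nw(1) outer(1) by blast
  have wc: "w \<noteq> c'" using Nw(1) no(4) by blast
  have wpqr: "w \<noteq> p" "w \<noteq> q" "w \<noteq> r" using wp wq wr N_irrefl pV by blast+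
  have abcp: "a \<noteq> p" "a \<noteq> q" "a \<noteq> r" "b \<noteq> p" "b \<noteq> q" "b \<noteq> r" "c' \<noteq> p" "c' \<noteq> q" "c' \<noteq> r"
    using outer abc(1) by auto
  have vabc: "v \<noteq> a" "v \<noteq> b" "v \<noteq> c'" using N_irrefl[OF v] abc(1) by auto
  let ?xs = "[v, a, b, c', p, q, r, w]"
  have dis: "distinct ?xs" using vabc abc abcp pqr wv wc w wpqr p(2) q(2) r(2) by auto
  have sub: "set ?xs \<subseteq> V" using v V pV wV by simp
  have T: "list_all2 (\<lambda>x js. distinct js \<and> length js = d \<and>
      (\<forall>j\<in>set js. j < length ?xs \<and> ?xs ! j \<in> N x)) ?xs cube_table"
    unfolding cube_table_def using d3 abc(1) vN mem sy wp wq wr Nw by simp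
  have "set ?xs = V" "isomorphic gr (label_graph cube_table)"
    using embed_list[OF _ dis sub T] by simp_all
  then show "finite V" "card V = 8" "isomorphic gr (label_graph cube_table)"
    using distinct_card[OF dis] by (metis List.finite_set, simp, simp)
qed

lemma triple_cut:
  assumes "X \<subseteq> V" "card X = 3"
  shows "5 \<le> c X"
proof (rule ccontr)
  assume "\<not> 5 \<le> c X"
  then have "c X < 2 * d" using d3 by simp
  then show False
  proof (rule triple_cases[OF assms])
    fix x y z assume a: "X = {x, y, z}" "y \<in> N x" "z \<in> N x" "z \<in> N y"
    then have "x \<in> V" using assms(1) by simp
    then show False using no_triD a by blast
  qed (use \<open>\<not> 5 \<le> c X\<close> d3 in auto)
qed

text \<open>Deleting a vertex leaves a cut of at least 5, so inner degrees are at least 2. An inner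
  degree 3 would, without triangles, leave the other vertices with inner degree 1.\<close>

lemma quad_cycle:
  assumes X: "X \<subseteq> V" "card X = 4" "c X \<le> 5"
  obtains p q r s where "X = {p, q, r, s}" "distinct [p, q, r, s]"
    "N p \<inter> X = {q, s}" "N q \<inter> X = {p, r}" "N r \<inter> X = {q, s}" "N s \<inter> X = {p, r}"
proof -
  have f: "finite X" using X(2) card.infinite by fastforce
  have ge2: "2 \<le> card (N x \<inter> X)" if x: "x \<in> X" for x
  proof -
    have "card (X - {x}) = 3" using card_Suc_Diff1[OF f x] X(2) by simp
    then have "5 \<le> c (X - {x})" using X(1) by (intro triple_cut) auto
    then show ?thesis using c_remove[OF f X(1) x] X(3) d3 by linarith
  qed
  have "card (N x \<inter> X) = 2" if x: "x \<in> X" for x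
  proof (rule ccontr)
    assume "card (N x \<inter> X) \<noteq> 2"
    then have c3: "3 \<le> card (N x \<inter> X)" using ge2[OF x] by linarith
    have xV: "x \<in> V" using x X by blast
    have sub: "N x \<inter> X \<subseteq> X - {x}" using N_irrefl[OF xV] by blast
    have "card (X - {x}) = 3" using card_Suc_Diff1[OF f x] X(2) by simp
    then have eq: "N x \<inter> X = X - {x}" using c3 sub f by (intro card_seteq) auto
    have "N x \<inter> X \<noteq> {}" using c3 by (metis card.empty not_numeral_le_zero)
    then obtain y where y: "y \<in> N x \<inter> X" by blast
    have "N y \<inter> X \<subseteq> {x}"
    proof
      fix z assume z: "z \<in> N y \<inter> X"
      then show "z \<in> {x}" using eq no_triD[OF xV, of y z] y by blast
    qed
    then have "card (N y \<inter> X) \<le> 1" using card_mono[of "{x}" "N y \<inter> X"] by simp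
    then show False using ge2[of y] y by simp
  qed
  then show thesis using regular_4_cycle[OF X(1,2)] that by metis
qed

lemma quad_is_cycle:
  assumes X: "X \<subseteq> V" "card X = 4" "c X \<le> 5"
  shows "is_cycle (induced gr X) 4"
proof -
  obtain p q r s where X': "X = {p, q, r, s}" "distinct [p, q, r, s]"
    "N p \<inter> X = {q, s}" "N q \<inter> X = {p, r}" "N r \<inter> X = {q, s}" "N s \<inter> X = {p, r}"
    by (rule quad_cycle[OF X])
  have adj: "y \<in> N p \<longleftrightarrow> y \<in> {q, s}" "y \<in> N q \<longleftrightarrow> y \<in> {p, r}" "y \<in> N r \<longleftrightarrow> y \<in> {q, s}"
    "y \<in> N s \<longleftrightarrow> y \<in> {p, r}"
    if "y \<in> X" for y
    by (rule X'(3-6)[THEN mem_Int_iff, OF that])+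
  have lt4: "i = 0 \<or> i = 1 \<or> i = 2 \<or> i = 3" if "i < 4" for i :: nat using that by linarith
  have "[p, q, r, s] ! j \<in> N ([p, q, r, s] ! i) \<longleftrightarrow> j = (i + 1) mod 4 \<or> i = (j + 1) mod 4"
    if "i < 4" "j < 4" for i j
    using lt4[OF that(1)] lt4[OF that(2)] X'(1,2) by (elim disjE) (auto simp: adj)
  then have "is_cycle (induced gr (set [p, q, r, s])) 4"
    using X X'(1,2) by (intro cycle_induced) auto
  then show ?thesis using X'(1) by simp
qed

text \<open>A smaller cut would have a minimiser with three or four vertices, and both sizes are
  bounded already.\<close>

lemma cubic_lower:
  assumes "\<And>X. X \<subseteq> V \<Longrightarrow> card X = 4 \<Longrightarrow> 5 \<le> c X" "sep 3 Y"
  shows "5 \<le> c Y"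
proof (rule ccontr)
  assume Y: "\<not> 5 \<le> c Y"
  then have "c Y < 2 * d" "3 \<le> d" using d3 by auto
  from small_minimal[OF assms(2) this]
  obtain k A where k: "\<And>Y. sep 3 Y \<Longrightarrow> k \<le> c Y" "small A" "card A = 3 \<or> card A = 4" "c A = k"
    by metis
  have "A \<subseteq> V" using k(2) by (simp add: small_def)
  then have "5 \<le> c A" using k(3) triple_cut assms(1) by blast
  then show False using k(1)[OF assms(2)] k(4) Y by linarith
qed

end

section \<open>Cubic graphs of girth at least five\<close>

locale girth5_egraph = cubic_egraph +
  assumes no_quad: "x \<in> V \<Longrightarrow> y \<in> V \<Longrightarrow> x \<noteq> y \<Longrightarrow> card (N x \<inter> N y) \<le> 1"
begin

lemma no_quadD:
  assumes "x \<in> V" "y \<in> V" "x \<noteq> y" "a \<in> N x" "a \<in> N y" "b \<in> N x" "b \<in> N y"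
  shows "a = b"
  using common_unique[OF assms(1,4-7)] no_quad[OF assms(1-3)] .

lemma quad_cut:
  assumes "X \<subseteq> V" "card X = 4"
  shows "6 \<le> c X"
proof (rule ccontr)
  assume "\<not> 6 \<le> c X"
  then have "c X \<le> 5" by simp
  then obtain p q r s where X: "X = {p, q, r, s}" "distinct [p, q, r, s]"
    "N p \<inter> X = {q, s}" "N r \<inter> X = {q, s}"
    using quad_cycle[OF assms] by metis
  then have "q \<in> N p" "q \<in> N r" "s \<in> N p" "s \<in> N r" by blast+
  then show False using no_quadD[of p r q s] X assms(1) by auto
qed

text \<open>Deleting a vertex leaves a cut of at least 6, so inner degrees are at least 2. If
  \<open>x\<close> had inner degree 3, each of its neighbours would need the one remaining vertex
  \<open>z\<close> as a second inner neighbour, which creates a 4-cycle.\<close>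

lemma pentagon:
  assumes X: "X \<subseteq> V" "card X = 5" "c X \<le> 5"
  obtains p q r s t where "X = {p, q, r, s, t}" "distinct [p, q, r, s, t]"
    "N p \<inter> X = {q, t}" "N q \<inter> X = {p, r}" "N r \<inter> X = {q, s}" "N s \<inter> X = {r, t}" "N t \<inter> X = {s, p}"
proof -
  have f: "finite X" using X(2) card.infinite by fastforce
  have ge2: "2 \<le> card (N x \<inter> X)" if x: "x \<in> X" for x
  proof -
    have "card (X - {x}) = 4" using card_Suc_Diff1[OF f x] X(2) by simp
    then have "6 \<le> c (X - {x})" using X(1) by (intro quad_cut) auto
    then show ?thesis using c_remove[OF f X(1) x] X(3) d3 by linarith
  qed
  have "card (N x \<inter> X) = 2" if x: "x \<in> X" for x
  proof (rule ccontr)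
    assume "card (N x \<inter> X) \<noteq> 2"
    then have c3: "3 \<le> card (N x \<inter> X)" using ge2[OF x] by linarith
    have xV: "x \<in> V" using x X by blast
    have sub: "N x \<subseteq> X"
    proof -
      have "N x \<inter> X = N x" using c3 N3[OF xV] N_fin[OF xV] by (intro card_seteq) auto
      then show ?thesis by blast
    qed
    obtain y1 y2 y3 where y: "N x = {y1, y2, y3}" "y1 \<noteq> y2" "y2 \<noteq> y3" "y1 \<noteq> y3"
      using N3[OF xV] by (auto simp: card_3_iff)
    have dis: "x \<notin> {y1, y2, y3}" using N_irrefl[OF xV] y by auto
    have "card (X - {x, y1, y2, y3}) = 1"
      using sub x f X(2) y dis by (subst card_Diff_subset) auto
    then obtain z where z: "X - {x, y1, y2, y3} = {z}" by (rule card_1_singletonE)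
    have Xsub: "X \<subseteq> {z, x} \<union> N x" using z y(1) by auto
    have zin: "z \<in> N w" if w: "w \<in> N x" for w
    proof (rule ccontr)
      assume nz: "z \<notin> N w"
      have wX: "w \<in> X" "w \<in> V" using w sub X by blast+
      have "N w \<inter> X \<subseteq> {x}"
      proof
        fix u assume u: "u \<in> N w \<inter> X"
        have "u \<notin> N x" using no_triD[OF xV w] u by blast
        then show "u \<in> {x}" using u Xsub nz by blast
      qed
      then have "card (N w \<inter> X) \<le> 1" using card_mono[of "{x}" "N w \<inter> X"] by simp
      then show False using ge2[OF wX(1)] by simp
    qed
    have zV: "z \<in> V" "z \<noteq> x" using z X by blast+
    have "y1 \<in> N z" "y2 \<in> N z" using zin y(1) N_sym N_sub[OF xV] by blast+
    then show False using no_quadD[OF zV(1) xV zV(2), of y1 y2] y by blast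
  qed
  then show thesis using regular_5_cycle[OF X(1,2)] that by metis
qed

lemma pentagon_is_cycle:
  assumes X: "X \<subseteq> V" "card X = 5" "c X \<le> 5"
  shows "is_cycle (induced gr X) 5"
proof -
  obtain p q r s t where X': "X = {p, q, r, s, t}" "distinct [p, q, r, s, t]"
    "N p \<inter> X = {q, t}" "N q \<inter> X = {p, r}" "N r \<inter> X = {q, s}" "N s \<inter> X = {r, t}" "N t \<inter> X = {s, p}"
    by (rule pentagon[OF X])
  have adj: "y \<in> N p \<longleftrightarrow> y \<in> {q, t}" "y \<in> N q \<longleftrightarrow> y \<in> {p, r}" "y \<in> N r \<longleftrightarrow> y \<in> {q, s}"
    "y \<in> N s \<longleftrightarrow> y \<in> {r, t}"
    "y \<in> N t \<longleftrightarrow> y \<in> {s, p}" if "y \<in> X" for y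
    by (rule X'(3-7)[THEN mem_Int_iff, OF that])+
  have lt5: "i = 0 \<or> i = 1 \<or> i = 2 \<or> i = 3 \<or> i = 4" if "i < 5" for i :: nat using that by linarith
  have "[p, q, r, s, t] ! j \<in> N ([p, q, r, s, t] ! i) \<longleftrightarrow> j = (i + 1) mod 5 \<or> i = (j + 1) mod 5"
    if "i < 5" "j < 5" for i j
    using lt5[OF that(1)] lt5[OF that(2)] X'(1,2) by (elim disjE) (auto simp: adj)
  then have "is_cycle (induced gr (set [p, q, r, s, t])) 5"
    using X X'(1,2) by (intro cycle_induced) auto
  then show ?thesis using X'(1) by simp
qed

text \<open>A 5-cycle read from its first 2-path \<open>u v w\<close>. Only the turns at
  \<open>u\<close>, \<open>v\<close> and \<open>w\<close> are required not to go back; the absence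
  of triangles gives the rest, as \<open>pent_rotate\<close> shows.\<close>

definition pent :: "'a \<Rightarrow> 'a \<Rightarrow> 'a \<Rightarrow> 'a \<Rightarrow> 'a \<Rightarrow> bool" where
  "pent u v w x y \<longleftrightarrow> v \<in> V \<and> u \<in> N v \<and> w \<in> N v \<and> u \<noteq> w \<and> x \<in> N w \<and> x \<noteq> v \<and>
     y \<in> N u \<and> y \<noteq> v \<and> x \<in> N y"

lemma pent_V: "pent u v w x y \<Longrightarrow> u \<in> V \<and> v \<in> V \<and> w \<in> V \<and> x \<in> V \<and> y \<in> V"
  unfolding pent_def using N_V by blast

lemma pent_rotate: "pent u v w x y \<Longrightarrow> pent v w x y u"
  using pent_V[of u v w x y] unfolding pent_def by (metis N_sym no_triD)

lemma pent_reflect: "pent u v w x y \<Longrightarrow> pent w v u y x"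
  using pent_V[of u v w x y] unfolding pent_def by (metis N_sym)

text \<open>A pentagon through \<open>a v b\<close> is the same as an edge between the remaining
  neighbours of \<open>a\<close> and those of \<open>b\<close>.\<close>

lemma pent_card:
  assumes "v \<in> V" "a \<in> N v" "b \<in> N v" "a \<noteq> b"
  shows "finite {(y, x). pent a v b x y}"
    and "e (N a - {v}) (N b - {v}) = card {(y, x). pent a v b x y}"
proof -
  have V: "a \<in> V" "b \<in> V" using assms N_V by blast+
  have eq: "{(y, x). pent a v b x y} = {(y, x). y \<in> N a - {v} \<and> x \<in> N y \<inter> (N b - {v})}"
    using assms by (auto simp: pent_def)
  have "{(y, x). pent a v b x y} \<subseteq> N a \<times> N b" by (auto simp: pent_def)
  then show "finite {(y, x). pent a v b x y}" using N_fin V by (meson finite_SigmaI finite_subset)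
  show "e (N a - {v}) (N b - {v}) = card {(y, x). pent a v b x y}"
    unfolding eq using N_sub[OF V(1)] N_fin[OF V(1)] by (intro e_eq_card) auto
qed

text \<open>Two such neighbours would close a 4-cycle through \<open>y\<close> and
  \<open>b\<close>.\<close>

lemma pent_step_le:
  assumes "v \<in> V" "a \<in> N v" "b \<in> N v" "a \<noteq> b" "y \<in> N a"
  shows "card (N y \<inter> (N b - {v})) \<le> 1"
proof -
  have V: "a \<in> V" "b \<in> V" "y \<in> V" using assms N_V by blast+
  have "y \<noteq> b" using no_triD[OF assms(1,2,3)] assms(5) by blast
  then have "card (N y \<inter> N b) \<le> 1" using no_quad V by blast
  moreover have "card (N y \<inter> (N b - {v})) \<le> card (N y \<inter> N b)"
    using N_fin V by (intro card_mono) auto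
  ultimately show ?thesis by linarith
qed

text \<open>The analogue of \<open>quads_const\<close> for 5-cycles: \<open>g\<close> counts those
  through an edge, \<open>F\<close> those through a 2-path. Either of the two neighbours of
  \<open>y\<close> other than \<open>x\<close> contributes at most one to \<open>F x y b\<close>,
  whence \<open>m \<le> 2\<close>.\<close>

lemma pents_const:
  obtains m where "m \<le> 2"
    "\<And>v a b. v \<in> V \<Longrightarrow> a \<in> N v \<Longrightarrow> b \<in> N v \<Longrightarrow> a \<noteq> b \<Longrightarrow> e (N a - {v}) (N b - {v}) = m"
proof -
  define g where "g x y = (\<Sum>a\<in>N x - {y}. \<Sum>b\<in>N y - {x}. card (N a \<inter> N b))" for x y
  have g_const: "g x y = g x' y'" if "x \<in> V" "y \<in> N x" "x' \<in> V" "y' \<in> N x'" for x y x' y'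
  proof (rule edge_count[OF that])
    show "g x y = g y x" for x y
      unfolding g_def by (subst sum.swap) (simp add: Int_commute)
  next
    fix f x y assume f: "aut f" and xy: "x \<in> V" "y \<in> N x"
    have V: "y \<in> V" "N x \<subseteq> V" "N y \<subseteq> V" using xy N_sub by blast+
    have im: "N (f x) - {f y} = f ` (N x - {y})" "N (f y) - {f x} = f ` (N y - {x})"
      using f V xy aut_inj[OF f] by (auto simp: aut_def inj_on_def)
    have inj: "inj_on f (N x - {y})" "inj_on f (N y - {x})"
      using aut_inj[OF f] V by (meson Diff_subset inj_on_subset dual_order.trans)+
    have "card (N (f a) \<inter> N (f b)) = card (N a \<inter> N b)" if "a \<in> N x - {y}" "b \<in> N y - {x}" for a b
    proof -
      have ab: "a \<in> V" "b \<in> V" using that V by blast+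
      then have "N (f a) \<inter> N (f b) = f ` (N a \<inter> N b)"
        using f aut_Int[OF f N_sub[OF ab(1)] N_sub[OF ab(2)]] by (simp add: aut_def)
      then show ?thesis using aut_card[OF f] N_sub[OF ab(1)] by (metis le_infI1)
    qed
    then show "g (f x) (f y) = g x y"
      unfolding g_def im by (simp add: sum.reindex[OF inj(1)] sum.reindex[OF inj(2)])
  qed
  obtain x y where x: "x \<in> V" "y \<in> N x"
    using V_ne N3 by (metis all_not_in_conv card.empty zero_neq_numeral)
  define F where "F v a b = e (N a - {v}) (N b - {v})" for v a b
  have F: "2 * F v a b = g x y" if v: "v \<in> V" "a \<in> N v" "b \<in> N v" "a \<noteq> b" for v a b
  proof (rule path_count[OF _ _ v])
    fix v a b assume v: "v \<in> V" "a \<in> N v" "b \<in> N v"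
    then have "N a \<subseteq> V" "N b \<subseteq> V" "finite (N a)" "finite (N b)" using N_sub N_V N_fin by metis+
    then show "F v a b = F v b a" unfolding F_def by (intro e_sym) auto
  next
    fix v a assume v: "v \<in> V" "a \<in> N v"
    then have aV: "a \<in> V" "v \<in> N a" using N_V N_sym by blast+
    \<comment> \<open>If \<open>v\<close> were adjacent to \<open>p\<close>, then \<open>v\<close>,
      \<open>a\<close>, \<open>p\<close> would be a triangle. This brings the sum of
      \<open>F\<close> into the form of \<open>g\<close>.\<close>
    have "card (N p \<inter> (N b - {v})) = card (N p \<inter> N b)" if "p \<in> N a - {v}" for p b
    proof -
      have "v \<notin> N p" using no_triD[OF aV(1), of p v] that aV(2) by blast
      then have "N p \<inter> (N b - {v}) = N p \<inter> N b" by blast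
      then show ?thesis by simp
    qed
    then have "(\<Sum>b\<in>N v - {a}. F v a b) = (\<Sum>b\<in>N v - {a}. \<Sum>p\<in>N a - {v}. card (N p \<inter> N b))"
      unfolding F_def e_def by simp
    also have "\<dots> = g a v" unfolding g_def by (rule sum.swap)
    also have "\<dots> = g x y" using g_const[OF aV x] .
    finally show "(\<Sum>b\<in>N v - {a}. F v a b) = g x y" .
  qed
  define m where "m = g x y div 2"
  have Fm: "F v a b = m" if v: "v \<in> V" "a \<in> N v" "b \<in> N v" "a \<noteq> b" for v a b
    using F[OF v] by (simp add: m_def)
  obtain b where b: "b \<in> N x" "b \<noteq> y"
    using N_obtain[OF x(1), of "{y}"] d3 by auto
  have yV: "y \<in> V" "x \<in> N y" using x N_V N_sym by blast+
  have "card (N y - {x}) = 2" using N3[OF yV(1)] yV(2) by simp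
  moreover have "F x y b \<le> of_nat (card (N y - {x})) * 1"
    unfolding F_def e_def
      using pent_step_le[OF x b(1) b(2)[symmetric]] by (intro sum_bounded_above) auto
  ultimately have "m \<le> 2" using Fm[OF x b(1) b(2)[symmetric]] by simp
  then show thesis using that[of m] Fm by (simp add: F_def)
qed

text \<open>With two pentagons on each 2-path, every neighbour of \<open>a\<close> other than
  \<open>v\<close> is joined to exactly one neighbour of \<open>b\<close> other than
  \<open>v\<close>. The choices made at \<open>a1\<close> determine all others: a deviation closes a
  triangle or a 4-cycle.\<close>

lemma petersen:
  assumes m: "\<And>v a b. v \<in> V \<Longrightarrow> a \<in> N v \<Longrightarrow> b \<in> N v \<Longrightarrow> a \<noteq> b \<Longrightarrow> e (N a - {v}) (N b - {v}) = 2"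
  shows "finite V" "card V = 10" "isomorphic gr (label_graph petersen_table)"
proof -
  have one: "\<exists>x. N y \<inter> (N b - {v}) = {x}"
    if v: "v \<in> V" "a \<in> N v" "b \<in> N v" "a \<noteq> b" and y: "y \<in> N a" "y \<noteq> v" for v a b y
  proof -
    have V: "a \<in> V" "v \<in> N a" using v N_V N_sym by blast+
    obtain z where z: "N a = {v, y, z}" "z \<noteq> v" "z \<noteq> y" using N_third[OF V y(1)] y(2) by metis
    then have "N a - {v} = {y, z}" using y by auto
    then have "card (N y \<inter> (N b - {v})) + card (N z \<inter> (N b - {v})) = 2"
      using m[OF v] z(3) by (simp add: e_def)
    moreover have "z \<in> N a" using z by blast
    ultimately have "card (N y \<inter> (N b - {v})) = 1"
      using pent_step_le[OF v y(1)] pent_step_le[OF v, of z] by linarith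
    then show ?thesis by (metis card_1_singletonE)
  qed
  obtain v where v: "v \<in> V" using V_ne by blast
  obtain a b c' where abc: "N v = {a, b, c'}" "a \<noteq> b" "b \<noteq> c'" "a \<noteq> c'"
    using N3[OF v] by (auto simp: card_3_iff)
  have abc': "a \<in> N v" "b \<in> N v" "c' \<in> N v" using abc by auto
  have V: "a \<in> V" "b \<in> V" "c' \<in> V" and vN: "v \<in> N a" "v \<in> N b" "v \<in> N c'"
    using N_V[OF v] N_sym[OF v] abc' by auto
  obtain a1 where a1: "a1 \<in> N a" "a1 \<noteq> v" using N_obtain[OF V(1), of "{v}"] d3 by auto
  obtain a2 where a2: "N a = {v, a1, a2}" "a2 \<noteq> v" "a2 \<noteq> a1"
    using N_third[OF V(1) vN(1) a1(1)] a1(2) by metis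
  obtain b1 where b1: "N a1 \<inter> (N b - {v}) = {b1}" using one[OF v abc'(1,2) abc(2) a1] by blast
  obtain c1 where c1: "N a1 \<inter> (N c' - {v}) = {c1}" using one[OF v abc'(1,3) abc(4) a1] by blast
  have b1': "b1 \<in> N a1" "b1 \<in> N b" "b1 \<noteq> v" and c1': "c1 \<in> N a1" "c1 \<in> N c'" "c1 \<noteq> v"
    using b1 c1 by blast+
  obtain b2 where b2: "N b = {v, b1, b2}" "b2 \<noteq> v" "b2 \<noteq> b1"
    using N_third[OF V(2) vN(2) b1'(2)] b1'(3) by metis
  obtain c2 where c2: "N c' = {v, c1, c2}" "c2 \<noteq> v" "c2 \<noteq> c1"
    using N_third[OF V(3) vN(3) c1'(2)] c1'(3) by metis
  have a2': "a2 \<in> N a" "b2 \<in> N b" "c2 \<in> N c'" using a2 b2 c2 by auto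
  have V2: "a1 \<in> V" "a2 \<in> V" "b1 \<in> V" "b2 \<in> V" "c1 \<in> V" "c2 \<in> V"
    using N_V V a1(1) a2' b1'(2) c1'(2) by blast+
  have outer: "x \<notin> N v" if "x \<in> N y" "y \<in> N v" "x \<noteq> v" for x y
    using no_triD[OF v that(2), of x] that(1) by blast
  have sep': "x \<notin> N z" if "x \<in> N y" "y \<in> N v" "z \<in> N v" "y \<noteq> z" "x \<noteq> v" for x y z
    using no_quadD[OF N_V[OF v that(2)] N_V[OF v that(3)] that(4) that(1), of v] N_sym[OF v] that
      by blast
  have a2b2: "b2 \<in> N a2"
  proof -
    obtain x where x: "N a2 \<inter> (N b - {v}) = {x}"
      using one[OF v abc'(1,2) abc(2) a2'(1) a2(2)] by blast
    have "x \<noteq> b1"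
    proof
      assume "x = b1"
      then have "b1 \<in> N a2" using x by blast
      moreover have "b1 \<noteq> a" using outer[OF b1'(2) abc'(2) b1'(3)] abc'(1) by blast
      ultimately show False
        using no_quadD[OF V2(3) V(1) _ _ a1(1) _ a2'(1)] b1'(1) N_sym[OF V2(1)] N_sym[OF V2(2)]
          a2(3) by blast
    qed
    then show ?thesis using x b2(1) by blast
  qed
  have a2c2: "c2 \<in> N a2"
  proof -
    obtain x where x: "N a2 \<inter> (N c' - {v}) = {x}"
      using one[OF v abc'(1,3) abc(4) a2'(1) a2(2)] by blast
    have "x \<noteq> c1"
    proof
      assume "x = c1"
      then have "c1 \<in> N a2" using x by blast
      moreover have "c1 \<noteq> a" using outer[OF c1'(2) abc'(3) c1'(3)] abc'(1) by blast
      ultimately show False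
        using no_quadD[OF V2(5) V(1) _ _ a1(1) _ a2'(1)] c1'(1) N_sym[OF V2(1)] N_sym[OF V2(2)]
          a2(3) by blast
    qed
    then show ?thesis using x c2(1) by blast
  qed
  have b1c2: "c2 \<in> N b1"
  proof -
    obtain x where x: "N b1 \<inter> (N c' - {v}) = {x}" using one[OF v abc'(2,3) abc(3) b1'(2,3)] by blast
    then have "x \<noteq> c1" using no_triD[OF V2(1) b1'(1) c1'(1)] by blast
    then show ?thesis using x c2(1) by blast
  qed
  have b2c1: "c1 \<in> N b2"
  proof -
    obtain x where x: "N b2 \<inter> (N c' - {v}) = {x}"
      using one[OF v abc'(2,3) abc(3) a2'(2) b2(2)] by blast
    then have "x \<noteq> c2" using no_triD[OF V2(2) a2b2 a2c2] by blast
    then show ?thesis using x c2(1) by blast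
  qed
  have rev_adj: "a \<in> N a1" "a \<in> N a2" "b \<in> N b1" "b \<in> N b2" "c' \<in> N c1" "c' \<in> N c2"
    "a1 \<in> N b1" "a1 \<in> N c1" "a2 \<in> N b2" "a2 \<in> N c2" "b1 \<in> N c2" "b2 \<in> N c1"
    using N_sym V V2 a1(1) a2' b1' c1' a2b2 a2c2 b1c2 b2c1 by blast+
  have dif1: "a1 \<notin> N v" "a2 \<notin> N v" "b1 \<notin> N v" "b2 \<notin> N v" "c1 \<notin> N v" "c2 \<notin> N v"
    using outer a1 a2 a2' b1' b2 c1' c2 abc' by blast+
  have dif2: "a1 \<notin> N b" "a2 \<notin> N b" "a1 \<notin> N c'" "a2 \<notin> N c'" "b1 \<notin> N c'" "b2 \<notin> N c'"
    using sep' a1 a2(2) a2' b1' b2(2) abc' abc by blast+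
  let ?xs = "[v, a, b, c', a1, a2, b1, b2, c1, c2]"
  have "v \<notin> N v" using N_irrefl v by blast
  then have dis: "distinct ?xs"
    using dif1 dif2 abc a1 a2 a2' b1' b2 c1' c2 by auto
  have sub: "set ?xs \<subseteq> V" using v V V2 by simp
  have T: "list_all2 (\<lambda>x js. distinct js \<and> length js = d \<and>
      (\<forall>j\<in>set js. j < length ?xs \<and> ?xs ! j \<in> N x)) ?xs petersen_table"
    unfolding petersen_table_def
    using d3 abc' vN a1(1) a2' b1'(1,2) c1'(1,2) a2b2 a2c2 b1c2 b2c1 rev_adj by simp
  have "set ?xs = V" "isomorphic gr (label_graph petersen_table)"
    using embed_list[OF _ dis sub T] by simp_all
  then show "finite V" "card V = 10" "isomorphic gr (label_graph petersen_table)"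
    using distinct_card[OF dis] by (metis List.finite_set, simp, simp)
qed

lemma girth5_lower:
  assumes "sep 3 Y"
  shows "5 \<le> c Y"
proof (rule cubic_lower[OF _ assms])
  fix X assume "X \<subseteq> V" "card X = 4"
  then have "6 \<le> c X" by (rule quad_cut)
  then show "5 \<le> c X" by simp
qed

text \<open>Uncrossing leaves four to six vertices, and an odd cut in a cubic graph requires an odd
  number.\<close>

lemma large_pentagon:
  assumes "small X" "4 \<le> card X" "c X \<le> 5"
  obtains A where "A \<subseteq> V" "card A = 5" "c A \<le> 5"
proof -
  have p: "3 \<le> (4 :: nat)" "5 < 4 * d" using d3 by auto
  obtain A B where A: "small A" "c A = 5" "4 \<le> card A" "card (A - B) < 4" "card (A \<inter> B) < 4"
    by (rule uncrossing[OF girth5_lower p(1) assms p(2)])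
  have f: "A \<subseteq> V" "finite A" using A by (auto simp: small_def)
  have "card A = card (A - B) + card (A \<inter> B)"
    using card_Diff_Int[OF f(2)] .
  then have "card A = 4 \<or> card A = 5 \<or> card A = 6" using A(3-5) by linarith
  moreover have "odd (card A)" using c_parity[OF f(2,1)] A(2) d3 by simp
  ultimately have "card A = 5" by (elim disjE) simp_all
  then show thesis using that[OF f(1)] A(2) by simp
qed

lemma pentagon_pent:
  assumes "X \<subseteq> V" "card X = 5" "c X \<le> 5"
  shows "\<exists>u v w x y. pent u v w x y"
proof -
  obtain p q r s t where X: "X = {p, q, r, s, t}" "distinct [p, q, r, s, t]"
    "N p \<inter> X = {q, t}" "N q \<inter> X = {p, r}" "N r \<inter> X = {q, s}" "N s \<inter> X = {r, t}" "N t \<inter> X = {s, p}"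
    by (rule pentagon[OF assms])
  have "p \<in> N q" "r \<in> N q" "s \<in> N r" "t \<in> N p" "s \<in> N t"
    using X(3-7)[THEN equalityD2] by simp_all
  moreover have "q \<in> V" using X(1) assms(1) by simp
  ultimately have "pent p q r s t" using X(2) by (auto simp: pent_def)
  then show ?thesis by blast
qed

end

section \<open>The dodecahedron\<close>

locale dodeca_egraph = girth5_egraph +
  assumes pent_ex: "v \<in> V \<Longrightarrow> u \<in> N v \<Longrightarrow> w \<in> N v \<Longrightarrow> u \<noteq> w \<Longrightarrow> \<exists>x y. pent u v w x y"
    and pent_uniq: "pent u v w x y \<Longrightarrow> pent u v w x' y' \<Longrightarrow> x = x' \<and> y = y'"
begin

text \<open>\<open>f\<close> is only known to be injective on the rows of the table. Equal images of
  the ends of a walk without backtracking would close a short cycle, or a pentagon other than the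
  unique one on its first two edges.\<close>

lemma spread_injective:
  assumes adj: "\<And>i j. i < n \<Longrightarrow> j \<in> set (T ! i) \<Longrightarrow> j < n \<and> f j \<in> N (f i)"
    and V: "\<And>i. i < n \<Longrightarrow> f i \<in> V"
    and inj: "\<And>i. i < n \<Longrightarrow> inj_on f (set (T ! i))"
    and sym: "\<And>i j. i < n \<Longrightarrow> j \<in> set (T ! i) \<Longrightarrow> i \<in> set (T ! j)"
    and ij: "i < n" "spread T i j"
  shows "f i \<noteq> f j"
proof -
  let ?E = "\<lambda>i j. i < n \<and> j \<in> set (T ! i)"
  have E: "j < n" "f j \<in> N (f i)" "f i \<in> N (f j)" "?E j i" if "?E i j" for i j
    using that adj[of i j] sym[of i j] N_sym V by auto
  have one: "f i \<noteq> f j" if "?E i j" for i j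
    using E(2)[OF that] N_irrefl V that by force
  have two: "f i \<noteq> f k" if "?E i j" "?E j k" "k \<noteq> i" for i j k
    using inj_on_eq_iff[OF inj, of j i k] E(4)[OF that(1)] that by auto
  have three: "f i \<noteq> f l" if "?E i j" "?E j k" "?E k l" "k \<noteq> i" "l \<noteq> j" for i j k l
  proof
    assume "f i = f l"
    then have "f k \<in> N (f i)" using E(3)[OF that(3)] by simp
    then show False
      using no_triD[OF V E(2)[OF that(1)], of "f k"] E(2)[OF that(2)] that(1) by simp
  qed
  have four: "f i \<noteq> f m" if "?E i j" "?E j k" "?E k l" "?E l m" "k \<noteq> i" "l \<noteq> j" "m \<noteq> k"
    for i j k l m
  proof
    assume eq: "f i = f m"
    have "f j \<noteq> f l" "f i \<noteq> f k" using two that by blast+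
    moreover have "f j \<in> N (f i)" "f j \<in> N (f k)" "f l \<in> N (f i)" "f l \<in> N (f k)"
      using E that eq by metis+
    moreover have "f i \<in> V" "f k \<in> V" using V that by auto
    ultimately show False using no_quadD by metis
  qed
  \<comment> \<open>The table contains the pentagon \<open>i a b k' l'\<close>; if
    \<open>f i = f j\<close>, the walk would close to a second pentagon through the images of
    \<open>i\<close>, \<open>a\<close>, \<open>b\<close>, with \<open>k\<close> in place of
    \<open>k'\<close>.\<close>
  have five: "f i \<noteq> f j"
    if "?E i a" "?E a b" "?E b k" "?E k l" "?E l j" "b \<noteq> i" "k \<noteq> a" "l \<noteq> b" "j \<noteq> k"
      and k': "?E b k'" "?E k' l'" "?E l' i" "k' \<noteq> a" "k' \<noteq> k" "l' \<noteq> b" for i j a b k l k' l'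
  proof
    assume eq: "f i = f j"
    have "pent (f i) (f a) (f b) (f k) (f l)"
      unfolding pent_def
        using E[OF that(1)] E[OF that(2)] E[OF that(3)] E[OF that(4)] E[OF that(5)] V that eq
        two[OF that(1,2,6)] two[OF that(2,3,7)] three[OF that(2,3,4) that(7,8)] by auto
    moreover have "pent (f i) (f a) (f b) (f k') (f l')"
      unfolding pent_def
        using E[OF that(1)] E[OF that(2)] E[OF k'(1)] E[OF k'(2)] E[OF k'(3)] V that
        two[OF that(1,2,6)] two[OF that(2) k'(1) k'(4)] three[OF that(2) k'(1,2) k'(4,6)] by auto
    ultimately have "f k = f k'" using pent_uniq by blast
    then show False using inj_on_eq_iff[OF inj, of b k k'] that by auto
  qed
  note E1 = E(1)
  from ij(2) show ?thesis
    unfolding spread_def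
  proof (elim disjE bexE conjE)
    assume "j \<in> set (T ! i)"
    then show ?thesis using one ij(1) by blast
  next
    fix a assume "a \<in> set (T ! i)" "j \<noteq> i" "j \<in> set (T ! a)"
    then show ?thesis using two[of i a j] E1[of i a] ij(1) by blast
  next
    fix a b assume a: "a \<in> set (T ! i)" "b \<in> set (T ! a)" "b \<noteq> i" "j \<noteq> a" "j \<in> set (T ! b)"
    then have "?E i a" "?E a b" "?E b j" using E1 ij(1) by blast+
    then show ?thesis using three a by blast
  next
    fix a b k assume a: "a \<in> set (T ! i)" "b \<in> set (T ! a)" "b \<noteq> i" "k \<in> set (T ! b)" "k \<noteq> a"
      "j \<noteq> b" "j \<in> set (T ! k)"
    then have "?E i a" "?E a b" "?E b k" "?E k j" using E1 ij(1) by blast+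
    then show ?thesis using four a by blast
  next
    fix a b k l k' l' assume a: "a \<in> set (T ! i)" "b \<in> set (T ! a)" "b \<noteq> i" "k \<in> set (T ! b)"
      "k \<noteq> a"
      "l \<in> set (T ! k)" "l \<noteq> b" "j \<noteq> k" "j \<in> set (T ! l)" "k' \<in> set (T ! b)" "k' \<noteq> a" "k' \<noteq> k"
      "l' \<in> set (T ! k')" "l' \<noteq> b" "i \<in> set (T ! l')"
    then have e: "?E i a" "?E a b" "?E b k" "?E k l" "?E l j" "?E b k'" "?E k' l'" "?E l' i"
      using E1 ij(1) by blast+
    show ?thesis by (rule five[OF e(1-5) a(3,5,7,8) e(6-8) a(11,12,14)])
  qed
qed

text \<open>Indices are read modulo 5: \<open>A i\<close> are the vertices of a pentagon, \<open>B i\<close> is the third neighbour of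
  \<open>A i\<close>, \<open>C i\<close> completes the pentagon through \<open>B i\<close>, \<open>A i\<close>, \<open>A (i + 1)\<close>, \<open>B (i + 1)\<close>, and \<open>D i\<close> is the third
  neighbour of \<open>C i\<close>.\<close>

lemma dodecahedron: "isomorphic gr (label_graph dodecahedron_table)"
proof -
  obtain v where v: "v \<in> V" using V_ne by blast
  obtain u w z where abc: "N v = {u, w, z}" "u \<noteq> w" "w \<noteq> z" "u \<noteq> z"
    using N3[OF v] by (auto simp: card_3_iff)
  obtain x y where P: "pent u v w x y" using pent_ex[OF v, of u w] abc by auto
  define A where "A = cyc5 u v w x y"
  have P1: "pent v w x y u" using pent_rotate[OF P] .
  have P2: "pent w x y u v" using pent_rotate[OF P1] .
  have P3: "pent x y u v w" using pent_rotate[OF P2] .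
  have P4: "pent y u v w x" using pent_rotate[OF P3] .
  have A_per: "A (i + 5) = A i" for i unfolding A_def by (rule cyc5_period)
  have A0: "pent (A i) (A (i + 1)) (A (i + 2)) (A (i - 2)) (A (i - 1))" for i
    unfolding A_def by (rule cyc5_all[where P = "\<lambda>p q r s t. pent p q r s t"]) (fact P P1 P2 P3 P4)+
  have A1: "pent (A (i - 1)) (A i) (A (i + 1)) (A (i + 2)) (A (i - 2))" for i
  proof -
    have "pent (A (i - 1)) (A i) (A (i + 1)) (A (i - 3)) (A (i - 2))"
      using A0[of "i - 1", unfolded int_shift] by simp
    moreover have "i - 3 + 5 = i + 2" by simp
    then have "A (i - 3) = A (i + 2)" using A_per[of "i - 3"] by metis
    ultimately show ?thesis by simp
  qed
  have AV: "A i \<in> V" for i using pent_V[OF A1] by blast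
  have AA: "A (i + 1) \<in> N (A i)" "A (i - 1) \<in> N (A i)" "A (i - 1) \<noteq> A (i + 1)" for i
    using A1[of i] by (auto simp: pent_def)
  define B where
    "B i = (SOME z. N (A i) = {A (i - 1), A (i + 1), z} \<and> z \<noteq> A (i - 1) \<and> z \<noteq> A (i + 1))" for i
  have B: "N (A i) = {A (i - 1), A (i + 1), B i} \<and> B i \<noteq> A (i - 1) \<and> B i \<noteq> A (i + 1)" for i
  proof -
    have "\<exists>z. N (A i) = {A (i - 1), A (i + 1), z} \<and> z \<noteq> A (i - 1) \<and> z \<noteq> A (i + 1)"
      using N_third[OF AV AA(2,1,3)] by metis
    then show ?thesis unfolding B_def by (rule someI_ex)
  qed
  have B_per: "B (i + 5) = B i" for i
    unfolding B_def int_shift using A_per[of i] A_per[of "i + 1", unfolded int_shift]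
      A_per[of "i - 1", unfolded int_shift] by simp
  have BA: "B i \<in> N (A i)" and AB: "A i \<in> N (B i)" and BV: "B i \<in> V" for i
    using B[of i] N_sym[OF AV] N_V[OF AV] by blast+
  define C where "C i = (SOME y. pent (B i) (A i) (A (i + 1)) (B (i + 1)) y)" for i
  have C: "pent (B i) (A i) (A (i + 1)) (B (i + 1)) (C i)" for i
  proof -
    obtain x y where xy: "pent (B i) (A i) (A (i + 1)) x y"
      using pent_ex[OF AV BA AA(1)] B by metis
    have "x \<in> N (A (i + 1))" "x \<noteq> A i" using xy by (auto simp: pent_def)
    then have "x = A (i + 2) \<or> x = B (i + 1)" using B[of "i + 1", unfolded int_shift] by blast
    \<comment> \<open>Otherwise this pentagon shares the 2-path \<open>A i\<close>,
      \<open>A (i + 1)\<close>, \<open>A (i + 2)\<close> with the initial one, which would identify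
      \<open>B i\<close> with \<open>A (i - 1)\<close>.\<close>
    moreover have "x \<noteq> A (i + 2)"
    proof
      assume "x = A (i + 2)"
      then have "pent (A i) (A (i + 1)) (A (i + 2)) y (B i)" using pent_rotate[OF xy] by simp
      then have "B i = A (i - 1)" using pent_uniq A0 by blast
      then show False using B by blast
    qed
    ultimately have "pent (B i) (A i) (A (i + 1)) (B (i + 1)) y" using xy by blast
    then show ?thesis unfolding C_def by (rule someI)
  qed
  have C_per: "C (i + 5) = C i" for i
    unfolding C_def int_shift using A_per[of i] A_per[of "i + 1", unfolded int_shift]
      B_per[of i] B_per[of "i + 1", unfolded int_shift] by simp
  note C1 = pent_rotate[OF C]
  note C2 = pent_rotate[OF C1]
  note C3 = pent_rotate[OF C2]
  note C4 = pent_rotate[OF C3]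
  have CV: "C i \<in> V" for i using pent_V[OF C] by blast
  have CB: "C i \<in> N (B i)" "C (i - 1) \<in> N (B i)" for i
    using C3[of i] C2[of "i - 1", unfolded int_shift] N_sym[OF CV] by (auto simp: pent_def)
  have CA: "C i \<noteq> A i" "C (i - 1) \<noteq> A i" for i
    using C[of i] C1[of "i - 1", unfolded int_shift] by (auto simp: pent_def)
  have BC: "B i \<in> N (C i)" "B (i + 1) \<in> N (C i)" for i
    using C3[of i] by (auto simp: pent_def)
  \<comment> \<open>Otherwise the pentagons on both sides of \<open>B i\<close> share the 2-path
    \<open>C i\<close>, \<open>B i\<close>, \<open>A i\<close> and coincide.\<close>
  have Cne: "C (i - 1) \<noteq> C i" for i
  proof
    assume eq: "C (i - 1) = C i"
    have "pent (C i) (B i) (A i) (A (i + 1)) (B (i + 1))" using C4 .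
    moreover have "pent (C (i - 1)) (B i) (A i) (A (i - 1)) (B (i - 1))"
      using pent_reflect[OF C2[of "i - 1", unfolded int_shift]] .
    ultimately have "A (i + 1) = A (i - 1)" using pent_uniq eq by metis
    then show False using AA(3) by metis
  qed
  have NB: "N (B i) = {A i, C (i - 1), C i}" for i
    using AB CB[of i] CA[of i] Cne[of i] by (intro N_eq3[OF BV]) auto
  have Bne: "B i \<noteq> B (i + 1)" for i
    using no_triD[OF AV AA(1) BA, of i] BA[of "i + 1"] by metis
  define D where "D i = (SOME z. N (C i) = {B i, B (i + 1), z} \<and> z \<noteq> B i \<and> z \<noteq> B (i + 1))" for i
  have D: "N (C i) = {B i, B (i + 1), D i} \<and> D i \<noteq> B i \<and> D i \<noteq> B (i + 1)" for i
  proof -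
    have "\<exists>z. N (C i) = {B i, B (i + 1), z} \<and> z \<noteq> B i \<and> z \<noteq> B (i + 1)"
      using N_third[OF CV BC Bne] by metis
    then show ?thesis unfolding D_def by (rule someI_ex)
  qed
  have D_per: "D (i + 5) = D i" for i
    unfolding D_def int_shift
      using C_per[of i] B_per[of i] B_per[of "i + 1", unfolded int_shift] by simp
  have DC: "D i \<in> N (C i)" and CD: "C i \<in> N (D i)" and DV: "D i \<in> V" for i
    using D[of i] N_sym[OF CV] N_V[OF CV] by blast+
  \<comment> \<open>The pentagon through \<open>C (i - 1)\<close>, \<open>B i\<close>,
    \<open>C i\<close> can continue only to the vertices \<open>D\<close>: a turn to a vertex
    \<open>B\<close> would give it a 2-path of a pentagon already found.\<close>
  have Q: "pent (C (i - 1)) (B i) (C i) (D i) (D (i - 1))" for i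
  proof -
    obtain x y where xy: "pent (C (i - 1)) (B i) (C i) x y"
      using pent_ex[OF BV CB(2) CB(1) Cne] by metis
    have "x \<in> N (C i)" "x \<noteq> B i" "y \<in> N (C (i - 1))" "y \<noteq> B i" using xy by (auto simp: pent_def)
    then have "x = B (i + 1) \<or> x = D i" "y = B (i - 1) \<or> y = D (i - 1)"
      using D[of i] D[of "i - 1", unfolded int_shift] by blast+
    moreover have "x \<noteq> B (i + 1)"
    proof
      assume "x = B (i + 1)"
      then have "pent (B i) (C i) (B (i + 1)) y (C (i - 1))" using pent_rotate[OF xy] by simp
      moreover have "pent (B i) (C i) (B (i + 1)) (A (i + 1)) (A i)" using pent_reflect[OF C3] .
      ultimately show False using pent_uniq CA(2) by metis
    qed
    moreover have "y \<noteq> B (i - 1)"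
    proof
      assume "y = B (i - 1)"
      then have "pent (B (i - 1)) (C (i - 1)) (B i) (C i) x"
        using pent_rotate[OF pent_rotate[OF pent_rotate[OF pent_rotate[OF xy]]]] by simp
      moreover have "pent (B (i - 1)) (C (i - 1)) (B i) (A i) (A (i - 1))"
        using pent_reflect[OF C3[of "i - 1", unfolded int_shift]] .
      ultimately show False using pent_uniq CA(1) by metis
    qed
    ultimately show ?thesis using xy by blast
  qed
  have DD: "D (i - 1) \<in> N (D i)" "D (i + 1) \<in> N (D i)" for i
    using Q[of i] Q[of "i + 1", unfolded int_shift] N_sym[OF DV] by (auto simp: pent_def)
  have CDne: "C i \<noteq> D (i - 1)" "C i \<noteq> D (i + 1)" for i
    using pent_rotate[OF pent_rotate[OF Q[of i]]]
      pent_rotate[OF pent_rotate[OF pent_rotate[OF pent_rotate[OF Q[of "i + 1", unfolded int_shift]]]]]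
    by (auto simp: pent_def)
  have Dne: "D (i - 1) \<noteq> D (i + 1)" for i
  proof
    assume eq: "D (i - 1) = D (i + 1)"
    have "pent (C i) (D i) (D (i - 1)) (C (i - 1)) (B i)"
      using pent_rotate[OF pent_rotate[OF Q[of i]]] .
    moreover have "pent (C i) (D i) (D (i + 1)) (C (i + 1)) (B (i + 1))"
      using
        pent_reflect[OF pent_rotate[OF pent_rotate[OF pent_rotate[OF Q[of "i + 1", unfolded int_shift]]]]]
        .
    ultimately have "B i = B (i + 1)" using pent_uniq eq by metis
    then show False using Bne by metis
  qed
  have per: "A 5 = A 0" "A (-1) = A 4" "B 5 = B 0" "B (-1) = B 4" "C 5 = C 0" "C (-1) = C 4"
      "D 5 = D 0" "D (-1) = D 4"
    using A_per[of 0] A_per[of "-1"] B_per[of 0] B_per[of "-1"] C_per[of 0] C_per[of "-1"]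
      D_per[of 0] D_per[of "-1"] by simp_all
  let ?xs = "[A 0, A 1, A 2, A 3, A 4, B 0, B 1, B 2, B 3, B 4, C 0, C 1, C 2, C 3, C 4,
    D 0, D 1, D 2, D 3, D 4]"
  \<comment> \<open>A map from the labels of the dodecahedron; \<open>ok\<close> makes it a local
    isomorphism, and \<open>spread_injective\<close> then separates labels that are far
    apart.\<close>
  define f where "f i = ?xs ! i" for i
  have ok:
    "list_all2 (\<lambda>x js. distinct (map f js) \<and> (\<forall>j\<in>set js. j < 20 \<and> f j \<in> N x)) ?xs dodecahedron_table"
    unfolding dodecahedron_table_def f_def
    using AA[of 0] AA[of 1] AA[of 2] AA[of 3] AA[of 4] BA[of 0] BA[of 1] BA[of 2] BA[of 3] BA[of 4]
      AB[of 0] AB[of 1] AB[of 2] AB[of 3] AB[of 4] CB[of 0] CB[of 1] CB[of 2] CB[of 3] CB[of 4]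
      BC[of 0] BC[of 1] BC[of 2] BC[of 3] BC[of 4] DC[of 0] DC[of 1] DC[of 2] DC[of 3] DC[of 4]
      CD[of 0] CD[of 1] CD[of 2] CD[of 3] CD[of 4] DD[of 0] DD[of 1] DD[of 2] DD[of 3] DD[of 4]
      B[of 0] B[of 1] B[of 2] B[of 3] B[of 4] CA[of 0] CA[of 1] CA[of 2] CA[of 3] CA[of 4]
      Cne[of 0] Cne[of 1] Cne[of 2] Cne[of 3] Cne[of 4] Bne[of 0] Bne[of 1] Bne[of 2] Bne[of 3]
        Bne[of 4]
      D[of 0] D[of 1] D[of 2] D[of 3] D[of 4] CDne[of 0] CDne[of 1] CDne[of 2] CDne[of 3] CDne[of 4]
      Dne[of 0] Dne[of 1] Dne[of 2] Dne[of 3] Dne[of 4]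
    by (simp add: per eq_commute)
  have len: "length dodecahedron_table = 20" by (simp add: dodecahedron_table_def)
  have sub: "set ?xs \<subseteq> V" using AV BV CV DV by simp
  have ok_i: "distinct (map f (dodecahedron_table ! i)) \<and>
      (\<forall>j\<in>set (dodecahedron_table ! i). j < 20 \<and> f j \<in> N (f i))" if "i < 20" for i
    using list_all2_nthD[OF ok, of i] that by (simp add: f_def)
  have symT: "\<forall>i\<in>set [0..<20]. \<forall>j\<in>set (dodecahedron_table ! i). i \<in> set (dodecahedron_table ! j)"
    by code_simp
  have fne: "f i \<noteq> f j" if ij: "i < 20" "j < 20" "i \<noteq> j" for i j
  proof (rule spread_injective[where n = 20 and T = dodecahedron_table])
    show "spread dodecahedron_table i j" using dodecahedron_table_spread ij by simp
    show "f k \<in> V" if "k < 20" for k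
    proof -
      have "f k \<in> set ?xs" unfolding f_def using that by (intro nth_mem) simp
      then show ?thesis using sub by blast
    qed
    show "inj_on f (set (dodecahedron_table ! k))" if "k < 20" for k
      using ok_i[OF that] by (simp add: distinct_map)
    show "l < 20 \<and> f l \<in> N (f k)" "k \<in> set (dodecahedron_table ! l)"
      if "k < 20" "l \<in> set (dodecahedron_table ! k)" for k l
    proof -
      show "l < 20 \<and> f l \<in> N (f k)" using ok_i that by blast
      have "k \<in> set [0..<20]" using that(1) by simp
      then show "k \<in> set (dodecahedron_table ! l)" using symT that(2) by blast
    qed
  qed (rule ij(1))
  have dis: "distinct ?xs"
    unfolding distinct_conv_nth
  proof (intro allI impI)
    fix i j assume "i < length ?xs" "j < length ?xs" "i \<noteq> j"
    then have "i < 20" "j < 20" by simp_all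
    then show "?xs ! i \<noteq> ?xs ! j" using fne[of i j] \<open>i \<noteq> j\<close> unfolding f_def by blast
  qed
  have dT: "\<forall>js\<in>set dodecahedron_table. distinct js \<and> length js = 3" by code_simp
  have T: "list_all2 (\<lambda>x js. distinct js \<and> length js = d \<and>
      (\<forall>j\<in>set js. j < length ?xs \<and> ?xs ! j \<in> N x)) ?xs dodecahedron_table"
  proof -
    have
      "list_all2 (\<lambda>x js. js \<in> set dodecahedron_table \<and> (\<forall>j\<in>set js. j < 20 \<and> f j \<in> N x)) ?xs dodecahedron_table"
    proof (rule list_all2_all_nthI)
      show "length ?xs = length dodecahedron_table" unfolding len by simp
      fix i assume "i < length ?xs"
      then have "i < 20" by simp
      then show "dodecahedron_table ! i \<in> set dodecahedron_table \<and>
          (\<forall>j\<in>set (dodecahedron_table ! i). j < 20 \<and> f j \<in> N (?xs ! i))"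
        using ok_i[of i] nth_mem[of i dodecahedron_table] unfolding len f_def[of i] by blast
    qed
    then show ?thesis
    proof (rule list_all2_mono)
      fix x js assume js: "js \<in> set dodecahedron_table \<and> (\<forall>j\<in>set js. j < 20 \<and> f j \<in> N x)"
      then have "distinct js" "length js = d" using dT d3 by simp_all
      moreover have "length ?xs = 20" by simp
      ultimately show "distinct js \<and> length js = d \<and> (\<forall>j\<in>set js. j < length ?xs \<and> ?xs ! j \<in> N x)"
        using js unfolding f_def by metis
    qed
  qed
  show ?thesis using embed_list(2)[OF _ dis sub T] by simp
qed

text \<open>A vertex outside the pentagon has at most one neighbour on it. Two added vertices thus
  bring at most three new inner edges, and the cut fails to grow only if all three occur. Then the
  attachment points \<open>a\<close> and \<open>b\<close> are distinct and not adjacent, and the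
  edge \<open>x y\<close> closes a second pentagon through the 2-path that joins them on
  \<open>Q\<close>.\<close>

lemma pentagon_pair_cut:
  assumes Q: "Q \<subseteq> V" "card Q = 5" "c Q \<le> 5" and xy: "x \<in> V" "y \<in> V" "x \<notin> Q" "y \<notin> Q" "x \<noteq> y"
  shows "c Q < c (insert x (insert y Q))"
proof (rule ccontr)
  assume le: "\<not> c Q < c (insert x (insert y Q))"
  obtain p q r s t where X: "Q = {p, q, r, s, t}" "distinct [p, q, r, s, t]"
    "N p \<inter> Q = {q, t}" "N q \<inter> Q = {p, r}" "N r \<inter> Q = {q, s}" "N s \<inter> Q = {r, t}" "N t \<inter> Q = {s, p}"
    by (rule pentagon[OF Q])
  have fin: "finite Q" using X(1) by simp
  have mem: "q \<in> N p" "t \<in> N p" "p \<in> N q" "r \<in> N q" "q \<in> N r" "s \<in> N r" "r \<in> N s" "t \<in> N s"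
    "s \<in> N t" "p \<in> N t"
    using X(3-7)[THEN equalityD2] by simp_all
  have V: "p \<in> V" "q \<in> V" "r \<in> V" "s \<in> V" "t \<in> V" using Q(1) X(1) by auto
  have chord: "b \<in> N a \<or> (\<exists>m k l. {m, k, l} \<subseteq> Q \<and> pent a m b k l)" if "a \<in> Q" "b \<in> Q" "a \<noteq> b"
    for a b
    using that unfolding X(1) pent_def
    by (elim insertE emptyE) (use X(2) mem V in auto)
  have single: "card (N z \<inter> Q) \<le> 1" if z: "z \<in> V" "z \<notin> Q" for z
  proof (rule ccontr)
    assume "\<not> card (N z \<inter> Q) \<le> 1"
    then have "\<exists>a b. a \<in> N z \<inter> Q \<and> b \<in> N z \<inter> Q \<and> a \<noteq> b"
      using card_le_Suc0_iff_eq[of "N z \<inter> Q"] fin by auto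
    then obtain a b where ab: "a \<in> N z" "b \<in> N z" "a \<in> Q" "b \<in> Q" "a \<noteq> b" by blast
    show False
    proof (cases "b \<in> N a")
      case True
      then show False using no_triD[OF z(1) ab(1,2)] by blast
    next
      case False
      then obtain m k l where m: "m \<in> Q" "pent a m b k l" using chord[OF ab(3,4,5)] by blast
      then have "a \<in> N m" "b \<in> N m" "m \<in> V" by (auto simp: pent_def)
      then show False using no_quadD[OF z(1) _ _ ab(1) _ ab(2)] m(1) z(2) ab(5) by blast
    qed
  qed
  have c2: "c (insert x (insert y Q)) + 2 * card (N x \<inter> insert y Q) = c (insert y Q) + 3"
    using c_insert[of "insert y Q" x] fin Q xy d3 by simp
  have c1: "c (insert y Q) + 2 * card (N y \<inter> Q) = c Q + 3"
    using c_insert[of Q y] fin Q xy d3 by simp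
  have cx: "card (N x \<inter> insert y Q) = of_bool (y \<in> N x) + card (N x \<inter> Q)"
    by (rule card_N_insert) (use fin xy in auto)
  have sx: "card (N x \<inter> Q) \<le> 1" "card (N y \<inter> Q) \<le> 1" using single xy by auto
  have "y \<in> N x" "card (N x \<inter> Q) = 1" "card (N y \<inter> Q) = 1"
    using c1 c2 cx sx le by (auto simp: of_bool_def split: if_splits)
  then obtain a b where ab: "N x \<inter> Q = {a}" "N y \<inter> Q = {b}" by (metis card_1_singletonE)
  then have a: "a \<in> N x" "a \<in> Q" "b \<in> N y" "b \<in> Q" by blast+
  have aV: "a \<in> V" "b \<in> V" using a Q by blast+
  have "a \<noteq> b" using no_triD[OF xy(1) \<open>y \<in> N x\<close> a(1)] a(3) by blast
  moreover have "b \<notin> N a"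
  proof
    assume "b \<in> N a"
    then have "a \<in> N b" "y \<in> N b" using N_sym aV xy(2) a(3) by blast+
    then have "a = y" using no_quadD[OF xy(1) aV(2) _ a(1) _ \<open>y \<in> N x\<close>] a(4) xy(3) by blast
    then show False using a(2) xy(4) by blast
  qed
  ultimately obtain m k l where m: "{m, k, l} \<subseteq> Q" "pent a m b k l" using chord[OF a(2,4)] by blast
  have "pent a m b y x"
    using m a \<open>y \<in> N x\<close> xy N_sym aV unfolding pent_def by auto
  then show False using pent_uniq[OF m(2)] m(1) xy(4) by blast
qed

text \<open>Uncrossing with \<open>n = 6\<close> and parity leave sizes 7 and 9 for
  \<open>A\<close>. The parts \<open>A - B\<close> and \<open>A \<inter> B\<close> have at most five
  vertices and not four, which excludes 9 and makes one of them a pentagon with cut at most 5.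
  Adding the last two vertices of \<open>A\<close> strictly raises the cut to 5, but no such
  pentagon has a cut below 5.\<close>

lemma dodeca_small:
  assumes "small X" "c X \<le> 5"
  shows "card X < 6"
proof (rule ccontr)
  assume "\<not> card X < 6"
  then have X6: "6 \<le> card X" by simp
  have p: "3 \<le> (6 :: nat)" "5 < 6 * d" using d3 by auto
  obtain A B where A: "small A" "small B" "card A = card B" "c A = 5" "c B = 5" "6 \<le> card A"
    "card (A - B) < 6" "card (A \<inter> B) < 6" "card (A - B) = card (B - A)"
    by (rule uncrossing[OF girth5_lower p(1) assms(1) X6 assms(2) p(2)])
  have f: "A \<subseteq> V" "finite A" "B \<subseteq> V" "finite B" using A by (auto simp: small_def)
  have split: "card A = card (A - B) + card (A \<inter> B)"
    using card_Diff_Int[OF f(2)] .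
  have odd: "odd (card A)" using c_parity[OF f(2,1)] A(4) d3 by simp
  note un = uncross_union[OF f(1,3,2,4)]
  have low: "5 \<le> c Y" if "small Y" "3 \<le> card Y" for Y
    using girth5_lower small_sep that by blast
  have sm: "small (A - B)" "small (B - A)" "small (A \<inter> B)" using small_subset A(1,2) by auto
  have i5: "c (A \<inter> B) \<le> 5" if i: "3 \<le> card (A \<inter> B)"
  proof -
    have "card (A \<union> B) + card (A \<inter> B) = 2 * card A" using card_Un_Int[OF f(2,4)] A(3) by simp
    moreover have "card A \<le> card (A \<union> B)" using f by (intro card_mono) auto
    ultimately have "sep 3 (A \<union> B)" using A(1,6) f i by (auto simp: sep_def small_def)
    then have "5 \<le> c (A \<union> B)" by (rule girth5_lower)
    then show ?thesis using un(1) A(4,5) by linarith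
  qed
  have d5: "c (A - B) \<le> 5" if "3 \<le> card (A - B)"
    using un(2) low[OF sm(2)] that A(4,5,9) by linarith
  have "card (A \<inter> B) \<noteq> 4"
  proof
    assume 4: "card (A \<inter> B) = 4"
    then have "6 \<le> c (A \<inter> B)" using f by (intro quad_cut) auto
    then show False using i5 4 by simp
  qed
  moreover have "card (A - B) \<noteq> 4"
  proof
    assume 4: "card (A - B) = 4"
    then have "6 \<le> c (A - B)" using f by (intro quad_cut) auto
    then show False using d5 4 by simp
  qed
  ultimately have ne: "card (A \<inter> B) = 5 \<or> card (A \<inter> B) \<le> 3" "card (A - B) = 5 \<or> card (A - B) \<le> 3"
    using A(7,8) by linarith+
  obtain m where m: "card A = 2 * m + 1" using odd by (rule oddE)
  then have m34: "m = 3 \<or> m = 4" using split A(6-8) by linarith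
  have "m \<noteq> 4"
  proof
    assume "m = 4"
    then have "card A = 9" using m by simp
    then show False using ne split by (elim disjE; linarith)
  qed
  then have A7: "card A = 7" using m m34 by simp
  then have cases: "card (A - B) = 5 \<or> card (A \<inter> B) = 5" using ne split by linarith
  obtain Q where Q: "Q \<subseteq> A" "card Q = 5" "c Q \<le> 5"
  proof (cases "card (A - B) = 5")
    case True
    then show thesis using that[of "A - B"] d5 by auto
  next
    case False
    then show thesis using that[of "A \<inter> B"] cases i5 by auto
  qed
  have QV: "Q \<subseteq> V" "finite Q" using Q f finite_subset by auto
  have "card (A - Q) = 2" using Q A7 QV(2) by (subst card_Diff_subset) auto
  then obtain x y where xy: "A - Q = {x, y}" "x \<noteq> y" by (auto simp: card_2_iff)
  then have "A = insert x (insert y Q)" "x \<in> V" "y \<in> V" "x \<notin> Q" "y \<notin> Q" using Q(1) f(1) by blast+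
  then have "c Q < 5" using pentagon_pair_cut[OF QV(1) Q(2,3), of x y] xy(2) A(4) by simp
  moreover have "small Q" using small_subset[OF A(1) Q(1)] .
  ultimately show False using low[of Q] Q(2) by simp
qed

end

section \<open>Classification\<close>

context egraph
begin

text \<open>The number of triangles on an edge is even because \<open>3 * t\<close> is. Without
  triangles the case distinction is on the 4-cycles and then on the 5-cycles through a 2-path; zero
  5-cycles contradict the pentagon that every larger set yields.\<close>

lemma classification_cubic:
  assumes d: "d = 3" and A: "small A" "3 \<le> card A" "c A < 2 * d"
  shows "isomorphic (induced gr A) (path_graph 2)
    \<or> (isomorphic gr (skeleton cube) \<or> isomorphic gr (skeleton dodecahedron)
        \<or> isomorphic gr petersen_graph) \<and> shortest_cycle (induced gr A) gr"
proof -
  have f: "A \<subseteq> V" "finite A" using A(1) by (auto simp: small_def)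
  have c5: "c A \<le> 5" using A(3) d by simp
  obtain x0 where x0: "x0 \<in> V" using V_ne by blast
  obtain y0 where y0: "y0 \<in> N x0" using N_card[OF x0] d by fastforce
  define t where "t = card (N x0 \<inter> N y0)"
  have t: "card (N x \<inter> N y) = t" if "x \<in> V" "y \<in> N x" for x y
    unfolding t_def using tri_const that x0 y0 by metis
  have "N x0 \<inter> N y0 \<subseteq> N x0 - {y0}" using N_irrefl N_V[OF x0 y0] by blast
  then have "t \<le> card (N x0 - {y0})" unfolding t_def using N_fin[OF x0] by (intro card_mono) auto
  then have "t \<le> 2" using y0 N_card[OF x0] d by simp
  moreover have "even t" using tri_parity[OF x0 t[OF x0]] d by simp
  ultimately have "t = 0 \<or> t = 2" by presburger
  then consider "t = 0" | "t = 2" by blast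
  then show ?thesis
  proof cases
    case 2
    \<comment> \<open>This is K_4, where half of the vertices are fewer than three.\<close>
    have full: "card (N x \<inter> N y) + 1 = d" if "x \<in> V" "y \<in> N x" for x y
      using t[OF that] 2 d by simp
    have "finite V" "card V = 4" using complete[OF full] d by simp_all
    then show ?thesis using A(1,2) by (simp add: small_def)
  next
    case 1
    have "N x \<inter> N y = {}" if "x \<in> V" "y \<in> N x" for x y
      using t[OF that] 1 N_fin[OF that(1)] by simp
    then interpret cubic_egraph V N d using d by unfold_locales auto
    have path: "isomorphic (induced gr A) (path_graph 2)" if "card A = 3"
    proof (rule triple_cases[OF f(1) that A(3)])
      fix x y z assume a: "A = {x, y, z}" "y \<in> N x" "z \<in> N x" "z \<in> N y"
      then have "x \<in> V" using f(1) by simp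
      then show ?thesis using no_triD a by blast
    qed (use d in auto)
    obtain m where m: "m \<le> 2"
      "\<And>v a b. v \<in> V \<Longrightarrow> a \<in> N v \<Longrightarrow> b \<in> N v \<Longrightarrow> a \<noteq> b \<Longrightarrow> card (N a \<inter> N b) = m + 1"
      using quads_const by blast
    consider "m = 0" | "m = 1" | "m = 2" using m(1) by linarith
    then show ?thesis
    proof cases
      case 3
      have "finite V" "card V \<le> 6" using few_vertices m(2) 3 by simp_all
      then have "card A = 3" using A by (simp add: small_def)
      then show ?thesis using path by blast
    next
      case 2
      have cube: "finite V" "card V = 8" "isomorphic gr (label_graph cube_table)"
        using cube_graph m(2) 2 by simp_all
      have "card A = 3 \<or> card A = 4" using A cube(1,2) by (auto simp: small_def)
      then show ?thesis
      proof
        assume "card A = 4"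
        then have "is_cycle (induced gr A) 4" using quad_is_cycle f(1) c5 by blast
        then have "shortest_cycle (induced gr A) gr"
          using no_tri f(1) by (intro shortest_cycleI) auto
        then show ?thesis using isomorphic_trans[OF cube(3) cube_skeleton] by blast
      qed (use path in blast)
    next
      case 1
      have "card (N x \<inter> N y) \<le> 1" if "x \<in> V" "y \<in> V" "x \<noteq> y" for x y
      proof (cases "N x \<inter> N y = {}")
        case False
        then obtain v where "v \<in> N x" "v \<in> N y" by blast
        then have "v \<in> V" "x \<in> N v" "y \<in> N v" using that N_V N_sym by blast+
        then show ?thesis using m(2)[of v x y] that(3) 1 by simp
      qed simp
      then interpret girth5_egraph V N d by unfold_locales
      have short: "shortest_cycle (induced gr A) gr" if "card A = 5"
        using pentagon_is_cycle[OF f(1) that c5] no_tri no_quad f(1) by (intro shortest_cycleI) auto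
      have "card A \<noteq> 4" using quad_cut[OF f(1)] c5 by fastforce
      then consider "card A = 3" | "5 \<le> card A" using A(2) by linarith
      then show ?thesis
      proof cases
        case 2
        then have A4: "4 \<le> card A" by simp
        obtain X where X: "X \<subseteq> V" "card X = 5" "c X \<le> 5" by (rule large_pentagon[OF A(1) A4 c5])
        obtain u v w x y where P: "pent u v w x y" using pentagon_pent[OF X] by blast
        then have uvw: "v \<in> V" "u \<in> N v" "w \<in> N v" "u \<noteq> w" by (auto simp: pent_def)
        obtain k where k: "k \<le> 2"
          "\<And>v a b. v \<in> V \<Longrightarrow> a \<in> N v \<Longrightarrow> b \<in> N v \<Longrightarrow> a \<noteq> b \<Longrightarrow> e (N a - {v}) (N b - {v}) = k"
          using pents_const by blast
        have "(y, x) \<in> {(y, x). pent u v w x y}" using P by simp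
        then have "card {(y, x). pent u v w x y} \<noteq> 0" using pent_card(1)[OF uvw] by auto
        then have "k \<noteq> 0" using pent_card(2)[OF uvw] k(2)[OF uvw] by simp
        then consider "k = 1" | "k = 2" using k(1) by linarith
        then show ?thesis
        proof cases
          case 2
          have pet: "finite V" "card V = 10" "isomorphic gr (label_graph petersen_table)"
            using petersen k(2) 2 by simp_all
          then have "card A = 5" using \<open>5 \<le> card A\<close> A(1) by (simp add: small_def)
          then show ?thesis
            using short isomorphic_trans[OF pet(3) petersen_isomorphic] by blast
        next
          case 1
          have one: "\<exists>p. {(y, x). pent u v w x y} = {p}" if "v \<in> V" "u \<in> N v" "w \<in> N v" "u \<noteq> w"
            for u v w
            using pent_card(2)[OF that] k(2)[OF that] 1 by (metis card_1_singletonE)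
          interpret dodeca_egraph V N d
          proof unfold_locales
            show "\<exists>x y. pent u v w x y" if h: "v \<in> V" "u \<in> N v" "w \<in> N v" "u \<noteq> w" for u v w
            proof -
              obtain p where "{(y, x). pent u v w x y} = {p}" using one[OF h] by blast
              then have "p \<in> {(y, x). pent u v w x y}" by (simp only: singletonI)
              then show ?thesis by auto
            qed
            show "x = x' \<and> y = y'" if p: "pent u v w x y" "pent u v w x' y'" for u v w x y x' y'
            proof -
              have "v \<in> V" "u \<in> N v" "w \<in> N v" "u \<noteq> w" using p by (auto simp: pent_def)
              then obtain q where "{(y, x). pent u v w x y} = {q}" using one by metis
              moreover have "(y, x) \<in> {(y, x). pent u v w x y}"
                "(y', x') \<in> {(y, x). pent u v w x y}"
                using p by simp_all
              ultimately have "(y, x) = q" "(y', x') = q" by (metis singletonD)+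
              then show ?thesis by auto
            qed
          qed
          have "card A = 5" using dodeca_small[OF A(1) c5] \<open>5 \<le> card A\<close> by simp
          then show ?thesis
            using short isomorphic_trans[OF dodecahedron dodecahedron_skeleton] by blast
        qed
      qed (use path in blast)
    qed
  qed
qed

text \<open>The least separating set contains a triangle, so every edge lies in one. The degree
  bound and the parity of \<open>d * t\<close> then leave five pairs \<open>(d, t)\<close>.\<close>

lemma classification_not_cubic:
  assumes d: "4 \<le> d" and A: "small A" "3 \<le> card A" "c A < 2 * d"
  shows "cubic_line_graph gr \<and> is_cycle (induced gr A) 3
    \<or> (isomorphic gr (skeleton octahedron) \<or> isomorphic gr (skeleton icosahedron)
        \<or> isomorphic gr (complete_graph 6)) \<and> shortest_cycle (induced gr A) gr"
proof -
  have f: "A \<subseteq> V" "finite A" using A(1) by (auto simp: small_def)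
  have d3: "3 \<le> d" using d by simp
  have tri3: "is_cycle (induced gr A) 3" if "card A = 3"
  proof (rule triple_cases[OF f(1) that A(3) d3])
    fix x y z assume "A = {x, y, z}" "y \<in> N x" "z \<in> N x" "z \<in> N y"
    moreover from this have "x \<noteq> y" "x \<noteq> z" "y \<noteq> z" using f(1) N_irrefl by auto
    ultimately show ?thesis using triangle_cycle[of x y z] f(1) by simp
  qed (use d in auto)
  have short3: "shortest_cycle (induced gr A) gr" if "card A = 3"
    using tri3[OF that] f(1) by (intro shortest_cycleI) auto
  obtain k B where k: "\<And>Y. sep 3 Y \<Longrightarrow> k \<le> c Y" "small B" "card B = 3 \<or> card B = 4" "c B = k"
    "k < 2 * d"
    using small_minimal[OF small_sep[OF A(1,2)] A(3) d3] by metis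
  have B: "B \<subseteq> V" "finite B" using k(2) by (auto simp: small_def)
  \<comment> \<open>Three vertices span at most three edges and four at most six, so the cut is at
    least \<open>3 * d - 6\<close> or \<open>4 * d - 12\<close>, respectively.\<close>
  have d6: "d < 6"
    using k(3)
  proof
    assume "card B = 4"
    obtain w x y z S where X': "B = {w, x, y, z}" "distinct [w, x, y, z]"
      "c B + 2 * S = 4 * d"
      "S = of_bool (x \<in> N w) + of_bool (y \<in> N w) + of_bool (z \<in> N w) +
        of_bool (y \<in> N x) + of_bool (z \<in> N x) + of_bool (z \<in> N y)"
      by (rule quad_count[OF B(1) \<open>card B = 4\<close>])
    have "S \<le> 6"
      unfolding X'(4) of_bool_def by simp
    then show ?thesis using X'(3) k(4,5) by linarith
  next
    assume "card B = 3"
    then show ?thesis by (rule triple_cases[OF B(1)]) (use k(4,5) d in auto)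
  qed
  have ex: "\<exists>x\<in>V. \<exists>y\<in>N x. N x \<inter> N y \<noteq> {}"
    using k(3)
  proof
    assume "card B = 4"
    then show ?thesis using quad_triangle[OF B(1) _ _ d] k(4,5) by simp
  next
    assume B3: "card B = 3"
    show ?thesis
    proof (rule triple_cases[OF B(1) B3])
      fix x y z assume "B = {x, y, z}" "y \<in> N x" "z \<in> N x" "z \<in> N y"
      then show ?thesis using B(1) by blast
    qed (use k(4,5) d in auto)
  qed
  then obtain x0 y0 where xy0: "x0 \<in> V" "y0 \<in> N x0" "N x0 \<inter> N y0 \<noteq> {}" by blast
  define t where "t = card (N x0 \<inter> N y0)"
  have t: "card (N x \<inter> N y) = t" if "x \<in> V" "y \<in> N x" for x y
    unfolding t_def using tri_const that xy0(1,2) by metis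
  have t1: "1 \<le> t" using xy0(3) N_fin[OF xy0(1)] by (simp add: t_def Suc_le_eq card_gt_0_iff)
  have "N x0 \<inter> N y0 \<subseteq> N x0 - {y0}" using N_irrefl N_V[OF xy0(1,2)] by blast
  then have "t \<le> card (N x0 - {y0})" unfolding t_def
    using N_fin[OF xy0(1)] by (intro card_mono) auto
  then have td: "t + 1 \<le> d" using xy0(2) N_card[OF xy0(1)] d by simp
  have even: "even (d * t)" using tri_parity[OF xy0(1) t[OF xy0(1)]] .
  consider "t + 1 = d" "d = 4" | "t + 1 = d" "d = 5" | "d = 4" "t = 1" | "d = 4" "t = 2"
    | "d = 5" "t = 2"
  proof -
    have "d = 4 \<or> d = 5" using d d6 by linarith
    moreover have "t = 1 \<or> t = 2 \<or> t = 3 \<or> t = 4" using t1 td d6 by linarith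
    ultimately show thesis using that td even by (elim disjE) simp_all
  qed
  then show ?thesis
  proof cases
    case 1
    \<comment> \<open>This is K_5, where half of the vertices are again fewer than three.\<close>
    have full: "card (N x \<inter> N y) + 1 = d" if "x \<in> V" "y \<in> N x" for x y using t[OF that] 1 by simp
    have "finite V" "card V = 5" using complete[OF full] 1 by simp_all
    then show ?thesis using A(1,2) by (simp add: small_def)
  next
    case 2
    have full: "card (N x \<inter> N y) + 1 = d" if "x \<in> V" "y \<in> N x" for x y using t[OF that] 2 by simp
    have V: "finite V" "card V = 6" using complete[OF full] 2 by simp_all
    then have "card A = 3" using A(1,2) by (simp add: small_def)
    then show ?thesis using complete_graph_6[OF V complete(3)[OF full]] short3 by blast
  next
    case 3
    have t': "card (N x \<inter> N y) = 1" if "x \<in> V" "y \<in> N x" for x y using t[OF that] 3 by simp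
    \<comment> \<open>For \<open>d = 4\<close> all cuts are even, so none lies strictly between 6
      and 8; this excludes four vertices here and larger sets \<open>A\<close> below.\<close>
    have "even k" using c_parity[OF B(2,1)] k(4) 3(1) by simp
    have "card B \<noteq> 4"
    proof
      assume "card B = 4"
      then have "6 < k" using line_quad[OF 3(1) t' B(1)] k(4) by simp
      moreover have "k < 8" using k(5) 3(1) by simp
      ultimately have "k = 7" by linarith
      then show False using \<open>even k\<close> by simp
    qed
    then have "card B = 3" using k(3) by blast
    then have "k = 6" by (rule triple_cases[OF B(1)]) (use k(4,5) 3(1) in auto)
    have "card A = 3"
    proof (rule ccontr)
      assume "card A \<noteq> 3"
      then have "6 < c A"
        using no_large_line[OF 3(1) t' _ A(1)] k(1) \<open>k = 6\<close> A(2) by simp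
      then have "c A = 7" using A(3) 3(1) by simp
      then show False using c_parity[OF f(2,1)] 3(1) by simp
    qed
    then show ?thesis using cubic_line_graph_gr[OF 3(1) t'] tri3 by blast
  next
    case 4
    have t': "card (N x \<inter> N y) = 2" if "x \<in> V" "y \<in> N x" for x y using t[OF that] 4 by simp
    note oct = octahedron[OF 4(1) t']
    have "card A = 3" using A(1,2) oct(1,2) by (simp add: small_def)
    then show ?thesis using short3 isomorphic_trans[OF oct(3) octahedron_skeleton] by blast
  next
    case 5
    have t': "card (N x \<inter> N y) = 2" if "x \<in> V" "y \<in> N x" for x y using t[OF that] 5 by simp
    have "\<not> 4 \<le> card A" using no_large_icosahedron[OF 5(1) t' A(1)] A(3) 5(1) by fastforce
    then have "card A = 3" using A(2) by simp
    then show ?thesis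
      using short3 isomorphic_trans[OF icosahedron[OF 5(1) t'] icosahedron_skeleton] by blast
  qed
qed

end

section \<open>From graphs given by edges to neighbourhoods\<close>

lemma nbr_edges:
  assumes "simple_graph G" "x \<in> verts G"
  shows "bij_betw (\<lambda>y. {x, y}) {y. {x, y} \<in> edges G} {E \<in> edges G. x \<in> E}"
  unfolding bij_betw_def
proof
  show "inj_on (\<lambda>y. {x, y}) {y. {x, y} \<in> edges G}" by (auto simp: inj_on_def doubleton_eq_iff)
  show "(\<lambda>y. {x, y}) ` {y. {x, y} \<in> edges G} = {E \<in> edges G. x \<in> E}"
  proof (intro set_eqI iffI)
    fix E assume E: "E \<in> {E \<in> edges G. x \<in> E}"
    then have "card E = 2" using assms(1) by (auto simp: simple_graph_def)
    then obtain y where "E = {x, y}" using E by (auto simp: card_2_iff)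
    then show "E \<in> (\<lambda>y. {x, y}) ` {y. {x, y} \<in> edges G}" using E by auto
  qed auto
qed

text \<open>A graph automorphism commutes with neighbourhoods: an edge at \<open>f z\<close> is the
  image of an edge, and by injectivity the end that is sent to \<open>f z\<close> is
  \<open>z\<close>.\<close>

lemma egraph_of_graph:
  fixes G :: "'a graph"
  assumes s: "simple_graph G" and c: "connected_graph G" and r: "regular_graph d G"
    and et: "edge_transitive G" and d: "0 < d"
  shows "egraph (verts G) (\<lambda>x. {y. {x, y} \<in> edges G}) d"
proof
  let ?N = "\<lambda>x. {y. {x, y} \<in> edges G}"
  have E: "x \<in> verts G" "y \<in> verts G" "x \<noteq> y" if "{x, y} \<in> edges G" for x y
    using s that by (auto simp: simple_graph_def)
  show "?N x \<subseteq> verts G" for x using E by blast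
  show "x \<in> ?N y" if "y \<in> ?N x" for x y using that by (simp add: insert_commute)
  show "x \<notin> ?N x" for x using E by blast
  have fin: "finite {E \<in> edges G. x \<in> E}" "card {E \<in> edges G. x \<in> E} = d" if "x \<in> verts G" for x
    using r that by (auto simp: regular_graph_def)
  show "finite (?N x)" if "x \<in> verts G" for x
    using bij_betw_finite[OF nbr_edges[OF s that]] fin[OF that] by simp
  show "card (?N x) = d" if "x \<in> verts G" for x
    using bij_betw_same_card[OF nbr_edges[OF s that]] fin[OF that] by simp
  show "verts G \<noteq> {}" using c by (simp add: connected_graph_def)
  show "X = verts G" if X: "X \<subseteq> verts G" "X \<noteq> {}" "\<And>x. x \<in> X \<Longrightarrow> ?N x \<subseteq> X" for X
  proof
    show "verts G \<subseteq> X"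
    proof
      fix v assume v: "v \<in> verts G"
      obtain u where u: "u \<in> X" using X(2) by blast
      then have "(u, v) \<in> {(x, y). {x, y} \<in> edges G}\<^sup>*"
        using c v X(1) by (auto simp: connected_graph_def)
      then show "v \<in> X" using u by (induction rule: rtrancl_induct) (use X(3) in auto)
    qed
  qed (rule X(1))
  show
    "\<exists>f. bij_betw f (verts G) (verts G) \<and> (\<forall>z\<in>verts G. ?N (f z) = f ` ?N z) \<and> {f x, f y} = {x', y'}"
    if xy: "x \<in> verts G" "y \<in> ?N x" "x' \<in> verts G" "y' \<in> ?N x'" for x y x' y'
  proof -
    obtain f where f: "graph_iso f G G" "f ` {x, y} = {x', y'}"
      using et xy(2,4) unfolding edge_transitive_def by blast
    have b: "bij_betw f (verts G) (verts G)" and ed: "edges G = (`) f ` edges G"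
      using f(1) by (auto simp: graph_iso_def)
    have inj: "inj_on f (verts G)" using b by (simp add: bij_betw_def)
    have "?N (f z) = f ` ?N z" if z: "z \<in> verts G" for z
    proof (intro set_eqI iffI)
      fix w assume "w \<in> ?N (f z)"
      then have "{f z, w} \<in> (`) f ` edges G" using ed by simp
      then obtain D where D: "D \<in> edges G" "{f z, w} = f ` D" by auto
      then obtain a b where ab: "D = {a, b}" "a \<in> verts G" "b \<in> verts G"
        using s by (auto simp: simple_graph_def card_2_iff)
      then have "f z = f a \<and> w = f b \<or> f z = f b \<and> w = f a"
        using D(2) by (auto simp: doubleton_eq_iff)
      then have "z = a \<and> w = f b \<or> z = b \<and> w = f a" using inj ab z by (meson inj_onD)
      then show "w \<in> f ` ?N z" using D(1) ab(1) by (auto simp: insert_commute)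
    next
      fix w assume "w \<in> f ` ?N z"
      then obtain y where "w = f y" "{z, y} \<in> edges G" by auto
      then have "f ` {z, y} \<in> (`) f ` edges G" by blast
      then show "w \<in> ?N (f z)" using ed \<open>w = f y\<close> by simp
    qed
    then show ?thesis using b f(2) by auto
  qed
qed (use d in simp)

theorem theorem7p3:
  fixes G :: "'a graph" and d :: nat and A :: "'a set"
  assumes "simple_graph G" and "connected_graph G" and "regular_graph d G"
    and "vertex_transitive G" and "edge_transitive G"
    and "A \<subseteq> verts G" and "finite A" and "A \<noteq> {}"
    and "cut_size G A < 2 * d"
    and "finite (verts G) \<longrightarrow> real (card A) \<le> 1 / 2 * real (card (verts G))"
  shows "isomorphic (induced G A) (path_graph 0)
    \<or> isomorphic (induced G A) (path_graph 1)
    \<or> ((\<exists>n. is_cycle G n) \<or> isomorphic G two_way_infinite_path)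
        \<and> (\<exists>k. isomorphic (induced G A) (path_graph k))
    \<or> cubic G \<and> isomorphic (induced G A) (path_graph 2)
    \<or> cubic_line_graph G \<and> is_cycle (induced G A) 3
    \<or> (isomorphic G (skeleton cube) \<or> isomorphic G (skeleton octahedron)
         \<or> isomorphic G (skeleton dodecahedron) \<or> isomorphic G (skeleton icosahedron)
         \<or> isomorphic G petersen_graph \<or> isomorphic G (complete_graph 6))
        \<and> shortest_cycle (induced G A) G"
proof -
  let ?N = "\<lambda>x. {y. {x, y} \<in> edges G}"
  have d: "0 < d" using assms(9) by simp
  interpret egraph "verts G" ?N d using egraph_of_graph assms(1-3,5) d by blast
  have gr: "gr = G"
  proof -
    have "{{x, y} |x y. x \<in> verts G \<and> y \<in> ?N x} = edges G"
    proof (intro set_eqI iffI)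
      fix E assume E: "E \<in> edges G"
      then obtain x y where "E = {x, y}" "x \<in> verts G"
        using assms(1) by (auto simp: simple_graph_def card_2_iff)
      then show "E \<in> {{x, y} |x y. x \<in> verts G \<and> y \<in> ?N x}" using E by auto
    qed auto
    then show ?thesis by (simp add: gr_def prod_eq_iff)
  qed
  have small: "small A"
    using assms(6,7,10) by (auto simp: small_def)
  have cut: "cut_size G A = c A"
  proof -
    \<comment> \<open>A cut edge is oriented by its unique end in \<open>A\<close>, which matches it
      with an ordered pair counted by \<open>e\<close>.\<close>
    have "bij_betw (\<lambda>(x, y). {x, y}) {(x, y). x \<in> A \<and> y \<in> ?N x \<inter> (verts G - A)}
        {E \<in> edges G. card (E \<inter> A) = 1}"
      unfolding bij_betw_def
    proof
      show "inj_on (\<lambda>(x, y). {x, y}) {(x, y). x \<in> A \<and> y \<in> ?N x \<inter> (verts G - A)}"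
        by (auto simp: inj_on_def doubleton_eq_iff)
      show "(\<lambda>(x, y). {x, y}) ` {(x, y). x \<in> A \<and> y \<in> ?N x \<inter> (verts G - A)} =
          {E \<in> edges G. card (E \<inter> A) = 1}"
      proof (intro set_eqI iffI)
        fix E assume "E \<in> {E \<in> edges G. card (E \<inter> A) = 1}"
        then have E: "E \<in> edges G" "card (E \<inter> A) = 1" by auto
        then have "card E = 2" "E \<subseteq> verts G" using assms(1) by (auto simp: simple_graph_def)
        obtain x where x: "E \<inter> A = {x}" using E(2) by (rule card_1_singletonE)
        obtain a b where ab: "E = {a, b}" "a \<noteq> b" using \<open>card E = 2\<close> by (auto simp: card_2_iff)
        then have "x = a \<or> x = b" using x by blast
        then obtain y where "E = {x, y}" "x \<noteq> y" using ab by blast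
        then have "(x, y) \<in> {(x, y). x \<in> A \<and> y \<in> ?N x \<inter> (verts G - A)}"
          using x E(1) \<open>E \<subseteq> verts G\<close> by auto
        then show "E \<in> (\<lambda>(x, y). {x, y}) ` {(x, y). x \<in> A \<and> y \<in> ?N x \<inter> (verts G - A)}"
          using \<open>E = {x, y}\<close> by force
      next
        fix E assume "E \<in> (\<lambda>(x, y). {x, y}) ` {(x, y). x \<in> A \<and> y \<in> ?N x \<inter> (verts G - A)}"
        then obtain x y where xy: "E = {x, y}" "x \<in> A" "y \<notin> A" "{x, y} \<in> edges G" by auto
        then have "E \<inter> A = {x}" by blast
        then show "E \<in> {E \<in> edges G. card (E \<inter> A) = 1}" using xy(1,4) by simp
      qed
    qed
    then show ?thesis
      unfolding cut_size_def c_def e_eq_card[OF assms(6,7)]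
        by (metis (no_types, lifting) bij_betw_same_card)
  qed
  have cA: "c A < 2 * d" using assms(9) cut by simp
  have pos: "1 \<le> card A" using assms(7,8) by (simp add: Suc_le_eq card_gt_0_iff)
  consider "card A = 1" | "card A = 2" | "3 \<le> card A" "d = 1" | "3 \<le> card A" "d = 2"
    | "3 \<le> card A" "d = 3" | "3 \<le> card A" "4 \<le> d"
    using pos d by linarith
  then show ?thesis
  proof cases
    case 1
    then show ?thesis using singleton_path[OF assms(6)] gr by simp
  next
    case 2
    then show ?thesis using pair_path[OF assms(6) _ cA] gr by simp
  next
    case 3
    \<comment> \<open>Degree 1 is the complete graph on two vertices, too small for
      \<open>A\<close>.\<close>
    have full: "card (?N x \<inter> ?N y) + 1 = d" if "x \<in> verts G" "y \<in> ?N x" for x y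
    proof -
      have "?N x = {y}"
        using N_card[OF that(1)] that(2) 3(2) by (metis card_1_singletonE singletonD)
      moreover have "y \<notin> ?N y" using N_irrefl N_V[OF that] by blast
      ultimately show ?thesis using 3(2) by simp
    qed
    have "finite (verts G)" "card (verts G) = 2" using complete[OF full] 3(2) by simp_all
    then show ?thesis using small 3(1) by (simp add: small_def)
  next
    case 4
    have "sep 1 A" using small pos by (rule small_sep)
    then obtain xs where xs: "ipath xs" "set xs = A" using degree2_ipath[OF 4(2)] cA 4(2) by auto
    then have "xs \<noteq> []" using assms(8) by auto
    then have "\<exists>k. isomorphic (induced G A) (path_graph k)"
      using ipath_path_graph[OF xs(1)] xs(2) gr by (metis length_greater_0_conv gr0_implies_Suc)
    moreover have "(\<exists>n. is_cycle G n) \<or> isomorphic G two_way_infinite_path"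
      using degree2_finite[OF 4(2)] degree2_infinite[OF 4(2)] gr by auto
    ultimately show ?thesis by blast
  next
    case 5
    have "cubic G" using assms(3) 5(2) by simp
    then show ?thesis using classification_cubic[OF 5(2) small 5(1) cA] unfolding gr by blast
  next
    case 6
    then show ?thesis using classification_not_cubic[OF 6(2) small 6(1) cA] unfolding gr by blast
  qed
qed

end
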